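(* Let $d\ge2$, and let $\omega_{N,d}=\{x_1,\dots,x_N\}$ denote the first $N$ elements of a greedy $s$-energy sequence on $\mathbb{S}^d$. Then there exist positive constants $c_{s,d},C_{s,d}$ such that the following hold for all integers $N\ge2$. (i) For $d-2\le s<d$, $s>0$, $$-c_{s,d}N^{1+\frac sd}\le E_s(\omega_{N,d})-I_{s,d}N^2\le -C_{s,d}N^{1+\frac sd}.$$ (ii) For $s=0$, $d=2$, $$-\tfrac12N\log N-c_{0,2}N\le E_0(\omega_{N,2})-I_{0,2}N^2\le -C_{0,2}N\log N.$$
   Context: $\mathbb{S}^d=\{x\in\mathbb{R}^{d+1}:\|x\|=1\}$ with $\|\cdot\|$ the Euclidean norm; $\sigma$ is the normalized uniform (surface) probability measure on $\mathbb{S}^d$. The Riesz $s$-kernel is $K_s(x,y)=\frac1s\|x-y\|^{-s}$ for $s\ne0$ and $K_0(x,y)=-\log\|x-y\|$ (with value $+\infty$ on the diagonal when $s\ge0$). The energy is $E_s(\omega_{N,d})=\sum_{i\neq j}K_s(x_i,x_j)$ (sum over ordered pairs), and $I_{s,d}=\int_{\mathbb{S}^d}\int_{\mathbb{S}^d}K_s(x,y)\,d\sigma(x)\,d\sigma(y)$ for $s<d$. A greedy $s$-energy sequence $\{x_n\}_{n\ge1}$ is obtained by taking an arbitrary $x_1\in\mathbb{S}^d$ and, for each $N\ge1$, choosing $x_{N+1}$ to be any minimizer of $x\mapsto\sum_{i=1}^N K_s(x,x_i)$ over $\mathbb{S}^d$. *)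

theory Defs
  imports "HOL-Analysis.Analysis"
begin

text \<open>
  The normalized surface measure on the unit sphere, as a Borel measure on the ambient space:
  the measure of \<open>A\<close> is the fraction of the unit ball whose radial projection \<open>sgn x = x / norm x\<close>
  lies in \<open>A\<close>. (Note \<open>sgn 0 = 0\<close>, on a null set.) It is a rotation-invariant probability
  measure carried by the sphere, see the lemmas below.
\<close>

definition sphere_measure :: "'a::euclidean_space measure" where
  "sphere_measure = distr (uniform_measure lborel (ball 0 1)) borel sgn"

definition riesz_kernel :: "real \<Rightarrow> 'a::real_normed_vector \<Rightarrow> 'a \<Rightarrow> ereal" where
  "riesz_kernel s x y =
     (if s \<ge> 0 \<and> x = y then \<infinity>
      else if s = 0 then ereal (- ln (norm (x - y)))
      else ereal (1 / s * norm (x - y) powr (- s)))"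

definition riesz_energy :: "real \<Rightarrow> (nat \<Rightarrow> 'a::real_normed_vector) \<Rightarrow> nat \<Rightarrow> ereal" where
  "riesz_energy s x N = (\<Sum>i\<in>{1..N}. \<Sum>j\<in>{1..N} - {i}. riesz_kernel s (x i) (x j))"

text \<open>
  The constant \<open>I\<^bsub>s,d\<^esub>\<close>, where \<open>'a\<close> is the ambient space of dimension \<open>d + 1\<close>. Only meaningful
  for \<open>s < d\<close>. The function \<open>real_of_ereal\<close> changes the kernel only on the diagonal, which is a
  null set.
\<close>

definition sphere_energy :: "'a::euclidean_space itself \<Rightarrow> real \<Rightarrow> real" where
  "sphere_energy _ s =
     (\<integral>x. (\<integral>y. real_of_ereal (riesz_kernel s x y) \<partial>sphere_measure) \<partial>(sphere_measure :: 'a measure))"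

text \<open>Sequences are indexed from 1; the value at 0 is irrelevant.\<close>

definition greedy_sequence :: "real \<Rightarrow> (nat \<Rightarrow> 'a::real_normed_vector) \<Rightarrow> bool" where
  "greedy_sequence s x \<longleftrightarrow>
     x 1 \<in> sphere 0 1 \<and>
     (\<forall>N\<ge>1. is_arg_min (\<lambda>y. \<Sum>i\<in>{1..N}. riesz_kernel s y (x i)) (\<lambda>y. y \<in> sphere 0 1) (x (Suc N)))"

lemma sets_sphere_measure [simp, measurable_cong]: "sets sphere_measure = sets borel"
  by (simp add: sphere_measure_def)

lemma space_sphere_measure [simp]: "space sphere_measure = UNIV"
  by (simp add: sphere_measure_def)

lemma sgn_measurable_borel [measurable]:
  "(sgn :: 'a::euclidean_space \<Rightarrow> 'a) \<in> borel_measurable borel"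
  unfolding sgn_div_norm[abs_def] by measurable

lemma emeasure_unit_ball_neq [simp]:
  "emeasure lborel (ball 0 1 :: 'a::euclidean_space set) \<noteq> 0"
  "emeasure lborel (ball 0 1 :: 'a::euclidean_space set) \<noteq> \<infinity>"
  using content_ball_pos[of 1 "0::'a"] emeasure_lborel_ball_finite[of "0::'a" 1]
  by (auto simp: measure_def)

lemma emeasure_sphere_measure:
  fixes A :: "'a::euclidean_space set"
  assumes [measurable]: "A \<in> sets borel"
  shows "emeasure sphere_measure A
           = emeasure lborel (ball 0 1 \<inter> sgn -` A) / emeasure lborel (ball 0 1 :: 'a set)"
proof -
  have [measurable]: "sgn -` A \<in> sets (borel :: 'a measure)"
    using measurable_sets[OF sgn_measurable_borel assms] by simp
  show ?thesis
    unfolding sphere_measure_def by (subst emeasure_distr) auto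
qed

lemma emeasure_sphere_measure_UNIV: "emeasure sphere_measure (UNIV :: 'a::euclidean_space set) = 1"
  using emeasure_unit_ball_neq[where 'a = 'a]
  by (simp add: emeasure_sphere_measure ennreal_divide_self less_top)

lemma AE_sphere_measure: "AE x in sphere_measure. x \<in> sphere (0 :: 'a::euclidean_space) 1"
proof -
  have "AE x in lborel. x \<noteq> (0::'a)"
    by (rule AE_lborel_singleton)
  hence "AE x in uniform_measure lborel (ball 0 1). sgn x \<in> sphere (0::'a) 1"
    by (intro AE_uniform_measureI) (auto simp: norm_sgn)
  thus ?thesis
    unfolding sphere_measure_def by (subst AE_distr_iff) auto
qed

lemma emeasure_sphere_measure_sphere:
  "emeasure sphere_measure (sphere (0 :: 'a::euclidean_space) 1) = 1"
proof -
  have "emeasure sphere_measure (sphere (0::'a) 1) = emeasure sphere_measure (UNIV :: 'a set)"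
    using AE_sphere_measure by (intro emeasure_eq_AE) auto
  thus ?thesis by (simp add: emeasure_sphere_measure_UNIV)
qed

text \<open>
  Lebesgue measure is invariant under orthogonal maps, by comparing \<open>lborel\<close> with its
  (translation-invariant) image measure on the unit ball, as in the uniqueness proof for Haar
  measure.
\<close>

lemma lborel_distr_orthogonal:
  fixes T :: "'a::euclidean_space \<Rightarrow> 'a"
  assumes T: "orthogonal_transformation T"
  shows "distr lborel borel T = lborel"
proof (rule measure_eqI)
  have lin: "linear T" using T by (rule orthogonal_transformation_linear)
  have [measurable]: "T \<in> borel_measurable borel"
    using lin by (intro borel_measurable_continuous_onI linear_continuous_on)
                 (simp add: linear_conv_bounded_linear)
  define M where "M = distr lborel borel T"
  have sM [simp, measurable_cong]: "sets M = sets borel" by (simp add: M_def)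
  have spM [simp]: "space M = UNIV" by (simp add: M_def)
  have ball: "emeasure M (ball a r) = emeasure lborel (ball 0 r :: 'a set)" for a r
  proof -
    obtain b where b: "T b = a" using orthogonal_transformation_surj[OF T] by (metis surjD)
    have "T -` ball a r = ball b r"
      using T by (auto simp: b[symmetric] dist_norm orthogonal_transformation_norm
                       simp flip: linear_diff[OF lin])
    hence "emeasure M (ball a r) = emeasure lborel (ball b r)"
      by (simp add: M_def emeasure_distr)
    also have "\<dots> = emeasure lborel (ball 0 r :: 'a set)"
      by (cases "r \<ge> 0") (simp_all add: emeasure_ball ball_empty)
    finally show ?thesis .
  qed
  have sf: "sigma_finite_measure M"
  proof
    let ?F = "range (\<lambda>n::nat. ball (0::'a) (real n))"
    have "\<exists>n::nat. norm x < real n" for x :: 'a by (rule reals_Archimedean2)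
    hence "\<Union>?F = UNIV" by auto
    moreover have "emeasure M a \<noteq> \<infinity>" if "a \<in> ?F" for a
      using that ball emeasure_lborel_ball_finite[of "0::'a"]
      by (auto simp: less_top)
    ultimately show "\<exists>A. countable A \<and> A \<subseteq> sets M \<and> \<Union> A = space M \<and> (\<forall>a\<in>A. emeasure M a \<noteq> \<infinity>)"
      by (intro exI[of _ ?F]) auto
  qed
  interpret M: sigma_finite_measure M by (fact sf)
  interpret P: pair_sigma_finite lborel M ..
  have shift: "(\<integral>\<^sup>+y. f (x + y) \<partial>M) = (\<integral>\<^sup>+y. f y \<partial>M)"
    if [measurable]: "f \<in> borel_measurable borel" for f :: "'a \<Rightarrow> ennreal" and x
  proof -
    obtain b where b: "T b = x" using orthogonal_transformation_surj[OF T] by (metis surjD)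
    have "(\<integral>\<^sup>+y. f (x + y) \<partial>M) = (\<integral>\<^sup>+y. f (T (b + y)) \<partial>lborel)"
      by (simp add: M_def nn_integral_distr linear_add[OF lin] b)
    also have "\<dots> = (\<integral>\<^sup>+y. f (T y) \<partial>distr lborel borel ((+) b))"
      by (subst nn_integral_distr) auto
    also have "\<dots> = (\<integral>\<^sup>+y. f y \<partial>M)"
      by (simp add: lborel_distr_plus M_def nn_integral_distr)
    finally show ?thesis .
  qed
  show "sets (distr lborel borel T) = sets lborel" by simp
  fix A :: "'a set"
  assume "A \<in> sets (distr lborel borel T)"
  hence [measurable]: "A \<in> sets borel" by simp
  let ?B = "ball 0 1 :: 'a set"
  have [measurable, simp]: "?B \<in> sets borel" by (intro borel_open open_ball)
  have [measurable]: "(\<lambda>z. indicator A (fst z + snd z) :: ennreal) \<in> borel_measurable (lborel \<Otimes>\<^sub>M M)"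
    by (rule measurable_compose[where N = borel and f = "\<lambda>z. fst z + snd z" and g = "indicator A"]) auto
  have [measurable]: "(\<lambda>z. indicator ?B (fst z - snd z) :: ennreal) \<in> borel_measurable (lborel \<Otimes>\<^sub>M M)"
    by (rule measurable_compose[where N = borel and f = "\<lambda>z. fst z - snd z" and g = "indicator ?B"]) auto
  have [measurable]: "(\<lambda>z. indicator ?B (fst z) :: ennreal) \<in> borel_measurable (lborel \<Otimes>\<^sub>M M)"
    by (rule measurable_compose[where N = borel and f = "fst" and g = "indicator ?B"]) auto
  have "emeasure lborel ?B * emeasure M A
          = (\<integral>\<^sup>+x. (\<integral>\<^sup>+y. indicator ?B x * indicator A y \<partial>M) \<partial>lborel)"
    by (subst nn_integral_cmult, simp, subst nn_integral_multc) auto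
  also have "\<dots> = (\<integral>\<^sup>+x. (\<integral>\<^sup>+y. indicator ?B x * indicator A (x + y) \<partial>M) \<partial>lborel)"
    by (subst (2) nn_integral_cmult) (auto simp: nn_integral_cmult shift[of "indicator A"])
  also have "\<dots> = (\<integral>\<^sup>+y. (\<integral>\<^sup>+x. indicator ?B x * indicator A (x + y) \<partial>lborel) \<partial>M)"
    by (rule P.Fubini'[symmetric]) (simp add: split_beta')
  also have "\<dots> = (\<integral>\<^sup>+y. (\<integral>\<^sup>+x. indicator ?B (x - y) * indicator A x \<partial>lborel) \<partial>M)"
  proof (rule nn_integral_cong)
    fix y
    have "(\<integral>\<^sup>+x. indicator ?B (x - y) * indicator A x \<partial>lborel)
            = (\<integral>\<^sup>+x. indicator ?B (x - y) * indicator A x \<partial>distr lborel borel ((+) y))"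
      by (simp add: lborel_distr_plus)
    also have "\<dots> = (\<integral>\<^sup>+x. indicator ?B x * indicator A (x + y) \<partial>lborel)"
      by (subst nn_integral_distr) (auto simp: add.commute)
    finally show "(\<integral>\<^sup>+x. indicator ?B x * indicator A (x + y) \<partial>lborel)
        = (\<integral>\<^sup>+x. indicator ?B (x - y) * indicator A x \<partial>lborel)" by simp
  qed
  also have "\<dots> = (\<integral>\<^sup>+x. (\<integral>\<^sup>+y. indicator ?B (x - y) * indicator A x \<partial>M) \<partial>lborel)"
    by (rule P.Fubini') (simp add: split_beta')
  also have "\<dots> = (\<integral>\<^sup>+x. (\<integral>\<^sup>+y. indicator (ball x 1) y * indicator A x \<partial>M) \<partial>lborel)"
    by (intro nn_integral_cong) (auto simp: indicator_def dist_norm norm_minus_commute)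
  also have "\<dots> = emeasure lborel ?B * emeasure lborel A"
  proof -
    have bx [simp]: "ball x 1 \<in> sets borel" for x :: 'a by (intro borel_open open_ball)
    have "(\<integral>\<^sup>+y. indicator (ball x 1) y * indicator A x \<partial>M) = emeasure lborel ?B * indicator A x" for x
      by (subst nn_integral_multc) (auto simp: ball intro!: borel_measurable_indicator)
    thus ?thesis by (simp add: nn_integral_cmult)
  qed
  finally have "emeasure lborel ?B * emeasure M A = emeasure lborel ?B * emeasure lborel A" .
  hence "emeasure M A = emeasure lborel A"
    using emeasure_unit_ball_neq[where 'a = 'a] by (auto simp: ennreal_mult_cancel_left)
  thus "emeasure (distr lborel borel T) A = emeasure lborel A" by (simp add: M_def)
qed

lemma sphere_measure_distr_orthogonal:
  fixes T :: "'a::euclidean_space \<Rightarrow> 'a"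
  assumes T: "orthogonal_transformation T"
  shows "distr sphere_measure borel T = sphere_measure"
proof (rule measure_eqI)
  have lin: "linear T" using T by (rule orthogonal_transformation_linear)
  have [measurable]: "T \<in> borel_measurable borel"
    using lin by (intro borel_measurable_continuous_onI linear_continuous_on)
                 (simp add: linear_conv_bounded_linear)
  show "sets (distr sphere_measure borel T) = sets sphere_measure" by simp
  fix A :: "'a set"
  assume "A \<in> sets (distr sphere_measure borel T)"
  hence A [measurable]: "A \<in> sets borel" by simp
  have TA [measurable]: "T -` A \<in> sets borel"
    using measurable_sets[OF \<open>T \<in> borel_measurable borel\<close> A] by simp
  have [measurable]: "sgn -` A \<in> sets (borel :: 'a measure)"
    using measurable_sets[OF sgn_measurable_borel A] by simp
  have "sgn (T x) = T (sgn x)" for x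
    using T by (simp add: sgn_div_norm orthogonal_transformation_norm linear_scale[OF lin])
  hence *: "ball 0 1 \<inter> sgn -` (T -` A) = T -` (ball 0 1 \<inter> sgn -` A)"
    using T by (auto simp: orthogonal_transformation_norm)
  have "emeasure lborel (ball 0 1 \<inter> sgn -` (T -` A))
          = emeasure (distr lborel borel T) (ball 0 1 \<inter> sgn -` A)"
    unfolding * by (subst emeasure_distr) auto
  also have "\<dots> = emeasure lborel (ball 0 1 \<inter> sgn -` A)"
    by (simp only: lborel_distr_orthogonal[OF T])
  finally show "emeasure (distr sphere_measure borel T) A = emeasure sphere_measure A"
    by (simp add: emeasure_distr emeasure_sphere_measure)
qed

end

theory Submission
  imports Defs "HOL-Probability.Probability" "HOL-Complex_Analysis.Complex_Analysis"
begin

text \<open>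
  The lower bounds hold for every configuration. The kernel dominates the second difference
  \<open>k = 2 k\<^sub>h - k\<^sub>2\<^sub>h\<close> of its regularisation \<open>k\<^sub>h = (r\<^sup>2 + h) powr (- s / 2)\<close> (respectively \<open>- ln (r\<^sup>2 + h) / 2\<close>),
  which is a power series in \<open>x \<bullet> y\<close> with nonnegative coefficients and therefore satisfies
  \<open>(\<Sum>i j. k x\<^sub>i x\<^sub>j) \<ge> N\<^sup>2 I(k)\<close>. The diagonal terms and the difference of the integrals are both of
  the right order for \<open>h = N powr (- 2 / d)\<close>.

  For the upper bounds, the energy of a greedy sequence is twice the sum of the minima \<open>u\<^sub>n\<close> of the
  potentials \<open>U\<^sub>n\<close> of the first \<open>n\<close> points, so one needs \<open>u\<^sub>n\<close> to lie well below the mean of \<open>U\<^sub>n\<close>.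
  If \<open>\<nu>\<^sub>y\<close> are probability measures such that the \<open>\<nu>\<^sub>y\<close>-average of the kernel is below the kernel by a gap
  concentrated near \<open>y\<close>, then averaging \<open>U\<^sub>n \<ge> u\<^sub>n\<close> bounds \<open>U\<^sub>n y - u\<^sub>n\<close> from below by the sum of the gaps
  at the \<open>n\<close> points, minus the mean of that sum once the gap is normalised; integrating over the union of small caps
  about the points gives the required estimate. For \<open>s > 0\<close> the measures come from sweeping a point
  mass onto the sphere by a Moebius transformation, and combining two of them at levels \<open>h\<close> and \<open>2 h\<close>
  makes the gap decay fast enough; positivity of the combination needs \<open>d - 2 \<le> s\<close>.

  For \<open>s = 0\<close>, \<open>d = 2\<close> the measures are uniform measures on circles about \<open>y\<close>. Now \<open>n I - u\<^sub>n\<close> may stay bounded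
  for some \<open>n\<close>, so \<open>u\<^sub>n\<close> alone does not suffice. The same inequality shows that greedy points are separated by
  a multiple of \<open>n powr (- 1 / 2)\<close>; averaging the potential over disjoint caps about the points then bounds
  the energy by \<open>n\<^sup>2 I - n ln n / 2\<close> plus a multiple of \<open>n (n I - u\<^sub>n)\<close>. Hence a deficit
  \<open>n\<^sup>2 I - E\<^sub>n\<close> that is too small forces a large \<open>n I - u\<^sub>n\<close>, which makes the deficit grow, and
  the resulting recursion gives order \<open>n ln n\<close>.
\<close>

section \<open>The distribution of chords\<close>

text \<open>A single regularisation would leave a gap of order \<open>h * r powr (-s - 2)\<close> at
  large \<open>r\<close>, whose mean acquires a factor \<open>ln (1 / h)\<close> at the endpoint
  \<open>s = d - 2\<close>, the logarithmic case on the two-dimensional sphere included. The second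
  difference decays like \<open>h\<^sup>2 * r powr (-s - 4)\<close>, so its mean is governed by
  distances of order \<open>sqrt h\<close>. This is why the two levels \<open>h\<close> and
  \<open>2 * h\<close> occur in both estimates for \<open>s > 0\<close> and in the lower logarithmic
  one.

  For \<open>s > 0\<close> no density of the chord length is computed: rotation invariance moves
  zonal integrals to one measure on the line, and only its two-sided growth \<open>r ^ d\<close> at
  small radii matters. For \<open>s = 0\<close> exact cap measures are used, and these are derived
  from the circle means themselves.

  For the logarithmic kernel a gap living on a cap of measure \<open>b\<close> of order
  \<open>1 / n\<close> has mean of order \<open>b\<close> only. The argument with caps then gives a
  bounded gain per step, hence a deficit of order \<open>N\<close>; the missing factor
  \<open>ln N\<close> has to come from comparing the energy with the minima.\<close>

lemma prob_space_sphere_measure: "prob_space (sphere_measure :: 'a::euclidean_space measure)"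
  by (rule prob_spaceI) (simp add: emeasure_sphere_measure_UNIV)

text \<open>The law of the distance to a pole. The pole is an arbitrary choice, which
  \<open>distr_chord\<close> shows to be immaterial; afterwards every integral of a function of
  \<open>norm (x - y)\<close> is an integral against this one measure.\<close>

definition chord_measure :: "'a::euclidean_space itself \<Rightarrow> real measure" where
  "chord_measure _ = distr sphere_measure borel (\<lambda>y. norm ((SOME e. e \<in> sphere (0::'a) 1) - y))"

lemma sets_chord_measure [simp, measurable_cong]: "sets (chord_measure TYPE('a::euclidean_space)) = sets borel"
  by (simp add: chord_measure_def)

lemma space_chord_measure [simp]: "space (chord_measure TYPE('a::euclidean_space)) = UNIV"
  by (simp add: chord_measure_def)

lemma prob_space_chord_measure: "prob_space (chord_measure TYPE('a::euclidean_space))"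
  unfolding chord_measure_def
  by (intro prob_space.prob_space_distr prob_space_sphere_measure) simp

definition reflect_along :: "'a::real_inner \<Rightarrow> 'a \<Rightarrow> 'a" where
  "reflect_along w u = u - (2 * (u \<bullet> w) / (w \<bullet> w)) *\<^sub>R w"

lemma orthogonal_transformation_reflect_along:
  fixes w :: "'a::euclidean_space"
  assumes "w \<noteq> 0"
  shows "orthogonal_transformation (reflect_along w)"
  unfolding orthogonal_transformation_def
proof (intro conjI allI)
  have w: "w \<bullet> w \<noteq> 0" using assms by simp
  show "linear (reflect_along w)"
    by (rule linearI) (simp_all add: reflect_along_def inner_add_left algebra_simps add_divide_distrib)
  show "reflect_along w u \<bullet> reflect_along w v = u \<bullet> v" for u v
    using w by (simp add: reflect_along_def inner_diff_left inner_diff_right inner_commute field_simps)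
qed

text \<open>The reflection in the hyperplane bisecting \<open>x\<close> and \<open>y\<close> does
  it: \<open>2 * (x \<bullet> u) = u \<bullet> u\<close> for \<open>u = x - y\<close> because the
  norms agree.\<close>

lemma orthogonal_transformation_exists_unit:
  fixes x y :: "'a::euclidean_space"
  assumes "norm x = norm y"
  obtains T where "orthogonal_transformation T" "T x = y"
proof (cases "x = y")
  case True
  thus ?thesis by (intro that[of "\<lambda>z. z"]) auto
next
  case False
  define u where "u = x - y"
  have u: "u \<bullet> u \<noteq> 0" using False by (simp add: u_def)
  have "x \<bullet> x = y \<bullet> y" using assms by (simp add: dot_square_norm)
  hence "2 * (x \<bullet> u) = u \<bullet> u"
    by (simp add: u_def inner_diff_left inner_diff_right inner_commute)
  hence "reflect_along u x = y" using u by (simp add: reflect_along_def) (simp add: u_def)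
  with u show ?thesis by (intro that[OF orthogonal_transformation_reflect_along]) auto
qed

lemma distr_chord:
  fixes x :: "'a::euclidean_space"
  assumes "norm x = 1"
  shows "distr sphere_measure borel (\<lambda>y. norm (x - y)) = chord_measure TYPE('a)"
proof -
  define e :: 'a where "e = (SOME e. e \<in> sphere 0 1)"
  have "e \<in> sphere 0 1"
    unfolding e_def by (rule someI[where x = x]) (use assms in auto)
  then obtain T where T: "orthogonal_transformation T" "T x = e"
    using orthogonal_transformation_exists_unit[of x e] assms by (auto simp: algebra_simps)
  have lin: "linear T" using T by (simp add: orthogonal_transformation_linear)
  have [measurable]: "T \<in> borel_measurable borel"
    using lin by (intro borel_measurable_continuous_onI linear_continuous_on)
                 (simp add: linear_conv_bounded_linear)
  have "chord_measure TYPE('a) = distr (distr sphere_measure borel T) borel (\<lambda>y. norm (e - y))"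
    by (simp add: chord_measure_def e_def sphere_measure_distr_orthogonal[OF T(1)])
  also have "\<dots> = distr sphere_measure borel (\<lambda>y. norm (e - T y))"
    by (subst distr_distr) (auto simp: comp_def)
  also have "(\<lambda>y. norm (e - T y)) = (\<lambda>y. norm (x - y))"
    using T by (simp flip: T(2) linear_diff[OF lin] add: orthogonal_transformation_norm)
  finally show ?thesis by simp
qed

lemma nn_integral_chord:
  fixes x :: "'a::euclidean_space"
  assumes "norm x = 1" and [measurable]: "f \<in> borel_measurable borel"
  shows "(\<integral>\<^sup>+y. f (norm (x - y)) \<partial>sphere_measure) = (\<integral>\<^sup>+r. f r \<partial>chord_measure TYPE('a))"
  by (subst distr_chord[OF assms(1), symmetric], subst nn_integral_distr) auto

lemma integral_chord:
  fixes x :: "'a::euclidean_space" and f :: "real \<Rightarrow> real"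
  assumes "norm x = 1" and [measurable]: "f \<in> borel_measurable borel"
  shows "(\<integral>y. f (norm (x - y)) \<partial>sphere_measure) = (\<integral>r. f r \<partial>chord_measure TYPE('a))"
  by (subst distr_chord[OF assms(1), symmetric], subst integral_distr) auto

lemma integrable_chord:
  fixes x :: "'a::euclidean_space" and f :: "real \<Rightarrow> real"
  assumes "norm x = 1" and [measurable]: "f \<in> borel_measurable borel"
  shows "integrable sphere_measure (\<lambda>y. f (norm (x - y))) \<longleftrightarrow> integrable (chord_measure TYPE('a)) f"
  by (subst distr_chord[OF assms(1), symmetric], subst integrable_distr_eq) auto

lemma emeasure_chord:
  fixes x :: "'a::euclidean_space"
  assumes "norm x = 1" and [measurable]: "A \<in> sets borel"
  shows "emeasure sphere_measure {y. norm (x - y) \<in> A} = emeasure (chord_measure TYPE('a)) A"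
  by (subst distr_chord[OF assms(1), symmetric], subst emeasure_distr) (auto simp: vimage_def)

lemma ex_unit_vector: "\<exists>e::'a::euclidean_space. norm e = 1"
  using vector_choose_size[of 1] by auto

section \<open>Measure of small spherical caps\<close>

lemma emeasure_lborel_box_Basis:
  fixes f g :: "'a::euclidean_space \<Rightarrow> real"
  assumes "\<And>b. b \<in> Basis \<Longrightarrow> f b \<le> g b"
  shows "emeasure lborel (cbox (\<Sum>b\<in>Basis. f b *\<^sub>R b) (\<Sum>b\<in>Basis. g b *\<^sub>R b)) = ennreal (\<Prod>b\<in>Basis. g b - f b)"
  using assms by (subst emeasure_lborel_cbox) (auto simp: inner_diff_left intro!: prod.cong arg_cong[of _ _ ennreal])

lemma prod_Basis_if:
  fixes e :: "'a::euclidean_space" and p q :: real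
  assumes "e \<in> Basis"
  shows "(\<Prod>b\<in>Basis. if b = e then p else q) = p * q ^ (DIM('a) - 1)"
proof -
  have "(\<Prod>b\<in>Basis - {e}. if b = e then p else q) = (\<Prod>b\<in>Basis - {e}. q)"
    by (intro prod.cong) auto
  thus ?thesis using assms by (simp add: prod.remove[of _ e] card_Diff_singleton)
qed

text \<open>The part of the unit ball lying over the cap is a thin cone around the axis
  \<open>e\<close>. It fits into a box with half side 1 along \<open>e\<close> and half side
  \<open>r\<close> in the other directions.\<close>

lemma emeasure_cap_le:
  fixes e :: "'a::euclidean_space"
  assumes e: "e \<in> Basis" and r: "r \<ge> 0"
  shows "emeasure sphere_measure {y. norm (e - y) \<le> r}
         \<le> ennreal (2 ^ DIM('a) / measure lborel (ball (0::'a) 1) * r ^ (DIM('a) - 1))"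
proof -
  let ?a = "(\<Sum>b\<in>Basis. (if b = e then 1 else r) *\<^sub>R b) :: 'a"
  have minus: "- ?a = (\<Sum>b\<in>Basis. (- (if b = e then 1 else r)) *\<^sub>R b)"
    by (simp add: sum_negf)
  have "ball 0 1 \<inter> sgn -` {y. norm (e - y) \<le> r} \<subseteq> cbox (- ?a) ?a"
  proof
    fix x :: 'a assume x: "x \<in> ball 0 1 \<inter> sgn -` {y. norm (e - y) \<le> r}"
    hence nx: "norm x \<le> 1" and sg: "norm (e - sgn x) \<le> r" by auto
    have "\<bar>x \<bullet> b\<bar> \<le> ?a \<bullet> b" if b: "b \<in> Basis" for b
    proof (cases "b = e")
      case True
      have "\<bar>x \<bullet> b\<bar> \<le> 1" using Basis_le_norm[OF b, of x] nx by linarith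
      thus ?thesis using True b by (simp only: inner_sum_left_Basis) simp
    next
      case False
      have "x \<bullet> b = norm x * ((sgn x - e) \<bullet> b)"
        using False b e by (cases "x = 0") (simp_all add: inner_diff_left sgn_div_norm inner_Basis)
      also have "\<bar>\<dots>\<bar> \<le> 1 * norm (sgn x - e)"
        unfolding abs_mult using nx Basis_le_norm[OF b, of "sgn x - e"]
        by (intro mult_mono) auto
      also have "\<dots> \<le> r" using sg by (simp add: norm_minus_commute)
      finally show ?thesis using False b by (simp only: inner_sum_left_Basis) simp
    qed
    thus "x \<in> cbox (- ?a) ?a" by (force simp: mem_box abs_le_iff)
  qed
  hence "emeasure lborel (ball 0 1 \<inter> sgn -` {y. norm (e - y) \<le> r}) \<le> emeasure lborel (cbox (- ?a) ?a)"
    by (intro emeasure_mono) auto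
  also have "\<dots> = ennreal (\<Prod>b\<in>Basis. 2 * (if b = e then 1 else r))"
    using r unfolding minus by (subst emeasure_lborel_box_Basis) (auto intro!: arg_cong[of _ _ ennreal] prod.cong)
  also have "(\<Prod>b\<in>Basis. 2 * (if b = e then 1 else r)) = 2 ^ DIM('a) * (\<Prod>b\<in>Basis. (if b = e then 1 else r))"
    by (simp add: prod.distrib)
  also have "(\<Prod>b\<in>Basis. (if b = e then 1 else r)) = r ^ (DIM('a) - 1)"
    using e by (subst prod_Basis_if) auto
  finally have *: "emeasure lborel (ball 0 1 \<inter> sgn -` {y. norm (e - y) \<le> r}) \<le> ennreal (2 ^ DIM('a) * r ^ (DIM('a) - 1))" .
  have vol: "emeasure lborel (ball (0::'a) 1) = ennreal (measure lborel (ball (0::'a) 1))"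
    by (rule emeasure_eq_ennreal_measure) (use emeasure_unit_ball_neq(2) in simp)
  have pos: "measure lborel (ball (0::'a) 1) > 0" by (rule content_ball_pos) simp
  show ?thesis
    by (subst emeasure_sphere_measure)
       (use divide_right_mono_ennreal[OF *, of "emeasure lborel (ball (0::'a) 1)"] pos r in
         \<open>auto simp: vol divide_ennreal mult_ac\<close>)
qed

text \<open>The cone over the cap contains a box away from the apex, at heights between 1/4 and 1/2
  along \<open>e\<close>, with sides proportional to \<open>r\<close> in the other
  directions.\<close>

lemma emeasure_cap_ge:
  fixes e :: "'a::euclidean_space"
  assumes e: "e \<in> Basis" and r: "0 < r" "r \<le> 1"
  shows "emeasure sphere_measure {y. norm (e - y) \<le> r}
         \<ge> ennreal (1 / 4 * (r / (8 * DIM('a))) ^ (DIM('a) - 1) / measure lborel (ball (0::'a) 1))"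
proof -
  \<comment> \<open>With this half side the tangential part \<open>w\<close> of a point of the box
    has norm at most \<open>r / 16\<close>, and since \<open>norm x \<ge> 1 / 4\<close> the radial
    projection moves it at most \<open>8 * norm w\<close> away from \<open>e\<close>.\<close>
  define q where "q = r / (16 * DIM('a))"
  have q: "q > 0" using r by (simp add: q_def)
  let ?a = "(\<Sum>b\<in>Basis. (if b = e then 1/4 else - q) *\<^sub>R b) :: 'a"
  let ?b = "(\<Sum>b\<in>Basis. (if b = e then 1/2 else q) *\<^sub>R b) :: 'a"
  have "cbox ?a ?b \<subseteq> ball 0 1 \<inter> sgn -` {y. norm (e - y) \<le> r}"
  proof
    fix x :: 'a assume x: "x \<in> cbox ?a ?b"
    have xe: "1/4 \<le> x \<bullet> e" "x \<bullet> e \<le> 1/2"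
      using x e by (simp_all only: mem_box inner_sum_left_Basis) auto
    have xb: "\<bar>x \<bullet> b\<bar> \<le> q" if "b \<in> Basis - {e}" for b
    proof -
      have "?a \<bullet> b \<le> x \<bullet> b" "x \<bullet> b \<le> ?b \<bullet> b" using x that by (auto simp: mem_box)
      moreover have "?a \<bullet> b = (if b = e then 1/4 else - q)" "?b \<bullet> b = (if b = e then 1/2 else q)"
        using that by (intro inner_sum_left_Basis; simp)+
      ultimately show ?thesis using that by auto
    qed
    define w where "w = x - (x \<bullet> e) *\<^sub>R e"
    have "norm w \<le> (\<Sum>b\<in>Basis. \<bar>w \<bullet> b\<bar>)" by (rule norm_le_l1)
    also have "\<dots> \<le> (\<Sum>b\<in>(Basis::'a set). q)"
    proof (rule sum_mono)
      fix b :: 'a assume b: "b \<in> Basis"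
      show "\<bar>w \<bullet> b\<bar> \<le> q"
        using xb[of b] b e q by (cases "b = e") (auto simp: w_def inner_diff_left inner_Basis)
    qed
    also have "\<dots> = r / 16" by (simp add: q_def)
    finally have w: "norm w \<le> r / 16" .
    have ne: "norm e = 1" using e by simp
    have xw: "x = (x \<bullet> e) *\<^sub>R e + w" by (simp add: w_def)
    have "norm x \<le> \<bar>x \<bullet> e\<bar> + norm w"
      by (subst xw) (use norm_triangle_ineq[of "(x \<bullet> e) *\<^sub>R e" w] ne in simp)
    hence n1: "norm x < 1" using xe w r by simp
    have n2: "norm x \<ge> 1/4" using Basis_le_norm[OF e, of x] xe by simp
    have n3: "\<bar>norm x - x \<bullet> e\<bar> \<le> norm w"
      using norm_triangle_ineq3[of x "(x \<bullet> e) *\<^sub>R e"] ne xe by (simp add: w_def)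
    have "(norm x - x \<bullet> e) *\<^sub>R e - w = norm x *\<^sub>R e - x"
      by (simp add: w_def scaleR_diff_left)
    moreover have n0: "norm x \<noteq> 0" using n2 by linarith
    ultimately have "inverse (norm x) *\<^sub>R ((norm x - x \<bullet> e) *\<^sub>R e - w) = e - sgn x"
      using n0 by (simp add: scaleR_diff_right sgn_div_norm)
    hence "norm (e - sgn x) = norm (inverse (norm x) *\<^sub>R ((norm x - x \<bullet> e) *\<^sub>R e - w))"
      by simp
    hence "norm (e - sgn x) = norm ((norm x - x \<bullet> e) *\<^sub>R e - w) / norm x"
      by (simp add: divide_inverse mult.commute)
    also have "\<dots> \<le> (2 * norm w) / (1/4)"
      using n2 n3 norm_triangle_ineq4[of "(norm x - x \<bullet> e) *\<^sub>R e" w] ne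
      by (intro frac_le) auto
    also have "\<dots> \<le> r" using w r by simp
    finally show "x \<in> ball 0 1 \<inter> sgn -` {y. norm (e - y) \<le> r}" using n1 by simp
  qed
  hence "emeasure lborel (cbox ?a ?b) \<le> emeasure lborel (ball 0 1 \<inter> sgn -` {y. norm (e - y) \<le> r})"
    by (intro emeasure_mono sets.Int) (auto intro!: measurable_sets_borel[OF sgn_measurable_borel])
  also have "emeasure lborel (cbox ?a ?b) = ennreal (\<Prod>b\<in>Basis. (if b = e then 1/4 else 2 * q))"
    using q by (subst emeasure_lborel_box_Basis) (auto intro!: arg_cong[of _ _ ennreal] prod.cong)
  also have "(\<Prod>b\<in>Basis. (if b = e then 1/4 else 2 * q)) = 1/4 * (2 * q) ^ (DIM('a) - 1)"
    using e by (rule prod_Basis_if)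
  finally have *: "ennreal (1/4 * (2 * q) ^ (DIM('a) - 1)) \<le> emeasure lborel (ball 0 1 \<inter> sgn -` {y. norm (e - y) \<le> r})" .
  have vol: "emeasure lborel (ball (0::'a) 1) = ennreal (measure lborel (ball (0::'a) 1))"
    by (rule emeasure_eq_ennreal_measure) (use emeasure_unit_ball_neq(2) in simp)
  have pos: "measure lborel (ball (0::'a) 1) > 0" by (rule content_ball_pos) simp
  have "2 * q = r / (8 * DIM('a))" by (simp add: q_def)
  thus ?thesis
    by (subst emeasure_sphere_measure)
       (use divide_right_mono_ennreal[OF *, of "emeasure lborel (ball (0::'a) 1)"] pos q in
         \<open>auto simp: vol divide_ennreal mult_ac\<close>)
qed

lemma chord_measure_le:
  obtains C where "C > 0"
    "\<And>r. r \<ge> 0 \<Longrightarrow> emeasure (chord_measure TYPE('a::euclidean_space)) {..r} \<le> ennreal (C * r ^ (DIM('a) - 1))"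
proof -
  obtain e :: 'a where e: "e \<in> Basis" using nonempty_Basis by blast
  show ?thesis
  proof (rule that)
    show "2 ^ DIM('a) / measure lborel (ball (0::'a) 1) > 0" using content_ball_pos[of 1 "0::'a"] by simp
    show "emeasure (chord_measure TYPE('a)) {..r} \<le> ennreal (2 ^ DIM('a) / measure lborel (ball (0::'a) 1) * r ^ (DIM('a) - 1))"
      if "r \<ge> 0" for r
      using emeasure_cap_le[OF e that] emeasure_chord[of e "{..r}"] e by simp
  qed
qed

lemma AE_chord_measure_pos: "AE r in chord_measure TYPE('a::euclidean_space). 0 < r \<and> r \<le> 2"
  if "DIM('a) \<ge> 2"
proof -
  obtain e :: 'a where e: "norm e = 1" using ex_unit_vector by blast
  obtain C where C: "\<And>r. r \<ge> 0 \<Longrightarrow> emeasure (chord_measure TYPE('a)) {..r} \<le> ennreal (C * r ^ (DIM('a) - 1))"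
    using chord_measure_le by blast
  have "emeasure (chord_measure TYPE('a)) {..0} = 0" using C[of 0] that by (simp add: power_0_left)
  hence "AE r in chord_measure TYPE('a). r \<notin> {..0}" by (intro AE_not_in) (auto simp: null_sets_def)
  moreover have "AE y in sphere_measure. norm (e - y) \<le> 2"
    using AE_sphere_measure
  proof eventually_elim
    case (elim y)
    thus ?case using norm_triangle_ineq4[of e y] e by simp
  qed
  hence "AE r in chord_measure TYPE('a). r \<le> 2"
    unfolding distr_chord[OF e, symmetric] by (subst AE_distr_iff) auto
  ultimately show ?thesis by eventually_elim auto
qed

lemma chord_measure_ge:
  obtains c where "c > 0"
    "\<And>r. 0 < r \<Longrightarrow> r \<le> 1 \<Longrightarrow> emeasure (chord_measure TYPE('a::euclidean_space)) {..r} \<ge> ennreal (c * r ^ (DIM('a) - 1))"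
proof -
  obtain e :: 'a where e: "e \<in> Basis" using nonempty_Basis by blast
  show ?thesis
  proof (rule that)
    show "1 / 4 * (1 / (8 * DIM('a))) ^ (DIM('a) - 1) / measure lborel (ball (0::'a) 1) > 0"
      using content_ball_pos[of 1 "0::'a"] by simp
    show "emeasure (chord_measure TYPE('a)) {..r}
            \<ge> ennreal (1 / 4 * (1 / (8 * DIM('a))) ^ (DIM('a) - 1) / measure lborel (ball (0::'a) 1) * r ^ (DIM('a) - 1))"
      if "0 < r" "r \<le> 1" for r
      using emeasure_cap_ge[OF e that] emeasure_chord[of e "{..r}"] e
      by (simp add: power_divide mult_ac)
  qed
qed

section \<open>Integrals of powers of the chord\<close>

lemma ennreal_le_suminf: "f k \<le> (\<Sum>k. f k)" for f :: "nat \<Rightarrow> ennreal"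
  using sum_le_suminf[of f "{k}"] by simp

text \<open>Dyadic decomposition of the region of integration.\<close>

lemma nn_integral_powr_near:
  fixes M :: "real measure" and C D p :: real
  assumes [measurable_cong, simp]: "sets M = sets borel"
    and C: "C \<ge> 0" "\<And>r. r \<ge> 0 \<Longrightarrow> emeasure M {..r} \<le> ennreal (C * r powr D)"
    and p: "0 \<le> p" "p < D" and x: "x > 0"
  shows "(\<integral>\<^sup>+r. ennreal (r powr (-p)) * indicator {0<..x} r \<partial>M)
           \<le> ennreal (C * 2 powr p / (1 - 2 powr (p - D)) * x powr (D - p))"
proof -
  have lt1: "2 powr (p - D) < 1" using powr_less_mono[of "p - D" 0 2] p by simp
  let ?x = "\<lambda>k::nat. x * 2 powr (- real k)"
  let ?f = "\<lambda>(k::nat) r. ennreal ((?x (Suc k)) powr (-p)) * indicator {..?x k} r"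
  have "ennreal (r powr (-p)) * indicator {0<..x} r \<le> (\<Sum>k. ?f k r)" for r
  proof (cases "r \<in> {0<..x}")
    case True
    define k where "k = nat \<lfloor>log 2 (x / r)\<rfloor>"
    have l0: "log 2 (x / r) \<ge> 0" using True by (simp add: zero_le_log_cancel_iff)
    hence k: "real k \<le> log 2 (x / r)" "log 2 (x / r) < real (Suc k)"
      by (simp_all add: k_def) linarith+
    have "2 powr (real k) \<le> x / r" using k(1) True x by (subst (asm) le_log_iff) auto
    hence 1: "r \<le> ?x k" using True by (simp add: powr_minus field_simps)
    have "x / r < 2 powr (real (Suc k))" using k(2) True x by (subst (asm) log_less_iff) auto
    hence "x < r * 2 powr (real (Suc k))" using True by (simp add: field_simps)
    hence 2: "?x (Suc k) < r"
      using powr_gt_zero[of 2 "real (Suc k)"] by (simp only: powr_minus divide_inverse[symmetric] pos_divide_less_eq)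
    have "ennreal (r powr (-p)) \<le> ?f k r"
      using 1 2 p x True by (auto intro!: ennreal_leI powr_mono2')
    also have "\<dots> \<le> (\<Sum>k. ?f k r)"
      using ennreal_le_suminf[of "\<lambda>k. ?f k r" k] .
    finally show ?thesis using True by simp
  qed auto
  hence "(\<integral>\<^sup>+r. ennreal (r powr (-p)) * indicator {0<..x} r \<partial>M) \<le> (\<integral>\<^sup>+r. (\<Sum>k. ?f k r) \<partial>M)"
    by (intro nn_integral_mono) auto
  also have "\<dots> = (\<Sum>k. (\<integral>\<^sup>+r. ?f k r \<partial>M))" by (intro nn_integral_suminf) auto
  also have "\<dots> \<le> (\<Sum>k. ennreal (C * 2 powr p * x powr (D - p) * (2 powr (p - D)) ^ k))"
  proof (intro suminf_le)
    fix k
    have "(\<integral>\<^sup>+r. ?f k r \<partial>M) = ennreal ((?x (Suc k)) powr (-p)) * emeasure M {..?x k}"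
      by (subst nn_integral_cmult) auto
    also have "\<dots> \<le> ennreal ((?x (Suc k)) powr (-p)) * ennreal (C * (?x k) powr D)"
      using x by (intro mult_left_mono C) auto
    also have "\<dots> = ennreal ((?x (Suc k)) powr (-p) * (C * (?x k) powr D))"
      using C by (simp add: ennreal_mult)
    also have "(?x (Suc k)) powr (-p) * (C * (?x k) powr D) = C * 2 powr p * x powr (D - p) * (2 powr (p - D)) ^ k"
    proof -
      have e1: "(?x (Suc k)) powr (-p) = x powr (-p) * 2 powr (p * (real k + 1))"
        using x by (simp add: powr_mult powr_powr algebra_simps)
      have e2: "(?x k) powr D = x powr D * 2 powr (- (real k * D))"
        using x by (simp add: powr_mult powr_powr)
      have e3: "(2 powr (p - D)) ^ k = 2 powr ((p - D) * real k)"
        by (simp add: powr_powr flip: powr_realpow)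
      have e4: "x powr (-p) * x powr D = x powr (D - p)"
        by (simp flip: powr_add)
      have e5: "2 powr (p * (real k + 1)) * 2 powr (- (real k * D)) = 2 powr p * 2 powr ((p - D) * real k)"
        by (simp add: algebra_simps flip: powr_add)
      have "(?x (Suc k)) powr (-p) * (C * (?x k) powr D)
          = C * (x powr (-p) * x powr D) * (2 powr (p * (real k + 1)) * 2 powr (- (real k * D)))"
        unfolding e1 e2 by (simp only: mult_ac)
      also have "\<dots> = C * 2 powr p * x powr (D - p) * (2 powr (p - D)) ^ k"
        unfolding e3 e4 e5 by (simp only: mult_ac)
      finally show ?thesis .
    qed
    finally show "(\<integral>\<^sup>+r. ?f k r \<partial>M) \<le> ennreal (C * 2 powr p * x powr (D - p) * (2 powr (p - D)) ^ k)" .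
  qed auto
  also have "\<dots> = ennreal (\<Sum>k. C * 2 powr p * x powr (D - p) * (2 powr (p - D)) ^ k)"
    using lt1 C by (intro suminf_ennreal2 summable_mult summable_geometric) auto
  also have "(\<Sum>k. C * 2 powr p * x powr (D - p) * (2 powr (p - D)) ^ k) = C * 2 powr p / (1 - 2 powr (p - D)) * x powr (D - p)"
    using lt1 by (subst suminf_mult) (auto simp: suminf_geometric intro!: summable_geometric)
  finally show ?thesis .
qed

text \<open>On the shell between \<open>x * 2 ^ k\<close> and \<open>x * 2 ^ (k + 1)\<close> the
  power is bounded by its value at the inner radius and the measure by that of the whole ball of the
  outer radius. The resulting geometric series has ratio \<open>2 powr (D - p) < 1\<close>.\<close>

lemma nn_integral_powr_far:
  fixes M :: "real measure" and C D p :: real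
  assumes [measurable_cong, simp]: "sets M = sets borel"
    and C: "C \<ge> 0" "\<And>r. r \<ge> 0 \<Longrightarrow> emeasure M {..r} \<le> ennreal (C * r powr D)"
    and p: "0 \<le> p" "D < p" and x: "x > 0"
  shows "(\<integral>\<^sup>+r. ennreal (r powr (-p)) * indicator {x<..} r \<partial>M)
           \<le> ennreal (C * 2 powr D / (1 - 2 powr (D - p)) * x powr (D - p))"
proof -
  have lt1: "2 powr (D - p) < 1" using powr_less_mono[of "D - p" 0 2] p by simp
  let ?x = "\<lambda>k::nat. x * 2 powr real k"
  let ?f = "\<lambda>(k::nat) r. ennreal ((?x k) powr (-p)) * indicator {..?x (Suc k)} r"
  have "ennreal (r powr (-p)) * indicator {x<..} r \<le> (\<Sum>k. ?f k r)" for r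
  proof (cases "r \<in> {x<..}")
    case True
    define k where "k = nat \<lfloor>log 2 (r / x)\<rfloor>"
    have r: "r > 0" using True x by auto
    have l0: "log 2 (r / x) \<ge> 0" using True x by (simp add: zero_le_log_cancel_iff)
    hence k: "real k \<le> log 2 (r / x)" "log 2 (r / x) < real (Suc k)"
      by (simp_all add: k_def) linarith+
    have "2 powr (real k) \<le> r / x" using k(1) r x by (subst (asm) le_log_iff) auto
    hence 1: "?x k \<le> r" using x by (simp add: field_simps)
    have "r / x < 2 powr (real (Suc k))" using k(2) r x by (subst (asm) log_less_iff) auto
    hence 2: "r < ?x (Suc k)" using x by (simp add: field_simps)
    have "ennreal (r powr (-p)) \<le> ?f k r"
      using 1 2 p x r by (auto intro!: ennreal_leI powr_mono2')
    also have "\<dots> \<le> (\<Sum>k. ?f k r)"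
      using ennreal_le_suminf[of "\<lambda>k. ?f k r" k] .
    finally show ?thesis using True by simp
  qed auto
  hence "(\<integral>\<^sup>+r. ennreal (r powr (-p)) * indicator {x<..} r \<partial>M) \<le> (\<integral>\<^sup>+r. (\<Sum>k. ?f k r) \<partial>M)"
    by (intro nn_integral_mono) auto
  also have "\<dots> = (\<Sum>k. (\<integral>\<^sup>+r. ?f k r \<partial>M))" by (intro nn_integral_suminf) auto
  also have "\<dots> \<le> (\<Sum>k. ennreal (C * 2 powr D * x powr (D - p) * (2 powr (D - p)) ^ k))"
  proof (intro suminf_le)
    fix k
    have "(\<integral>\<^sup>+r. ?f k r \<partial>M) = ennreal ((?x k) powr (-p)) * emeasure M {..?x (Suc k)}"
      by (subst nn_integral_cmult) auto
    also have "\<dots> \<le> ennreal ((?x k) powr (-p)) * ennreal (C * (?x (Suc k)) powr D)"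
      using x by (intro mult_left_mono C) auto
    also have "\<dots> = ennreal ((?x k) powr (-p) * (C * (?x (Suc k)) powr D))"
      using C by (simp add: ennreal_mult)
    also have "(?x k) powr (-p) * (C * (?x (Suc k)) powr D) = C * 2 powr D * x powr (D - p) * (2 powr (D - p)) ^ k"
    proof -
      have e1: "(?x k) powr (-p) = x powr (-p) * 2 powr (- (p * real k))"
        using x by (simp add: powr_mult powr_powr algebra_simps)
      have e2: "(?x (Suc k)) powr D = x powr D * 2 powr ((real k + 1) * D)"
        using x by (simp add: powr_mult powr_powr algebra_simps)
      have e3: "(2 powr (D - p)) ^ k = 2 powr ((D - p) * real k)"
        by (simp add: powr_powr flip: powr_realpow)
      have e4: "x powr (-p) * x powr D = x powr (D - p)"
        by (simp flip: powr_add)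
      have e5: "2 powr (- (p * real k)) * 2 powr ((real k + 1) * D) = 2 powr D * 2 powr ((D - p) * real k)"
        by (simp add: algebra_simps flip: powr_add)
      have "(?x k) powr (-p) * (C * (?x (Suc k)) powr D)
          = C * (x powr (-p) * x powr D) * (2 powr (- (p * real k)) * 2 powr ((real k + 1) * D))"
        unfolding e1 e2 by (simp only: mult_ac)
      also have "\<dots> = C * 2 powr D * x powr (D - p) * (2 powr (D - p)) ^ k"
        unfolding e3 e4 e5 by (simp only: mult_ac)
      finally show ?thesis .
    qed
    finally show "(\<integral>\<^sup>+r. ?f k r \<partial>M) \<le> ennreal (C * 2 powr D * x powr (D - p) * (2 powr (D - p)) ^ k)" .
  qed auto
  also have "\<dots> = ennreal (\<Sum>k. C * 2 powr D * x powr (D - p) * (2 powr (D - p)) ^ k)"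
    using lt1 C by (intro suminf_ennreal2 summable_mult summable_geometric) auto
  also have "(\<Sum>k. C * 2 powr D * x powr (D - p) * (2 powr (D - p)) ^ k) = C * 2 powr D / (1 - 2 powr (D - p)) * x powr (D - p)"
    using lt1 by (subst suminf_mult) (auto simp: suminf_geometric intro!: summable_geometric)
  finally show ?thesis .
qed

section \<open>Lower energy bounds from positive definite kernels\<close>

lemma inner_eq_chord: "norm x = 1 \<Longrightarrow> norm y = 1 \<Longrightarrow> x \<bullet> y = 1 - (norm (x - y))\<^sup>2 / 2" for x y :: "'a::real_inner"
  by (simp add: power2_norm_eq_inner inner_diff_left inner_diff_right inner_commute) (simp add: dot_square_norm field_simps)

lemma AE_sphere_inner_le:
  fixes x :: "'a::euclidean_space"
  shows "norm x = 1 \<Longrightarrow> AE y in sphere_measure. \<bar>x \<bullet> y\<bar> \<le> 1"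
  using AE_sphere_measure
proof eventually_elim
  case (elim y)
  thus ?case using Cauchy_Schwarz_ineq2[of x y] by simp
qed

text \<open>Expand \<open>(x \<bullet> y) ^ k\<close> in the monomials of degree \<open>k\<close> and compare the empirical with the spherical moments.\<close>

lemma sum_inner_power_ge:
  fixes x :: "'i \<Rightarrow> 'a::euclidean_space" and e :: 'a
  assumes I: "finite I" "\<And>i. i \<in> I \<Longrightarrow> norm (x i) = 1" and e: "norm e = 1"
  shows "(real (card I))\<^sup>2 * (\<integral>y. (e \<bullet> y) ^ k \<partial>sphere_measure) \<le> (\<Sum>i\<in>I. \<Sum>j\<in>I. (x i \<bullet> x j) ^ k)"
proof -
  interpret prob_space "sphere_measure :: 'a measure" by (rule prob_space_sphere_measure)
  define G where "G = PiE {..<k} (\<lambda>_. Basis :: 'a set)"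
  define M where "M g y = (\<Prod>l<k. y \<bullet> g l)" for g and y :: 'a
  have G: "finite G" by (simp add: G_def finite_PiE)
  have exp: "(y \<bullet> z) ^ k = (\<Sum>g\<in>G. M g y * M g z)" for y z :: 'a
  proof -
    have "(y \<bullet> z) ^ k = (\<Prod>l<k. \<Sum>b\<in>Basis. (y \<bullet> b) * (z \<bullet> b))"
      by (subst euclidean_inner) simp
    also have "\<dots> = (\<Sum>g\<in>G. \<Prod>l<k. (y \<bullet> g l) * (z \<bullet> g l))"
      unfolding G_def by (subst prod_sum_PiE) auto
    finally show ?thesis by (simp add: M_def prod.distrib)
  qed
  have M_le: "\<bar>M g y\<bar> \<le> 1" if "g \<in> G" "norm y = 1" for g y
    unfolding M_def abs_prod using that
    by (intro prod_le_1) (auto simp: G_def PiE_iff Pi_iff intro!: Basis_le_norm[THEN order_trans])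
  have Mm [measurable]: "M g \<in> borel_measurable borel" for g unfolding M_def by measurable
  have int: "integrable sphere_measure (M g)" if "g \<in> G" for g
    using AE_sphere_measure M_le[OF that]
    by (intro integrable_const_bound[where B = 1]) (auto elim: eventually_mono)
  define m where "m g = (\<integral>y. M g y \<partial>sphere_measure)" for g
  define c where "c = (\<integral>y. (e \<bullet> y) ^ k \<partial>sphere_measure)"
  have lin: "(\<integral>y. (z \<bullet> y) ^ k \<partial>sphere_measure) = (\<Sum>g\<in>G. M g z * m g)" for z
    unfolding exp m_def using int by (subst Bochner_Integration.integral_sum) auto
  have const: "(\<integral>y. (z \<bullet> y) ^ k \<partial>sphere_measure) = c" if "norm z = 1" for z :: 'a
  proof -
    have *: "(\<integral>y. (z \<bullet> y) ^ k \<partial>sphere_measure) = (\<integral>r. (1 - r\<^sup>2 / 2) ^ k \<partial>chord_measure TYPE('a))" if z: "norm z = 1" for z :: 'a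
    proof -
      have "(\<integral>y. (z \<bullet> y) ^ k \<partial>sphere_measure) = (\<integral>y. (1 - (norm (z - y))\<^sup>2 / 2) ^ k \<partial>sphere_measure)"
        using AE_sphere_measure z by (intro integral_cong_AE) (auto elim!: eventually_mono simp: inner_eq_chord)
      also have "\<dots> = (\<integral>r. (1 - r\<^sup>2 / 2) ^ k \<partial>chord_measure TYPE('a))"
        using z by (rule integral_chord) measurable
      finally show ?thesis .
    qed
    show ?thesis unfolding c_def using *[OF that] *[OF e] by simp
  qed
  have "c = (\<integral>z. c \<partial>(sphere_measure :: 'a measure))" using prob_space by simp
  also have "\<dots> = (\<integral>z. (\<Sum>g\<in>G. M g z * m g) \<partial>(sphere_measure :: 'a measure))"
    using AE_sphere_measure by (intro integral_cong_AE) (auto elim!: eventually_mono simp: const simp flip: lin)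
  also have "\<dots> = (\<Sum>g\<in>G. (m g)\<^sup>2)"
    using int by (subst Bochner_Integration.integral_sum) (auto simp: m_def power2_eq_square)
  finally have c2: "c = (\<Sum>g\<in>G. (m g)\<^sup>2)" .
  define N where "N = real (card I)"
  define S where "S g = (\<Sum>i\<in>I. M g (x i))" for g
  have c1: "(\<Sum>g\<in>G. S g * m g) = N * c"
  proof -
    have "(\<Sum>g\<in>G. S g * m g) = (\<Sum>i\<in>I. \<Sum>g\<in>G. M g (x i) * m g)"
      unfolding S_def sum_distrib_right by (rule sum.swap)
    also have "\<dots> = N * c" by (simp add: lin[symmetric] const I N_def)
    finally show ?thesis .
  qed
  have "(\<Sum>i\<in>I. \<Sum>j\<in>I. (x i \<bullet> x j) ^ k) = (\<Sum>i\<in>I. \<Sum>g\<in>G. M g (x i) * S g)"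
    unfolding exp S_def sum_distrib_left by (intro sum.cong refl sum.swap)
  also have "\<dots> = (\<Sum>g\<in>G. (S g)\<^sup>2)"
    by (subst sum.swap) (simp add: S_def power2_eq_square sum_distrib_right)
  finally have c0: "(\<Sum>i\<in>I. \<Sum>j\<in>I. (x i \<bullet> x j) ^ k) = (\<Sum>g\<in>G. (S g)\<^sup>2)" .
  \<comment> \<open>The squared distance between the empirical moment vector and \<open>N\<close>
    times the spherical one; expanding it gives the claim.\<close>
  have "0 \<le> (\<Sum>g\<in>G. (S g - N * m g)\<^sup>2)" by (intro sum_nonneg) auto
  also have "\<dots> = (\<Sum>g\<in>G. (S g)\<^sup>2) - 2 * N * (\<Sum>g\<in>G. S g * m g) + N\<^sup>2 * (\<Sum>g\<in>G. (m g)\<^sup>2)"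
    by (simp add: power2_diff sum.distrib sum_subtractf sum_distrib_left power_mult_distrib mult_ac)
  also have "\<dots> = (\<Sum>g\<in>G. (S g)\<^sup>2) - N\<^sup>2 * c"
    unfolding c1 c2[symmetric] by (simp add: power2_eq_square)
  finally show ?thesis by (simp add: c0 c_def N_def)
qed

text \<open>The moment inequality is applied degree by degree. In degree 0 both sides are equal, so
  \<open>a 0\<close> may have any sign; this admits the logarithmic kernel, whose constant
  coefficient has no fixed sign.\<close>

lemma sum_power_series_kernel_ge:
  fixes x :: "'i \<Rightarrow> 'a::euclidean_space" and u :: "real \<Rightarrow> real"
  assumes I: "finite I" "\<And>i. i \<in> I \<Longrightarrow> norm (x i) = 1"
    and a: "\<And>k. k > 0 \<Longrightarrow> a k \<ge> 0" and [measurable]: "u \<in> borel_measurable borel"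
    and u: "\<And>r. 0 \<le> r \<Longrightarrow> r \<le> 2 \<Longrightarrow> (\<lambda>k. a k * (1 - r\<^sup>2 / 2) ^ k) sums u r"
  shows "(real (card I))\<^sup>2 * (\<integral>r. u r \<partial>chord_measure TYPE('a)) \<le> (\<Sum>i\<in>I. \<Sum>j\<in>I. u (norm (x i - x j)))"
proof -
  interpret prob_space "sphere_measure :: 'a measure" by (rule prob_space_sphere_measure)
  obtain e :: 'a where e: "norm e = 1" using ex_unit_vector by blast
  \<comment> \<open>At \<open>r = 0\<close> the inner product is 1, so the series there is the
    series of coefficients, which dominates for all other inner products.\<close>
  have sa: "summable a" using u[of 0] by (simp add: sums_iff)
  have san: "summable (\<lambda>k. \<bar>a k\<bar>)"
    by (rule summable_comparison_test_ev[OF eventually_mono[OF eventually_gt_at_top[of 0]] sa])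
       (use a in auto)
  have us: "(\<lambda>k. a k * (y \<bullet> z) ^ k) sums u (norm (y - z))" if "norm y = 1" "norm z = 1" for y z :: 'a
    using u[of "norm (y - z)"] norm_triangle_ineq4[of y z] that by (simp add: inner_eq_chord)
  let ?c = "\<lambda>k. \<integral>y. (e \<bullet> y) ^ k \<partial>sphere_measure"
  have int: "integrable sphere_measure (\<lambda>y. (e \<bullet> y) ^ k)" for k
    using AE_sphere_inner_le[OF e]
    by (intro integrable_const_bound[where B = 1]) (auto elim!: eventually_mono simp: power_abs intro: power_le_one)
  have le1: "norm (\<integral>y. norm (a k * (e \<bullet> y) ^ k) \<partial>sphere_measure) \<le> \<bar>a k\<bar>" for k
  proof -
    have "(\<integral>y. norm (a k * (e \<bullet> y) ^ k) \<partial>sphere_measure) \<le> (\<integral>y. \<bar>a k\<bar> \<partial>(sphere_measure :: 'a measure))"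
    proof (rule integral_mono_AE)
      show "integrable sphere_measure (\<lambda>y. norm (a k * (e \<bullet> y) ^ k))"
        by (intro integrable_norm integrable_mult_right int)
      show "AE y in sphere_measure. norm (a k * (e \<bullet> y) ^ k) \<le> \<bar>a k\<bar>"
        using AE_sphere_inner_le[OF e]
        by eventually_elim (auto simp: abs_mult power_abs intro!: mult_left_le power_le_one)
    qed simp
    moreover have "(\<integral>y. norm (a k * (e \<bullet> y) ^ k) \<partial>sphere_measure) \<ge> 0" by simp
    ultimately show ?thesis using prob_space by simp
  qed
  have "(\<integral>r. u r \<partial>chord_measure TYPE('a)) = (\<integral>y. u (norm (e - y)) \<partial>sphere_measure)"
    using e by (rule integral_chord[symmetric]) measurable
  also have "\<dots> = (\<integral>y. (\<Sum>k. a k * (e \<bullet> y) ^ k) \<partial>sphere_measure)"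
    using AE_sphere_measure us[OF e] by (intro integral_cong_AE) (auto elim!: eventually_mono simp: sums_iff)
  finally have iu: "(\<integral>r. u r \<partial>chord_measure TYPE('a)) = \<dots>" .
  have "(\<lambda>k. \<integral>y. a k * (e \<bullet> y) ^ k \<partial>sphere_measure) sums (\<integral>y. (\<Sum>k. a k * (e \<bullet> y) ^ k) \<partial>sphere_measure)"
  proof (rule sums_integral)
    show "integrable sphere_measure (\<lambda>y. a k * (e \<bullet> y) ^ k)" for k using int by simp
    show "AE y in sphere_measure. summable (\<lambda>k. norm (a k * (e \<bullet> y) ^ k))"
      using AE_sphere_inner_le[OF e]
      by eventually_elim (rule summable_comparison_test'[OF san, of 0],
          auto simp: abs_mult power_abs intro!: mult_left_le power_le_one)
    show "summable (\<lambda>k. \<integral>y. norm (a k * (e \<bullet> y) ^ k) \<partial>sphere_measure)"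
      by (rule summable_comparison_test'[OF san, of 0]) (rule le1)
  qed
  hence s1: "(\<lambda>k. (real (card I))\<^sup>2 * (a k * ?c k)) sums ((real (card I))\<^sup>2 * (\<integral>r. u r \<partial>chord_measure TYPE('a)))"
    unfolding iu by (intro sums_mult) simp
  have s2: "(\<lambda>k. \<Sum>i\<in>I. \<Sum>j\<in>I. a k * (x i \<bullet> x j) ^ k) sums (\<Sum>i\<in>I. \<Sum>j\<in>I. u (norm (x i - x j)))"
    by (intro sums_sum us I)
  show ?thesis
  proof (rule sums_le[OF _ s1 s2])
    fix k
    show "(real (card I))\<^sup>2 * (a k * ?c k) \<le> (\<Sum>i\<in>I. \<Sum>j\<in>I. a k * (x i \<bullet> x j) ^ k)"
    proof (cases "k = 0")
      case True
      thus ?thesis using prob_space by (simp add: power2_eq_square)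
    next
      case False
      have "a k * ((real (card I))\<^sup>2 * ?c k) \<le> a k * (\<Sum>i\<in>I. \<Sum>j\<in>I. (x i \<bullet> x j) ^ k)"
        using False a by (intro mult_left_mono sum_inner_power_ge I e) auto
      thus ?thesis by (simp add: sum_distrib_left mult_ac)
    qed
  qed
qed

text \<open>A finite kernel \<open>u\<close> below \<open>K\<close> may be summed over all ordered
  pairs; the price for including the diagonal is \<open>u 0\<close> for each point.\<close>

lemma sum_offdiag_ge:
  fixes x :: "'i \<Rightarrow> 'a::euclidean_space" and u K :: "real \<Rightarrow> real"
  assumes I: "finite I" "\<And>i. i \<in> I \<Longrightarrow> norm (x i) = 1" "inj_on x I"
    and a: "\<And>k. k > 0 \<Longrightarrow> a k \<ge> 0" and [measurable]: "u \<in> borel_measurable borel"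
    and u: "\<And>r. 0 \<le> r \<Longrightarrow> r \<le> 2 \<Longrightarrow> (\<lambda>k. a k * (1 - r\<^sup>2 / 2) ^ k) sums u r"
    and uK: "\<And>r. 0 < r \<Longrightarrow> r \<le> 2 \<Longrightarrow> u r \<le> K r"
  shows "(real (card I))\<^sup>2 * (\<integral>r. u r \<partial>chord_measure TYPE('a)) - real (card I) * u 0
           \<le> (\<Sum>i\<in>I. \<Sum>j\<in>I - {i}. K (norm (x i - x j)))"
proof -
  have "(real (card I))\<^sup>2 * (\<integral>r. u r \<partial>chord_measure TYPE('a)) \<le> (\<Sum>i\<in>I. \<Sum>j\<in>I. u (norm (x i - x j)))"
    by (rule sum_power_series_kernel_ge[OF I(1,2) a _ u]) auto
  also have "\<dots> = (\<Sum>i\<in>I. u 0 + (\<Sum>j\<in>I - {i}. u (norm (x i - x j))))"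
    using I(1) by (intro sum.cong refl) (subst sum.remove, auto)
  also have "\<dots> = real (card I) * u 0 + (\<Sum>i\<in>I. \<Sum>j\<in>I - {i}. u (norm (x i - x j)))"
    by (simp add: sum.distrib)
  also have "(\<Sum>i\<in>I. \<Sum>j\<in>I - {i}. u (norm (x i - x j))) \<le> (\<Sum>i\<in>I. \<Sum>j\<in>I - {i}. K (norm (x i - x j)))"
  proof (intro sum_mono uK)
    fix i j assume "i \<in> I" "j \<in> I - {i}"
    thus "0 < norm (x i - x j)" "norm (x i - x j) \<le> 2"
      using I norm_triangle_ineq4[of "x i" "x j"] by (auto simp: inj_on_def)
  qed
  finally show ?thesis by simp
qed

section \<open>Second differences of the Riesz kernel\<close>

lemma powr_second_difference:
  fixes q v h :: real
  assumes q: "q > 0" and v: "v > 0" and h: "h > 0"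
  shows "q * (q + 1) * h\<^sup>2 * (v + 2 * h) powr (-q - 2) \<le> v powr (-q) - 2 * (v + h) powr (-q) + (v + 2 * h) powr (-q)" (is "_ \<le> ?D")
    and "v powr (-q) - 2 * (v + h) powr (-q) + (v + 2 * h) powr (-q) \<le> v powr (-q)"
    and "v powr (-q) - 2 * (v + h) powr (-q) + (v + 2 * h) powr (-q) \<le> q * (q + 1) * h\<^sup>2 * v powr (-q - 2)"
proof -
  \<comment> \<open>The second difference is \<open>\<phi> 0 - \<phi> h\<close>. The mean value
    theorem for \<open>\<phi>\<close>, and then for its derivative, which is again a difference with
    step \<open>h\<close>, evaluates it as a second derivative at a point \<open>w\<close> between
    \<open>v\<close> and \<open>v + 2 * h\<close>.\<close>
  define \<phi> where "\<phi> x = (v + x) powr (-q) - (v + x + h) powr (-q)" for x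
  have "\<exists>z. 0 < z \<and> z < h \<and> \<phi> h - \<phi> 0 = (h - 0) * (-q * (v + z) powr (-q - 1) + q * (v + z + h) powr (-q - 1))"
    unfolding \<phi>_def using v h q
    by (intro MVT2) (auto intro!: derivative_eq_intros)
  then obtain z where z: "0 < z" "z < h"
    "\<phi> h - \<phi> 0 = h * (-q * (v + z) powr (-q - 1) + q * (v + z + h) powr (-q - 1))" by auto
  have "\<exists>w. v + z < w \<and> w < v + z + h \<and>
      (v + z + h) powr (-q - 1) - (v + z) powr (-q - 1) = (v + z + h - (v + z)) * ((-q - 1) * w powr (-q - 1 - 1))"
    using v h z by (intro MVT2) (auto intro!: derivative_eq_intros)
  then obtain w where w: "v + z < w" "w < v + z + h" and
      eq: "(v + z + h) powr (-q - 1) - (v + z) powr (-q - 1) = h * ((-q - 1) * w powr (-q - 1 - 1))" by auto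
  have v2: "v + 2 * h = v + h + h" by simp
  have D: "?D = \<phi> 0 - \<phi> h" unfolding \<phi>_def v2 by simp
  also have "\<dots> = - (h * q * ((v + z + h) powr (-q - 1) - (v + z) powr (-q - 1)))"
    using z(3) by (simp add: algebra_simps)
  also have "\<dots> = q * (q + 1) * h\<^sup>2 * w powr (-q - 2)"
    unfolding eq by (simp add: power2_eq_square algebra_simps)
  finally have D: "?D = q * (q + 1) * h\<^sup>2 * w powr (-q - 2)" .
  have "(v + 2 * h) powr (-q - 2) \<le> w powr (-q - 2)" using w v z q by (intro powr_mono2') auto
  thus "q * (q + 1) * h\<^sup>2 * (v + 2 * h) powr (-q - 2) \<le> ?D"
    unfolding D using q by (intro mult_left_mono) auto
  have "w powr (-q - 2) \<le> v powr (-q - 2)" using w v z q by (intro powr_mono2') auto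
  thus "?D \<le> q * (q + 1) * h\<^sup>2 * v powr (-q - 2)"
    unfolding D using q by (intro mult_left_mono) auto
  have "(v + 2 * h) powr (-q) \<le> (v + h) powr (-q)" using v h q by (intro powr_mono2') auto
  moreover have "(v + h) powr (-q) \<ge> 0" by simp
  ultimately show "?D \<le> v powr (-q)" by linarith
qed

text \<open>The second forward difference with step \<open>h\<close> of \<open>v powr (-s/2)\<close>
  at \<open>v = r\<^sup>2\<close>, that is, the kernel minus its regularised version.\<close>

definition riesz_gap :: "real \<Rightarrow> real \<Rightarrow> real \<Rightarrow> real" where
  "riesz_gap s h r = r powr (-s) - 2 * (r\<^sup>2 + h) powr (-s/2) + (r\<^sup>2 + 2 * h) powr (-s/2)"

lemma riesz_gap_measurable [measurable]: "riesz_gap s h \<in> borel_measurable borel"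
  unfolding riesz_gap_def by measurable

lemma square_powr_half: "r > 0 \<Longrightarrow> (r\<^sup>2) powr p = r powr (2 * p)" for r p :: real
  by (simp add: powr_powr flip: powr_numeral)

lemma riesz_gap_bounds:
  assumes "s > 0" "h > 0" "r > 0"
  shows "s/2 * (s/2 + 1) * h\<^sup>2 * (r\<^sup>2 + 2 * h) powr (-s/2 - 2) \<le> riesz_gap s h r"
    "0 < riesz_gap s h r" "riesz_gap s h r \<le> r powr (-s)"
    "riesz_gap s h r \<le> s/2 * (s/2 + 1) * h\<^sup>2 * r powr (-s - 4)"
proof -
  have "(r\<^sup>2) powr (-(s/2)) = r powr (-s)" "(r\<^sup>2) powr (-(s/2) - 2) = r powr (-s - 4)"
    using assms by (simp_all add: square_powr_half algebra_simps)
  thus *: "s/2 * (s/2 + 1) * h\<^sup>2 * (r\<^sup>2 + 2 * h) powr (-s/2 - 2) \<le> riesz_gap s h r"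
    "riesz_gap s h r \<le> r powr (-s)"
    "riesz_gap s h r \<le> s/2 * (s/2 + 1) * h\<^sup>2 * r powr (-s - 4)"
    using powr_second_difference[of "s/2" "r\<^sup>2" h] assms by (simp_all add: riesz_gap_def)
  have "0 < s/2 * (s/2 + 1) * h\<^sup>2 * (r\<^sup>2 + 2 * h) powr (-s/2 - 2)"
    using assms by (intro mult_pos_pos) (auto intro: add_pos_pos add_pos_nonneg simp: add_nonneg_eq_0_iff)
  thus "0 < riesz_gap s h r" using *(1) by linarith
qed

lemma integrable_chord_powr:
  assumes d: "DIM('a::euclidean_space) = d + 1" "d \<ge> 1" and s: "0 \<le> s" "s < real d"
  shows "integrable (chord_measure TYPE('a)) (\<lambda>r. r powr (-s))"
proof (rule integrableI_bounded)
  obtain C where C: "C > 0" "\<And>r. r \<ge> 0 \<Longrightarrow> emeasure (chord_measure TYPE('a)) {..r} \<le> ennreal (C * r ^ d)"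
    using chord_measure_le[where 'a = 'a] d by auto
  have "(\<integral>\<^sup>+r. ennreal (norm (r powr (-s))) \<partial>chord_measure TYPE('a))
          = (\<integral>\<^sup>+r. ennreal (r powr (-s)) * indicator {0<..2} r \<partial>chord_measure TYPE('a))"
  proof (intro nn_integral_cong_AE)
    show "AE r in chord_measure TYPE('a). ennreal (norm (r powr (-s))) = ennreal (r powr (-s)) * indicator {0<..2} r"
      using AE_chord_measure_pos[where 'a = 'a] d by (auto simp del: AE_conj_iff elim!: eventually_mono)
  qed
  also have "\<dots> \<le> ennreal (C * 2 powr s / (1 - 2 powr (s - real d)) * 2 powr (real d - s))"
    using C s d by (intro nn_integral_powr_near) (auto simp: powr_realpow' )
  also have "\<dots> < \<infinity>" by simp
  finally show "(\<integral>\<^sup>+r. ennreal (norm (r powr (-s))) \<partial>chord_measure TYPE('a)) < \<infinity>" .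
qed auto

lemma nn_integral_near_far:
  fixes f :: "real \<Rightarrow> ennreal"
  assumes M: "sets M = sets borel" "AE r in M. r > 0" and [measurable]: "f \<in> borel_measurable borel"
    and "\<And>r. 0 < r \<Longrightarrow> r \<le> x \<Longrightarrow> f r \<le> g r" "\<And>r. r > x \<Longrightarrow> f r \<le> g' r"
    and [measurable]: "g \<in> borel_measurable borel" "g' \<in> borel_measurable borel" and "x > 0"
  shows "(\<integral>\<^sup>+r. f r \<partial>M) \<le> (\<integral>\<^sup>+r. g r * indicator {0<..x} r \<partial>M) + (\<integral>\<^sup>+r. g' r * indicator {x<..} r \<partial>M)"
proof -
  note M(1)[measurable_cong]
  have "(\<integral>\<^sup>+r. f r \<partial>M) \<le> (\<integral>\<^sup>+r. g r * indicator {0<..x} r + g' r * indicator {x<..} r \<partial>M)"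
    using M(2) assms by (intro nn_integral_mono_AE) (auto elim!: eventually_mono simp: indicator_def)
  also have "\<dots> = (\<integral>\<^sup>+r. g r * indicator {0<..x} r \<partial>M) + (\<integral>\<^sup>+r. g' r * indicator {x<..} r \<partial>M)"
    by (intro nn_integral_add) auto
  finally show ?thesis .
qed

text \<open>The two upper bounds for the gap cross at \<open>r\<close> of order
  \<open>sqrt h\<close>. Below that the kernel itself is integrable since \<open>s < d\<close>;
  beyond it the decay \<open>r powr (-s - 4)\<close> is integrable at infinity since
  \<open>d < s + 4\<close>. Both parts scale like \<open>h powr ((d - s) / 2)\<close>.\<close>

lemma nn_integral_riesz_gap_le:
  assumes d: "DIM('a::euclidean_space) = d + 1" "d \<ge> 1" and s: "0 < s" "s < real d" "real d < s + 4"
  obtains C where "C > 0"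
    "\<And>h. h > 0 \<Longrightarrow> (\<integral>\<^sup>+r. ennreal (riesz_gap s h r) \<partial>chord_measure TYPE('a)) \<le> ennreal (C * h powr ((real d - s) / 2))"
proof -
  obtain C where C: "C > 0" "\<And>r. r \<ge> 0 \<Longrightarrow> emeasure (chord_measure TYPE('a)) {..r} \<le> ennreal (C * r ^ d)"
    using chord_measure_le[where 'a = 'a] d by auto
  hence C': "emeasure (chord_measure TYPE('a)) {..r} \<le> ennreal (C * r powr real d)" if "r \<ge> 0" for r
    using that d by (simp add: powr_realpow')
  define A where "A = C * 2 powr s / (1 - 2 powr (s - real d))"
  define B where "B = C * 2 powr (real d) / (1 - 2 powr (real d - (s + 4)))"
  define E where "E = s/2 * (s/2 + 1)"
  have "2 powr (s - real d) < 2 powr 0" "2 powr (real d - (s + 4)) < 2 powr 0"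
    using s by (intro powr_less_mono; simp)+
  hence pos: "A > 0" "B > 0" "E > 0" using C s by (auto simp: A_def B_def E_def intro!: divide_pos_pos mult_pos_pos)
  show ?thesis
  proof (rule that[of "A + E * B"])
    fix h :: real assume h: "h > 0"
    let ?x = "sqrt h"
    have x: "?x > 0" using h by simp
    have "(\<integral>\<^sup>+r. ennreal (riesz_gap s h r) \<partial>chord_measure TYPE('a))
        \<le> (\<integral>\<^sup>+r. ennreal (r powr (-s)) * indicator {0<..?x} r \<partial>chord_measure TYPE('a))
          + (\<integral>\<^sup>+r. ennreal (E * h\<^sup>2) * ennreal (r powr (-(s+4))) * indicator {?x<..} r \<partial>chord_measure TYPE('a))"
    proof (rule nn_integral_near_far)
      show "AE r in chord_measure TYPE('a). 0 < r"
        using AE_chord_measure_pos[where 'a = 'a] d by (auto simp del: AE_conj_iff elim!: eventually_mono)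
      show "ennreal (riesz_gap s h r) \<le> ennreal (E * h\<^sup>2) * ennreal (r powr (-(s+4)))" if "r > ?x" for r
      proof -
        have "-(s+4) = -s-4" by simp
        hence "riesz_gap s h r \<le> E * h\<^sup>2 * r powr (-(s+4))"
          using riesz_gap_bounds(4)[OF s(1) h, of r] that x unfolding E_def by (simp only:)
        thus ?thesis using pos by (simp add: ennreal_leI flip: ennreal_mult)
      qed
    qed (use x riesz_gap_bounds(3)[OF s(1) h] in \<open>auto intro!: ennreal_leI\<close>)
    also have "(\<integral>\<^sup>+r. ennreal (E * h\<^sup>2) * ennreal (r powr (-(s+4))) * indicator {?x<..} r \<partial>chord_measure TYPE('a))
        = ennreal (E * h\<^sup>2) * (\<integral>\<^sup>+r. ennreal (r powr (-(s+4))) * indicator {?x<..} r \<partial>chord_measure TYPE('a))"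
      unfolding mult.assoc by (intro nn_integral_cmult) auto
    also have "\<dots> \<le> ennreal (E * h\<^sup>2) * ennreal (B * ?x powr (real d - (s+4)))"
      unfolding B_def using C C' s x by (intro mult_left_mono nn_integral_powr_far) auto
    also have "\<dots> = ennreal (E * h\<^sup>2 * (B * ?x powr (real d - (s+4))))"
      using pos by (intro ennreal_mult[symmetric]) auto
    also have "E * h\<^sup>2 * (B * ?x powr (real d - (s+4))) = E * B * h powr ((real d - s) / 2)"
    proof -
      have "h\<^sup>2 * ?x powr (real d - (s+4)) = h powr 2 * h powr ((real d - (s+4)) / 2)"
        using h by (simp add: powr_half_sqrt[symmetric] powr_powr)
      also have "\<dots> = h powr ((real d - s) / 2)" by (simp add: field_simps flip: powr_add)
      finally show ?thesis by (simp add: mult_ac)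
    qed
    also have "(\<integral>\<^sup>+r. ennreal (r powr (-s)) * indicator {0<..?x} r \<partial>chord_measure TYPE('a)) \<le> ennreal (A * ?x powr (real d - s))"
      unfolding A_def using C C' s x by (intro nn_integral_powr_near) auto
    also have "?x powr (real d - s) = h powr ((real d - s) / 2)"
      using h by (simp add: powr_half_sqrt[symmetric] powr_powr)
    finally show "(\<integral>\<^sup>+r. ennreal (riesz_gap s h r) \<partial>chord_measure TYPE('a)) \<le> ennreal ((A + E * B) * h powr ((real d - s) / 2))"
      using pos by (simp add: distrib_right add_increasing flip: ennreal_plus)
  qed (use pos in \<open>auto intro!: add_pos_pos\<close>)
qed

text \<open>With \<open>t = 1 - r\<^sup>2 / 2\<close>, the inner product of two unit vectors at
  distance \<open>r\<close>, one has \<open>r\<^sup>2 + h = (2 + h) - 2 * t\<close>. This is the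
  binomial series about \<open>2 + h\<close>; the signs of the binomial coefficient and of
  \<open>(- 2 * t) ^ k\<close> cancel.\<close>

lemma powr_kernel_sums:
  fixes q h r :: real
  assumes "h > 0" "0 \<le> r" "r \<le> 2"
  shows "(\<lambda>k. ((q + real k - 1) gchoose k) * 2 ^ k * (2 + h) powr (- q - real k) * (1 - r\<^sup>2 / 2) ^ k) sums (r\<^sup>2 + h) powr (- q)"
proof -
  define t where "t = 1 - r\<^sup>2 / 2"
  have "r\<^sup>2 \<le> 2\<^sup>2" using assms by (intro power_mono) auto
  hence "\<bar>t\<bar> \<le> 1" by (auto simp: t_def abs_le_iff)
  hence "\<bar>- 2 * t\<bar> < 2 + h" using assms by auto
  hence "(\<lambda>k. (- q gchoose k) * (2 + h) powr (- q - real k) * (- 2 * t) ^ k) sums ((2 + h) + (- 2 * t)) powr (- q)"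
    by (rule gen_binomial_real'')
  moreover have eq: "(- q gchoose k) * (2 + h) powr (- q - real k) * (- 2 * t) ^ k
      = ((q + real k - 1) gchoose k) * 2 ^ k * (2 + h) powr (- q - real k) * t ^ k" for k
  proof -
    have "(- q gchoose k) = (- 1) ^ k * ((q + real k - 1) gchoose k)"
      by (subst gbinomial_negated_upper) (simp add: algebra_simps)
    moreover have "(- 2 * t) ^ k = (- 1) ^ k * 2 ^ k * t ^ k"
      by (simp flip: power_mult_distrib)
    moreover have "(- 1) ^ k * (- 1) ^ k = (1::real)" by (simp flip: power_mult_distrib)
    ultimately show ?thesis by (simp add: algebra_simps)
  qed
  moreover have "(2 + h) + (- 2 * t) = r\<^sup>2 + h" by (simp add: t_def)
  ultimately show ?thesis unfolding t_def[symmetric] by (simp only: eq)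
qed

lemma gbinomial_pos: "q > 0 \<Longrightarrow> ((q + real k - 1) gchoose k) > 0" for q :: real
  unfolding gbinomial_prod_rev by (intro divide_pos_pos prod_pos) auto

lemma riesz_energy_ge:
  assumes d: "DIM('a::euclidean_space) = d + 1" "d \<ge> 1" and s: "0 < s" "s < real d" "real d < s + 4"
  obtains c where "c > 0"
    "\<And>I (x :: 'i \<Rightarrow> 'a). finite I \<Longrightarrow> I \<noteq> {} \<Longrightarrow> (\<And>i. i \<in> I \<Longrightarrow> norm (x i) = 1) \<Longrightarrow> inj_on x I \<Longrightarrow>
      (real (card I))\<^sup>2 * (\<integral>r. r powr (-s) \<partial>chord_measure TYPE('a)) - c * real (card I) powr (1 + s / real d)
        \<le> (\<Sum>i\<in>I. \<Sum>j\<in>I - {i}. norm (x i - x j) powr (-s))"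
proof -
  interpret prob_space "chord_measure TYPE('a)" by (rule prob_space_chord_measure)
  obtain C where C: "C > 0"
    "\<And>h. h > 0 \<Longrightarrow> (\<integral>\<^sup>+r. ennreal (riesz_gap s h r) \<partial>chord_measure TYPE('a)) \<le> ennreal (C * h powr ((real d - s) / 2))"
    using nn_integral_riesz_gap_le[OF d s] by metis
  show ?thesis
  proof (rule that[of "C + 2"])
    fix I and x :: "'i \<Rightarrow> 'a"
    assume I: "finite I" "I \<noteq> {}" "\<And>i. i \<in> I \<Longrightarrow> norm (x i) = 1" "inj_on x I"
    define N where "N = real (card I)"
    have N: "N \<ge> 1" using I by (simp add: N_def card_gt_0_iff Suc_leI)
    define h where "h = N powr (- 2 / real d)"
    have h: "h > 0" using N by (simp add: h_def)
    define u where "u r = 2 * (r\<^sup>2 + h) powr (-(s/2)) - (r\<^sup>2 + 2 * h) powr (-(s/2))" for r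
    have [measurable]: "u \<in> borel_measurable borel" unfolding u_def by measurable
    define b where "b k = ((s/2 + real k - 1) gchoose k) * 2 ^ k" for k
    define a where "a k = 2 * (b k * (2 + h) powr (- (s/2) - real k)) - b k * (2 + 2 * h) powr (- (s/2) - real k)" for k
    have bpos: "b k \<ge> 0" for k using gbinomial_pos[of "s/2" k] s by (simp add: b_def)
    \<comment> \<open>The coefficient subtracted, at level \<open>2 * h\<close>, is at most the one
      at level \<open>h\<close>, which is counted twice.\<close>
    have a: "a k \<ge> 0" for k
    proof -
      have "b k * (2 + 2 * h) powr (- (s/2) - real k) \<le> b k * (2 + h) powr (- (s/2) - real k)"
        using h s bpos by (intro mult_left_mono powr_mono2') auto
      moreover have "0 \<le> b k * (2 + h) powr (- (s/2) - real k)" using bpos by simp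
      ultimately show ?thesis unfolding a_def by linarith
    qed
    have sums: "(\<lambda>k. a k * (1 - r\<^sup>2 / 2) ^ k) sums u r" if "0 \<le> r" "r \<le> 2" for r
    proof -
      have "(\<lambda>k. 2 * (b k * (2 + h) powr (- (s/2) - real k) * (1 - r\<^sup>2 / 2) ^ k)
              - b k * (2 + 2 * h) powr (- (s/2) - real k) * (1 - r\<^sup>2 / 2) ^ k) sums u r"
        unfolding u_def b_def using h that by (intro sums_diff sums_mult powr_kernel_sums) auto
      thus ?thesis by (simp add: a_def algebra_simps)
    qed
    have gap: "u r = r powr (-s) - riesz_gap s h r" for r by (simp add: u_def riesz_gap_def)
    have ge: "N\<^sup>2 * (\<integral>r. u r \<partial>chord_measure TYPE('a)) - N * u 0 \<le> (\<Sum>i\<in>I. \<Sum>j\<in>I - {i}. norm (x i - x j) powr (-s))"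
      unfolding N_def
    proof (rule sum_offdiag_ge[where a = a])
      show "u r \<le> r powr (-s)" if "0 < r" "r \<le> 2" for r
        using riesz_gap_bounds(2)[OF s(1) h that(1)] by (simp add: gap)
    qed (use I a sums in auto)
    have ig: "integrable (chord_measure TYPE('a)) (riesz_gap s h)"
    proof (rule Bochner_Integration.integrable_bound[OF integrable_chord_powr[OF d, of s]])
      show "AE r in chord_measure TYPE('a). norm (riesz_gap s h r) \<le> norm (r powr (-s))"
        using AE_chord_measure_pos[where 'a = 'a] d riesz_gap_bounds[OF s(1) h]
        by (auto elim!: eventually_mono simp: less_imp_le)
    qed (use s in auto)
    have "(\<integral>r. riesz_gap s h r \<partial>chord_measure TYPE('a)) \<le> C * h powr ((real d - s) / 2)"
    proof -
      have "ennreal (\<integral>r. riesz_gap s h r \<partial>chord_measure TYPE('a)) = (\<integral>\<^sup>+r. ennreal (riesz_gap s h r) \<partial>chord_measure TYPE('a))"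
        using AE_chord_measure_pos[where 'a = 'a] d riesz_gap_bounds[OF s(1) h] ig
        by (intro nn_integral_eq_integral[symmetric]) (auto elim!: eventually_mono simp: less_imp_le)
      also have "\<dots> \<le> ennreal (C * h powr ((real d - s) / 2))" by (rule C(2)[OF h])
      finally show ?thesis using C by (simp add: ennreal_le_iff)
    qed
    also have "h powr ((real d - s) / 2) = N powr (s / real d - 1)"
    proof -
      have "- 2 / real d * ((real d - s) / 2) = s / real d - 1" using d by (simp add: field_simps)
      thus ?thesis by (simp only: h_def powr_powr)
    qed
    finally have "N\<^sup>2 * (\<integral>r. riesz_gap s h r \<partial>chord_measure TYPE('a)) \<le> N\<^sup>2 * (C * N powr (s / real d - 1))"
      by (intro mult_left_mono) auto
    also have "\<dots> = C * N powr (1 + s / real d)"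
      using N by (simp add: powr_diff powr_add power2_eq_square)
    finally have 1: "N\<^sup>2 * (\<integral>r. riesz_gap s h r \<partial>chord_measure TYPE('a)) \<le> C * N powr (1 + s / real d)" .
    have "u 0 \<le> 2 * h powr (-(s/2))" by (simp add: u_def)
    also have "h powr (-(s/2)) = N powr (s / real d)"
      using d by (simp add: h_def powr_powr field_simps)
    finally have "N * u 0 \<le> N * (2 * N powr (s / real d))" using N by (intro mult_left_mono) auto
    hence 2: "N * u 0 \<le> 2 * N powr (1 + s / real d)" using N by (simp add: powr_add)
    have "(\<integral>r. u r \<partial>chord_measure TYPE('a))
        = (\<integral>r. r powr (-s) \<partial>chord_measure TYPE('a)) - (\<integral>r. riesz_gap s h r \<partial>chord_measure TYPE('a))"
      unfolding gap using ig s by (intro Bochner_Integration.integral_diff integrable_chord_powr[OF d]) auto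
    with ge 1 2 show "(real (card I))\<^sup>2 * (\<integral>r. r powr (-s) \<partial>chord_measure TYPE('a)) - (C + 2) * real (card I) powr (1 + s / real d)
        \<le> (\<Sum>i\<in>I. \<Sum>j\<in>I - {i}. norm (x i - x j) powr (-s))"
      unfolding N_def[symmetric] by (simp add: algebra_simps)
  qed (use C in auto)
qed

section \<open>Moebius transformations of the sphere\<close>

text \<open>The second intersection of the sphere with the line through \<open>z\<close> and the
  interior point \<open>p\<close>: by the power of a point the two intersections lie on opposite
  sides of \<open>p\<close> and the product of their distances to \<open>p\<close> is
  \<open>1 - (norm p)\<^sup>2\<close>. Hence it is an involution, namely an inversion centred at
  \<open>p\<close> followed by the point reflection in \<open>p\<close>.\<close>

definition sphere_moebius :: "'a::real_inner \<Rightarrow> 'a \<Rightarrow> 'a" where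
  "sphere_moebius p z = p - ((1 - (norm p)\<^sup>2) / (norm (z - p))\<^sup>2) *\<^sub>R (z - p)"

lemma norm_power2_lt_1: "norm p < 1 \<Longrightarrow> (norm p)\<^sup>2 < 1" for p :: "'a::real_normed_vector"
  by (simp add: power_less_one_iff)

lemma inner_minus_eq:
  fixes p z :: "'a::real_inner"
  assumes "norm z = 1"
  shows "2 * ((z - p) \<bullet> p) = 1 - (norm p)\<^sup>2 - (norm (z - p))\<^sup>2"
proof -
  have "z \<bullet> z = 1" using assms by (simp add: dot_square_norm)
  thus ?thesis
    by (simp add: power2_norm_eq_inner inner_diff_left inner_diff_right inner_commute)
qed

lemma norm_moebius:
  fixes p z :: "'a::real_inner"
  assumes p: "norm p < 1" and z: "norm z = 1"
  shows "norm (sphere_moebius p z) = 1"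
proof -
  define w where "w = z - p"
  define c where "c = 1 - (norm p)\<^sup>2"
  define m where "m = w \<bullet> w"
  have wp: "w \<bullet> p = (c - m) / 2"
    using inner_minus_eq[OF z, of p] by (simp add: w_def c_def m_def power2_norm_eq_inner)
  have "w \<noteq> 0" using assms by (auto simp: w_def)
  hence m: "m \<noteq> 0" by (simp add: m_def)
  have "(norm (sphere_moebius p z))\<^sup>2 = (p - (c / m) *\<^sub>R w) \<bullet> (p - (c / m) *\<^sub>R w)"
    by (simp add: sphere_moebius_def w_def c_def m_def power2_norm_eq_inner)
  also have "\<dots> = p \<bullet> p - 2 * (c / m) * (w \<bullet> p) + (c / m)\<^sup>2 * m"
    by (simp add: inner_diff_left inner_diff_right inner_commute m_def power2_eq_square)
  also have "\<dots> = p \<bullet> p + c" unfolding wp using m by (simp add: power2_eq_square field_simps)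
  also have "\<dots> = 1" by (simp add: c_def power2_norm_eq_inner)
  finally show ?thesis by (simp add: abs_square_eq_1 power2_eq_1_iff)
qed

lemma norm_sphere_moebius_minus_pole:
  fixes p z :: "'a::real_inner"
  assumes "norm p < 1" "norm z = 1"
  shows "norm (sphere_moebius p z - p) = (1 - (norm p)\<^sup>2) / norm (z - p)"
  using norm_power2_lt_1[OF assms(1)] assms
  by (auto simp: sphere_moebius_def power2_eq_square)

lemma sphere_moebius_sphere_moebius:
  fixes p z :: "'a::real_inner"
  assumes p: "norm p < 1" and z: "norm z = 1"
  shows "sphere_moebius p (sphere_moebius p z) = z"
proof -
  define c where "c = 1 - (norm p)\<^sup>2"
  have c: "c > 0" using norm_power2_lt_1[OF p] by (simp add: c_def)
  have zp: "norm (z - p) > 0" using assms by auto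
  have "sphere_moebius p (sphere_moebius p z) = p - (c / (c / norm (z - p))\<^sup>2) *\<^sub>R (sphere_moebius p z - p)"
    unfolding sphere_moebius_def[of p "sphere_moebius p z"] norm_sphere_moebius_minus_pole[OF p z] by (simp add: c_def)
  also have "sphere_moebius p z - p = - (c / (norm (z - p))\<^sup>2) *\<^sub>R (z - p)"
    by (simp add: sphere_moebius_def c_def)
  finally show ?thesis using c zp by (simp add: power_divide power2_eq_square)
qed

text \<open>The distance formula of inversions. Letting \<open>w\<close> tend to \<open>z\<close>
  one reads off the conformal factor
  \<open>(1 - (norm p)\<^sup>2) / (norm (z - p))\<^sup>2\<close>.\<close>

lemma norm_moebius_diff:
  fixes p z w :: "'a::real_inner"
  assumes p: "norm p < 1" and z: "norm z = 1" and w: "norm w = 1"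
  shows "norm (sphere_moebius p z - sphere_moebius p w) = (1 - (norm p)\<^sup>2) * norm (z - w) / (norm (z - p) * norm (w - p))"
proof -
  define c where "c = 1 - (norm p)\<^sup>2"
  have c: "c > 0" using norm_power2_lt_1[OF p] by (simp add: c_def)
  define a b where "a = z - p" and "b = w - p"
  have nz: "a \<noteq> 0" "b \<noteq> 0" using assms by (auto simp: a_def b_def)
  have "sphere_moebius p z - sphere_moebius p w = (c / (norm b)\<^sup>2) *\<^sub>R b - (c / (norm a)\<^sup>2) *\<^sub>R a"
    by (simp add: sphere_moebius_def a_def b_def c_def)
  hence "(norm (sphere_moebius p z - sphere_moebius p w))\<^sup>2
      = (c / (b \<bullet> b))\<^sup>2 * (b \<bullet> b) - 2 * (c / (b \<bullet> b)) * (c / (a \<bullet> a)) * (a \<bullet> b) + (c / (a \<bullet> a))\<^sup>2 * (a \<bullet> a)"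
    by (simp add: power2_norm_eq_inner inner_diff_left inner_diff_right inner_commute) (simp add: power2_eq_square mult_ac)
  also have "\<dots> = c\<^sup>2 * (a \<bullet> a - 2 * (a \<bullet> b) + b \<bullet> b) / ((a \<bullet> a) * (b \<bullet> b))"
    using nz by (simp add: field_simps power2_eq_square)
  also have "a \<bullet> a - 2 * (a \<bullet> b) + b \<bullet> b = (norm (z - w))\<^sup>2"
  proof -
    have "z - w = a - b" by (simp add: a_def b_def)
    thus ?thesis by (simp add: power2_norm_eq_inner inner_diff_left inner_diff_right inner_commute)
  qed
  also have "c\<^sup>2 * (norm (z - w))\<^sup>2 / ((a \<bullet> a) * (b \<bullet> b)) = (c * norm (z - w) / (norm a * norm b))\<^sup>2"
    by (simp add: power_divide power_mult_distrib power2_norm_eq_inner)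
  finally have "norm (sphere_moebius p z - sphere_moebius p w) = c * norm (z - w) / (norm a * norm b)"
    using c by (subst (asm) power2_eq_iff_nonneg) auto
  thus ?thesis by (simp add: a_def b_def c_def)
qed

text \<open>The norm-preserving extension, homogeneous of degree 1. As the surface measure is
  defined through the unit ball, a change of variables in the ball under this map yields the one on
  the sphere.\<close>

definition moebius_ext :: "'a::real_inner \<Rightarrow> 'a \<Rightarrow> 'a" where
  "moebius_ext p x = norm x *\<^sub>R sphere_moebius p (sgn x)"

lemma norm_moebius_ext: "norm p < 1 \<Longrightarrow> norm (moebius_ext p x) = norm x"
  by (cases "x = 0") (simp_all add: moebius_ext_def norm_moebius norm_sgn)

lemma sgn_moebius_ext: "norm p < 1 \<Longrightarrow> x \<noteq> 0 \<Longrightarrow> sgn (moebius_ext p x) = sphere_moebius p (sgn x)"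
  using norm_moebius_ext[of p x] by (simp add: sgn_div_norm) (simp add: moebius_ext_def sgn_div_norm)

lemma moebius_ext_moebius_ext: "norm p < 1 \<Longrightarrow> moebius_ext p (moebius_ext p x) = x"
proof (cases "x = 0")
  case False
  assume p: "norm p < 1"
  have "moebius_ext p (moebius_ext p x) = norm x *\<^sub>R sphere_moebius p (sphere_moebius p (sgn x))"
    unfolding moebius_ext_def[of p "moebius_ext p x"] using p False
    by (simp add: norm_moebius_ext sgn_moebius_ext)
  also have "\<dots> = norm x *\<^sub>R sgn x" using p False by (simp add: sphere_moebius_sphere_moebius norm_sgn)
  finally show ?thesis using False by (simp add: sgn_div_norm)
qed (simp add: moebius_ext_def)

definition radial_stretch :: "real \<Rightarrow> 'a::real_inner \<Rightarrow> 'a \<Rightarrow> 'a" where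
  "radial_stretch l z v = (1 + l) *\<^sub>R (v \<bullet> z) *\<^sub>R z - l *\<^sub>R v"

text \<open>The derivative is a reflection after a map that is the identity in the radial direction and
  multiplication by minus the conformal factor in the tangential ones.\<close>

lemma has_derivative_moebius_ext:
  fixes p x :: "'a::euclidean_space"
  assumes p: "norm p < 1" and x: "x \<noteq> 0"
  shows "(moebius_ext p has_derivative (\<lambda>v. reflect_along (sgn x - p)
           (radial_stretch ((1 - (norm p)\<^sup>2) / (norm (sgn x - p))\<^sup>2) (sgn x) v))) (at x)"
proof -
  define z where "z = sgn x"
  define l where "l = (1 - (norm p)\<^sup>2) / (norm (sgn x - p))\<^sup>2"
  define R where "R = reflect_along (z - p)"
  define L where "L = radial_stretch l z"
  define w where "w = z - p"
  define c where "c = 1 - (norm p)\<^sup>2"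
  define m where "m = w \<bullet> w"
  define n where "n = norm x"
  have n: "n > 0" using x by (simp add: n_def)
  have nz: "norm z = 1" using x by (simp add: z_def norm_sgn)
  have "w \<noteq> 0" using p nz by (auto simp: w_def)
  hence m: "m > 0" by (simp add: m_def)
  have lam: "l = c / m" by (simp add: l_def c_def m_def w_def z_def power2_norm_eq_inner)
  have wp: "w \<bullet> p = (c - m) / 2"
    using inner_minus_eq[OF nz, of p] by (simp add: w_def c_def m_def power2_norm_eq_inner)
  have wz: "w \<bullet> z = (c + m) / 2"
  proof -
    have "z = w + p" by (simp add: w_def)
    thus ?thesis using wp by (simp add: inner_add_right m_def field_simps)
  qed
  \<comment> \<open>Since \<open>g y\<close> is \<open>norm y\<close> times
    \<open>sgn y - p\<close>, the map becomes \<open>norm y *\<^sub>R p - q y *\<^sub>R g y\<close>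
    with a scalar \<open>q\<close>, to which the product and quotient rules apply.\<close>
  define g where "g y = y - norm y *\<^sub>R p" for y
  have gx: "g x = n *\<^sub>R w" using x by (simp add: g_def w_def z_def n_def sgn_div_norm scaleR_diff_right)
  have gg: "g x \<bullet> g x = n\<^sup>2 * m" by (simp add: gx m_def power2_eq_square)
  have dn: "(norm has_derivative (\<lambda>v. z \<bullet> v)) (at x)"
    using has_derivative_norm[OF x] by (simp add: z_def inner_commute)
  have dg: "(g has_derivative (\<lambda>v. v - (z \<bullet> v) *\<^sub>R p)) (at x)"
    unfolding g_def by (auto intro!: derivative_eq_intros dn)
  define q where "q y = c * (norm y * norm y) / (g y \<bullet> g y)" for y
  have qx: "q x = l" using n m by (simp add: q_def gg lam n_def[symmetric] power2_eq_square)
  define q' where "q' v = 2 * c * (z \<bullet> v) / (n * m) - 2 * c * (w \<bullet> (v - (z \<bullet> v) *\<^sub>R p)) / (n * m\<^sup>2)" for v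
  have dq: "(q has_derivative q') (at x)"
  proof -
    have "(q has_derivative (\<lambda>v. (c * (n * (z \<bullet> v) + (z \<bullet> v) * n) * (g x \<bullet> g x)
            - c * (n * n) * (g x \<bullet> (v - (z \<bullet> v) *\<^sub>R p) + (v - (z \<bullet> v) *\<^sub>R p) \<bullet> g x)) / ((g x \<bullet> g x) * (g x \<bullet> g x)))) (at x)"
      unfolding q_def n_def
      by (intro has_derivative_divide' has_derivative_mult_right has_derivative_mult dn has_derivative_inner dg)
         (use gg n m in auto)
    also have "(\<lambda>v. (c * (n * (z \<bullet> v) + (z \<bullet> v) * n) * (g x \<bullet> g x)
            - c * (n * n) * (g x \<bullet> (v - (z \<bullet> v) *\<^sub>R p) + (v - (z \<bullet> v) *\<^sub>R p) \<bullet> g x)) / ((g x \<bullet> g x) * (g x \<bullet> g x))) = q'"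
    proof
      fix v
      define a where "a = z \<bullet> v"
      define b where "b = w \<bullet> (v - a *\<^sub>R p)"
      have b2: "g x \<bullet> (v - a *\<^sub>R p) = n * b" "(v - a *\<^sub>R p) \<bullet> g x = n * b"
        by (simp_all add: gx b_def inner_commute)
      show "(c * (n * (z \<bullet> v) + (z \<bullet> v) * n) * (g x \<bullet> g x)
            - c * (n * n) * (g x \<bullet> (v - (z \<bullet> v) *\<^sub>R p) + (v - (z \<bullet> v) *\<^sub>R p) \<bullet> g x)) / ((g x \<bullet> g x) * (g x \<bullet> g x)) = q' v"
        unfolding q'_def a_def[symmetric] b_def[symmetric] b2 gg
        using n m by (simp add: field_simps power2_eq_square)
    qed
    finally show ?thesis .
  qed
  have "moebius_ext p y = norm y *\<^sub>R p - q y *\<^sub>R g y" if "y \<noteq> 0" for y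
  proof -
    have s: "sgn y - p = (1 / norm y) *\<^sub>R g y"
      using that by (simp add: g_def sgn_div_norm scaleR_diff_right divide_inverse)
    have "(norm (sgn y - p))\<^sup>2 = (g y \<bullet> g y) / (norm y * norm y)"
      unfolding s power2_norm_eq_inner by simp
    thus ?thesis
      unfolding moebius_ext_def sphere_moebius_def using that
      by (simp add: s scaleR_diff_right q_def c_def)
  qed
  hence ev: "\<forall>\<^sub>F y in at x. norm y *\<^sub>R p - q y *\<^sub>R g y = moebius_ext p y"
    using eventually_neq_at_within[of 0 x UNIV] by (auto elim!: eventually_mono)
  have "((\<lambda>y. norm y *\<^sub>R p - q y *\<^sub>R g y) has_derivative
      (\<lambda>v. (z \<bullet> v) *\<^sub>R p - (q x *\<^sub>R (v - (z \<bullet> v) *\<^sub>R p) + q' v *\<^sub>R g x))) (at x)"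
    by (intro has_derivative_diff has_derivative_scaleR dq dg has_derivative_scaleR_left dn)
  also have "(\<lambda>v. (z \<bullet> v) *\<^sub>R p - (q x *\<^sub>R (v - (z \<bullet> v) *\<^sub>R p) + q' v *\<^sub>R g x)) = (\<lambda>v. R (L v))"
  proof
    fix v
    define a b where "a = z \<bullet> v" and "b = w \<bullet> v"
    have wv: "w \<bullet> (v - a *\<^sub>R p) = b - a * ((c - m) / 2)" by (simp add: inner_diff_right b_def wp)
    hence q': "q' v *\<^sub>R g x = (2 * l * a - 2 * l * (b - a * ((c - m) / 2)) / m) *\<^sub>R w"
      unfolding q'_def a_def[symmetric] gx lam wv using n m by (simp add: field_simps power2_eq_square)
    have Lv: "L v = ((1 + l) * a) *\<^sub>R (w + p) - l *\<^sub>R v"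
      by (simp add: L_def radial_stretch_def a_def w_def inner_commute)
    have "L v \<bullet> w = (1 + l) * a * ((c + m) / 2) - l * b"
    proof -
      have "L v \<bullet> w = (1 + l) * (v \<bullet> z) * (z \<bullet> w) - l * (v \<bullet> w)" by (simp add: L_def radial_stretch_def inner_diff_left)
      thus ?thesis using wz by (simp add: a_def b_def inner_commute)
    qed
    hence RL: "R (L v) = ((1 + l) * a) *\<^sub>R (w + p) - l *\<^sub>R v - (2 * ((1 + l) * a * ((c + m) / 2) - l * b) / m) *\<^sub>R w"
      by (simp add: R_def reflect_along_def w_def[symmetric] m_def[symmetric]) (simp add: Lv)
    have cm: "c = l * m" using m by (simp add: lam)
    \<comment> \<open>Apart from a multiple of \<open>w\<close>, the two sides agree term by term;
      only the scalar identity between the coefficients of \<open>w\<close> is left.\<close>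
    define X where "X = 2 * l * a - 2 * l * (b - a * ((c - m) / 2)) / m"
    define Y where "Y = 2 * ((1 + l) * a * ((c + m) / 2) - l * b) / m"
    have XY: "X = Y - (1 + l) * a"
      unfolding X_def Y_def cm using m by (simp add: field_simps)
    show "(z \<bullet> v) *\<^sub>R p - (q x *\<^sub>R (v - (z \<bullet> v) *\<^sub>R p) + q' v *\<^sub>R g x) = R (L v)"
      unfolding a_def[symmetric] q' RL qx X_def[symmetric] Y_def[symmetric] XY
      by (simp add: algebra_simps)
  qed
  finally show ?thesis unfolding R_def L_def l_def z_def
    by (rule has_derivative_transform_eventually[OF _ ev]) (use x in \<open>auto simp: \<open>\<And>y. y \<noteq> 0 \<Longrightarrow> moebius_ext p y = _ y\<close>\<close>)
qed

text \<open>The reflection contributes a factor of modulus 1. Conjugating by an orthogonal map that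
  sends a coordinate axis to \<open>z\<close> makes the stretch diagonal, with one entry 1 and all
  others \<open>- l\<close>.\<close>

lemma abs_det_reflection_scaling:
  fixes z w :: "real^'n::finite" and l :: real
  assumes z: "norm z = 1" and w: "w \<noteq> 0" and lam: "l > 0"
  shows "\<bar>det (matrix (\<lambda>v. reflect_along w (radial_stretch l z v)))\<bar> = l ^ (CARD('n) - 1)"
proof -
  define R where "R = reflect_along w"
  define L where "L = radial_stretch l z"
  have oR: "orthogonal_transformation R"
    unfolding R_def using w by (rule orthogonal_transformation_reflect_along)
  have lL: "linear L"
    by (rule linearI) (simp_all add: L_def radial_stretch_def inner_add_left algebra_simps)
  define k :: 'n where "k = undefined"
  have "norm (axis k 1 :: real^'n) = norm z" using z by simp
  then obtain T :: "real^'n \<Rightarrow> real^'n" where T: "orthogonal_transformation T" "T (axis k 1) = z"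
    by (rule orthogonal_transformation_exists_unit) blast
  have lT: "linear T" using T by (simp add: orthogonal_transformation_linear)
  define D :: "real^'n \<Rightarrow> real^'n" where "D v = ((1 + l) * v $ k) *\<^sub>R axis k 1 - l *\<^sub>R v" for v
  have lD: "linear D" by (rule linearI) (simp_all add: D_def algebra_simps)
  have "L \<circ> T = T \<circ> D"
  proof
    fix v
    have "T v \<bullet> z = v $ k"
      using T by (simp flip: T(2) add: orthogonal_transformation_def inner_axis)
    thus "(L \<circ> T) v = (T \<circ> D) v"
      by (simp add: L_def radial_stretch_def D_def linear_diff[OF lT] linear_scale[OF lT] T(2))
  qed
  hence "matrix L ** matrix T = matrix T ** matrix D"
    using lL lT lD by (metis matrix_compose)
  hence "det (matrix L) * det (matrix T) = det (matrix T) * det (matrix D)"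
    by (metis det_mul)
  moreover have "\<bar>det (matrix T)\<bar> = 1" using T by simp
  ultimately have dL: "det (matrix L) = det (matrix D)" by auto
  have D_nth: "matrix D $ i $ j = (if i = j then if i = k then 1 else - l else 0)" for i j
    by (auto simp: matrix_def D_def axis_def)
  have "det (matrix D) = (\<Prod>i\<in>UNIV. if i = k then 1 else - l)"
    by (subst det_diagonal) (auto simp: D_nth intro!: prod.cong)
  also have "\<dots> = (\<Prod>i\<in>UNIV - {k}. if i = k then 1 else - l)"
    by (subst prod.remove[of _ k]) auto
  also have "\<dots> = (\<Prod>i\<in>UNIV - {k}. - l)" by (intro prod.cong) auto
  also have "\<dots> = (- l) ^ (CARD('n) - 1)" by (simp add: card_Diff_singleton)
  finally have "\<bar>det (matrix L)\<bar> = l ^ (CARD('n) - 1)"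
    using lam by (simp add: dL power_abs)
  moreover have "matrix (\<lambda>v. R (L v)) = matrix R ** matrix L"
    using matrix_compose[OF lL orthogonal_transformation_linear[OF oR]] by (simp add: comp_def)
  ultimately show ?thesis using oR by (simp add: det_mul abs_mult R_def L_def)
qed

lemma ball_moebius_image:
  fixes p :: "'a::euclidean_space"
  assumes "norm p < 1"
  shows "moebius_ext p ` {x. x \<noteq> 0 \<and> norm x < 1 \<and> sphere_moebius p (sgn x) \<in> A} = {x. x \<noteq> 0 \<and> norm x < 1 \<and> sgn x \<in> A}"
proof safe
  fix x assume x: "x \<noteq> 0" "norm x < 1" "sphere_moebius p (sgn x) \<in> A"
  show "norm (moebius_ext p x) < 1" "sgn (moebius_ext p x) \<in> A"
    using x assms by (auto simp: norm_moebius_ext sgn_moebius_ext)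
  assume "moebius_ext p x = 0"
  thus False using x norm_moebius_ext[OF assms, of x] by simp
next
  fix x assume x: "x \<noteq> 0" "norm x < 1" "sgn x \<in> A"
  have ne: "moebius_ext p x \<noteq> 0" using x norm_moebius_ext[OF assms, of x] by auto
  have "sphere_moebius p (sgn (moebius_ext p x)) = sgn x"
    using x assms by (simp add: sgn_moebius_ext sphere_moebius_sphere_moebius norm_sgn)
  thus "x \<in> moebius_ext p ` {x. x \<noteq> 0 \<and> norm x < 1 \<and> sphere_moebius p (sgn x) \<in> A}"
    using ne x assms by (intro image_eqI[of _ _ "moebius_ext p x"]) (auto simp: moebius_ext_moebius_ext norm_moebius_ext)
qed

lemma sphere_moebius_measurable [measurable]:
  "(sphere_moebius p :: 'a::euclidean_space \<Rightarrow> 'a) \<in> borel_measurable borel"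
  unfolding sphere_moebius_def[abs_def] by measurable

text \<open>The origin is cut out of the ball because the derivative of \<open>moebius_ext\<close>
  is available only away from it.\<close>

lemma nn_integral_sphere_measure:
  fixes f :: "'a::euclidean_space \<Rightarrow> ennreal"
  assumes [measurable]: "f \<in> borel_measurable borel"
  shows "(\<integral>\<^sup>+y. f y \<partial>sphere_measure)
    = (\<integral>\<^sup>+x. f (sgn x) * indicator {x. x \<noteq> 0 \<and> norm x < 1} x \<partial>lborel) / emeasure lborel (ball (0::'a) 1)"
proof -
  have "(\<integral>\<^sup>+y. f y \<partial>sphere_measure) = (\<integral>\<^sup>+x. f (sgn x) * indicator (ball 0 1) x \<partial>lborel) / emeasure lborel (ball (0::'a) 1)"
    unfolding sphere_measure_def
    by (subst nn_integral_distr) (auto simp: nn_integral_uniform_measure)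
  also have "(\<integral>\<^sup>+x. f (sgn x) * indicator (ball 0 1) x \<partial>lborel)
      = (\<integral>\<^sup>+x. f (sgn x) * indicator {x. x \<noteq> 0 \<and> norm x < 1} x \<partial>lborel)"
  proof (rule nn_integral_cong_AE)
    show "AE x in lborel. f (sgn x) * indicator (ball 0 1) x = f (sgn x) * indicator {x. x \<noteq> 0 \<and> norm x < 1} x"
      using AE_lborel_singleton[of "0::'a"] by eventually_elim (simp add: indicator_def)
  qed
  finally show ?thesis .
qed

text \<open>It suffices to test the weighted image measure on Borel sets \<open>A\<close>. There the
  identity compares the parts of the ball over the preimage of \<open>A\<close> and over
  \<open>A\<close>; \<open>moebius_ext p\<close> maps the first bijectively onto the second, with a
  Jacobian that depends only on the direction.\<close>

lemma nn_integral_sphere_moebius_wellorder: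
  fixes p :: "real^'n::{finite,wellorder}"
  assumes p: "norm p < 1" and f [measurable]: "f \<in> borel_measurable borel"
  shows "(\<integral>\<^sup>+z. f (sphere_moebius p z) * ennreal (((1 - (norm p)\<^sup>2) / (norm (z - p))\<^sup>2) ^ (CARD('n) - 1)) \<partial>sphere_measure)
           = (\<integral>\<^sup>+z. f z \<partial>sphere_measure)"
proof -
  define l where "l z = ((1 - (norm p)\<^sup>2) / (norm (z - p))\<^sup>2) ^ (CARD('n) - 1)" for z
  have c: "1 - (norm p)\<^sup>2 > 0" using norm_power2_lt_1[OF p] by simp
  have [measurable]: "l \<in> borel_measurable borel" unfolding l_def by measurable
  have l0: "l z \<ge> 0" for z using c by (simp add: l_def)
  define M where "M = distr (density sphere_measure (\<lambda>z. ennreal (l z))) borel (sphere_moebius p)"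
  have "M = sphere_measure"
  proof (rule measure_eqI)
    fix A assume "A \<in> sets M"
    hence A [measurable]: "A \<in> sets borel" by (simp add: M_def)
    define S where "S = {x. x \<noteq> 0 \<and> norm x < 1 \<and> sphere_moebius p (sgn x) \<in> A}"
    have S [measurable]: "S \<in> sets borel"
    proof -
      have "S = {x \<in> space borel. x \<noteq> 0 \<and> norm x < 1 \<and> sphere_moebius p (sgn x) \<in> A}" by (simp add: S_def)
      also have "\<dots> \<in> sets borel" by measurable
      finally show ?thesis .
    qed
    define S' where "S' = {x::real^'n::_. x \<noteq> 0 \<and> norm x < 1 \<and> sgn x \<in> A}"
    have S' [measurable]: "S' \<in> sets borel"
    proof -
      have "S' = {x \<in> space borel. x \<noteq> 0 \<and> norm x < 1 \<and> sgn x \<in> A}" by (simp add: S'_def)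
      also have "\<dots> \<in> sets borel" by measurable
      finally show ?thesis .
    qed
    have im: "moebius_ext p ` S = S'" unfolding S_def S'_def by (rule ball_moebius_image[OF p])
    have inj: "inj_on (moebius_ext p) S"
      by (rule inj_on_inverseI[where g = "moebius_ext p"]) (simp add: moebius_ext_moebius_ext p)
    have "bounded S'" by (rule bounded_subset[of "ball 0 1"]) (auto simp: S'_def)
    moreover have leb: "T \<in> sets lebesgue" if "T \<in> sets borel" for T :: "(real^'n::_) set"
      using that by (intro sets_completionI_sets) simp
    ultimately have lm: "S' \<in> lmeasurable" using S' by (intro bounded_set_imp_lmeasurable leb)
    define F where "F x = (\<lambda>v. reflect_along (sgn x - p)
           (radial_stretch ((1 - (norm p)\<^sup>2) / (norm (sgn x - p))\<^sup>2) (sgn x) v))" for x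
    have der: "(moebius_ext p has_derivative F x) (at x within S)" if "x \<in> S" for x
      unfolding F_def using that
      by (intro has_derivative_at_withinI[OF has_derivative_moebius_ext[OF p]]) (simp add: S_def)
    have det: "\<bar>det (matrix (F x))\<bar> = l (sgn x)" if "x \<in> S" for x
    proof -
      have ns: "norm (sgn x) = 1" using that by (simp add: S_def norm_sgn)
      hence ne: "sgn x - p \<noteq> 0" using p by auto
      show ?thesis unfolding F_def l_def
        using c ne by (intro abs_det_reflection_scaling ns) auto
    qed
    have "((\<lambda>x. \<bar>det (matrix (F x))\<bar>) has_integral (measure lebesgue S')) S"
      using has_measure_differentiable_image[OF leb[OF S] der inj, of "measure lebesgue S'"] lm im by simp
    hence "((\<lambda>x. l (sgn x)) has_integral (measure lebesgue S')) S"
      by (rule has_integral_eq[rotated]) (simp add: det)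
    hence "(\<integral>\<^sup>+x. ennreal (l (sgn x)) * indicator S x \<partial>lborel) = ennreal (measure lebesgue S')"
      by (intro nn_integral_has_integral_lebesgue' l0)
    also have "\<dots> = emeasure lborel S'"
    proof -
      have "emeasure lborel S' = emeasure lebesgue S'" using S' by simp
      also have "\<dots> = ennreal (measure lebesgue S')" using lm by (rule emeasure_eq_measure2)
      finally show ?thesis ..
    qed
    finally have eq: "(\<integral>\<^sup>+x. ennreal (l (sgn x)) * indicator S x \<partial>lborel) = emeasure lborel S'" .
    have "emeasure M A = (\<integral>\<^sup>+z. ennreal (l z) * indicator (sphere_moebius p -` A) z \<partial>sphere_measure)"
    proof -
      have "sphere_moebius p -` A \<in> sets borel"
        by (rule measurable_sets_borel[OF sphere_moebius_measurable A])
      thus ?thesis unfolding M_def by (subst emeasure_distr) (auto simp: emeasure_density)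
    qed
    also have "\<dots> = (\<integral>\<^sup>+x. ennreal (l (sgn x)) * indicator (sphere_moebius p -` A) (sgn x) * indicator {x. x \<noteq> 0 \<and> norm x < 1} x \<partial>lborel)
        / emeasure lborel (ball (0::real^'n::_) 1)"
      by (intro nn_integral_sphere_measure borel_measurable_times borel_measurable_indicator
            measurable_sets_borel[OF sphere_moebius_measurable]) auto
    also have "(\<integral>\<^sup>+x. ennreal (l (sgn x)) * indicator (sphere_moebius p -` A) (sgn x) * indicator {x. x \<noteq> 0 \<and> norm x < 1} x \<partial>lborel)
        = emeasure lborel S'"
      unfolding eq[symmetric] by (intro nn_integral_cong) (auto simp: S_def indicator_def)
    also have "emeasure lborel S' = (\<integral>\<^sup>+x. indicator A (sgn x) * indicator {x. x \<noteq> 0 \<and> norm x < 1} x \<partial>lborel)"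
    proof -
      have "emeasure lborel S' = (\<integral>\<^sup>+x. indicator S' x \<partial>lborel)" using S' by simp
      also have "\<dots> = (\<integral>\<^sup>+x. indicator A (sgn x) * indicator {x. x \<noteq> 0 \<and> norm x < 1} x \<partial>lborel)"
        by (intro nn_integral_cong) (auto simp: S'_def indicator_def)
      finally show ?thesis .
    qed
    also have "\<dots> / emeasure lborel (ball (0::real^'n::_) 1) = (\<integral>\<^sup>+z. indicator A z \<partial>sphere_measure)"
      by (rule nn_integral_sphere_measure[symmetric]) measurable
    also have "\<dots> = emeasure sphere_measure A" by simp
    finally show "emeasure M A = emeasure sphere_measure A" .
  qed (simp add: M_def)
  hence "(\<integral>\<^sup>+z. f z \<partial>sphere_measure) = (\<integral>\<^sup>+z. f z \<partial>M)" by simp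
  also have "\<dots> = (\<integral>\<^sup>+z. f (sphere_moebius p z) \<partial>density sphere_measure (\<lambda>z. ennreal (l z)))"
    unfolding M_def by (subst nn_integral_distr) auto
  also have "\<dots> = (\<integral>\<^sup>+z. f (sphere_moebius p z) * ennreal (l z) \<partial>sphere_measure)"
    by (subst nn_integral_density) (auto simp: mult.commute)
  finally show ?thesis by (simp add: l_def)
qed

text \<open>The change-of-variables theorem of the library needs a well-ordered index type, so we pass to a copy of it.\<close>

typedef ('n::finite) index_copy = "{..<CARD('n)}" by (rule exI[of _ 0]) simp

instantiation index_copy :: (finite) linorder
begin

definition less_eq_index_copy :: "'a index_copy \<Rightarrow> 'a index_copy \<Rightarrow> bool" where
  "i \<le> j \<longleftrightarrow> Rep_index_copy i \<le> Rep_index_copy j"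

definition less_index_copy :: "'a index_copy \<Rightarrow> 'a index_copy \<Rightarrow> bool" where
  "i < j \<longleftrightarrow> Rep_index_copy i < Rep_index_copy j"

instance
  by standard (auto simp: less_eq_index_copy_def less_index_copy_def Rep_index_copy_inject)

end

instance index_copy :: (finite) finite
proof
  have "(UNIV :: 'a index_copy set) = Abs_index_copy ` {..<CARD('a)}"
    by (rule type_definition.Abs_image[OF type_definition_index_copy, symmetric])
  thus "finite (UNIV :: 'a index_copy set)" by (metis finite_imageI finite_lessThan)
qed

instance index_copy :: (finite) wellorder
proof
  fix P :: "'a index_copy \<Rightarrow> bool" and a :: "'a index_copy"
  assume step: "\<And>x. (\<And>y. y < x \<Longrightarrow> P y) \<Longrightarrow> P x"
  show "P a"
  proof (induction "Rep_index_copy a" arbitrary: a rule: less_induct)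
    case less
    show ?case
    proof (rule step)
      fix y assume "y < a"
      thus "P y" unfolding less_index_copy_def by (rule less)
    qed
  qed
qed

lemma CARD_index_copy [simp]: "CARD('n::finite index_copy) = CARD('n)"
  using type_definition.card[OF type_definition_index_copy[where 'n = 'n]] by simp

lemma bij_index_copy: obtains f :: "'n::finite \<Rightarrow> 'n index_copy" where "bij f"
  using finite_same_card_bij[of "UNIV :: 'n set" "UNIV :: 'n index_copy set"] by auto

lemma prod_Basis_vec:
  fixes g :: "real^'n::finite \<Rightarrow> real"
  shows "(\<Prod>b\<in>Basis. g b) = (\<Prod>i\<in>UNIV. g (axis i 1))"
proof -
  have B: "(Basis :: (real^'n) set) = range (\<lambda>i. axis i 1)" by (auto simp: Basis_vec_def)
  have "inj (\<lambda>i. axis i 1 :: real^'n)" by (auto simp: inj_on_def axis_eq_axis)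
  thus ?thesis unfolding B by (subst prod.reindex) simp_all
qed

text \<open>A relabelling of coordinates between two index types of equal size: a linear isometry
  that preserves Lebesgue and surface measure and intertwines the Moebius maps.\<close>

definition permute_coords :: "('n \<Rightarrow> 'm) \<Rightarrow> real^'m \<Rightarrow> real^'n" where
  "permute_coords f y = (\<chi> i. y $ f i)"

context
  fixes f :: "'n::finite \<Rightarrow> 'm::finite"
  assumes f: "bij f"
begin

lemma linear_permute_coords: "linear (permute_coords f)"
  by (rule linearI) (simp_all add: permute_coords_def vec_eq_iff)

lemma inner_permute_coords: "permute_coords f x \<bullet> permute_coords f y = x \<bullet> y"
  using sum.reindex_bij_betw[OF f, of "\<lambda>i. x $ i * y $ i"] by (simp add: permute_coords_def inner_vec_def)

lemma norm_permute_coords: "norm (permute_coords f x) = norm x"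
  by (simp add: norm_eq_sqrt_inner inner_permute_coords)

lemma permute_coords_measurable [measurable]: "permute_coords f \<in> borel_measurable borel"
  using linear_permute_coords by (intro borel_measurable_continuous_onI linear_continuous_on)
    (simp add: linear_conv_bounded_linear)

lemma surj_permute_coords: obtains x where "permute_coords f x = y"
proof
  show "permute_coords f (\<chi> j. y $ (inv f j)) = y"
    using f by (simp add: permute_coords_def vec_eq_iff bij_is_inj)
qed

lemma lborel_distr_permute_coords: "distr lborel borel (permute_coords f) = lborel"
proof (rule lborel_eqI[symmetric])
  fix l u :: "real^'n"
  assume lu: "\<And>b. b \<in> Basis \<Longrightarrow> l \<bullet> b \<le> u \<bullet> b"
  hence lu': "l $ i \<le> u $ i" for i
    by (force simp: Basis_vec_def cart_eq_inner_axis)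
  define g where "g = inv f"
  have gf: "f (g j) = j" "g (f i) = i" for i j using f by (simp_all add: g_def bij_is_surj surj_f_inv_f bij_is_inj)
  let ?l = "(\<chi> j. l $ g j) :: real^'m" and ?u = "(\<chi> j. u $ g j) :: real^'m"
  have "permute_coords f -` box l u = box ?l ?u"
    by (auto simp: mem_box_cart permute_coords_def gf) (metis gf)+
  hence "emeasure (distr lborel borel (permute_coords f)) (box l u) = emeasure lborel (box ?l ?u)"
    by (subst emeasure_distr) auto
  also have "\<dots> = (\<Prod>b\<in>Basis. (?u - ?l) \<bullet> b)"
    using lu' by (intro emeasure_lborel_box) (auto simp: Basis_vec_def inner_axis)
  also have "(\<Prod>b\<in>Basis. (?u - ?l) \<bullet> b) = (\<Prod>j\<in>UNIV. u $ g j - l $ g j)"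
    by (simp add: prod_Basis_vec inner_axis)
  also have "\<dots> = (\<Prod>i\<in>UNIV. u $ i - l $ i)"
    using prod.reindex_bij_betw[of g UNIV UNIV "\<lambda>i. u $ i - l $ i"] f by (simp add: g_def bij_imp_bij_inv)
  also have "\<dots> = (\<Prod>b\<in>Basis. (u - l) \<bullet> b)" by (simp add: prod_Basis_vec inner_axis)
  finally show "emeasure (distr lborel borel (permute_coords f)) (box l u) = (\<Prod>b\<in>Basis. (u - l) \<bullet> b)" .
qed simp

lemma nn_integral_sphere_permute_coords:
  fixes h :: "real^'n \<Rightarrow> ennreal"
  assumes [measurable]: "h \<in> borel_measurable borel"
  shows "(\<integral>\<^sup>+z. h z \<partial>sphere_measure) = (\<integral>\<^sup>+y. h (permute_coords f y) \<partial>sphere_measure)"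
proof -
  have "{x \<in> space borel. x \<noteq> (0::real^'n) \<and> norm x < 1} \<in> sets borel" by measurable
  hence B [measurable]: "{x::real^'n. x \<noteq> 0 \<and> norm x < 1} \<in> sets borel" by simp
  have B' [measurable]: "ball (0::real^'n) 1 \<in> sets borel" by (intro borel_open open_ball)
  have sg: "sgn (permute_coords f y) = permute_coords f (sgn y)" for y
    by (simp add: sgn_div_norm norm_permute_coords linear_scale[OF linear_permute_coords])
  have z: "permute_coords f y = 0 \<longleftrightarrow> y = 0" for y
    using norm_permute_coords[of y] by (metis norm_eq_zero)
  have "(\<integral>\<^sup>+x. h (sgn x) * indicator {x. x \<noteq> 0 \<and> norm x < 1} x \<partial>lborel)
      = (\<integral>\<^sup>+x. h (sgn x) * indicator {x. x \<noteq> 0 \<and> norm x < 1} x \<partial>distr lborel borel (permute_coords f))"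
    by (simp add: lborel_distr_permute_coords)
  also have "\<dots> = (\<integral>\<^sup>+y. h (permute_coords f (sgn y)) * indicator {x. x \<noteq> 0 \<and> norm x < 1} y \<partial>lborel)"
    by (subst nn_integral_distr) (auto simp: sg norm_permute_coords z indicator_def intro!: nn_integral_cong)
  finally have 1: "(\<integral>\<^sup>+x. h (sgn x) * indicator {x. x \<noteq> 0 \<and> norm x < 1} x \<partial>lborel) = \<dots>" .
  have "emeasure lborel (ball (0::real^'n) 1) = emeasure (distr lborel borel (permute_coords f)) (ball (0::real^'n) 1)"
    by (simp add: lborel_distr_permute_coords)
  also have "\<dots> = emeasure lborel (permute_coords f -` ball (0::real^'n) 1)"
    using B' by (subst emeasure_distr) auto
  also have "permute_coords f -` ball (0::real^'n) 1 = ball (0::real^'m) 1"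
    by (auto simp: norm_permute_coords)
  finally have 2: "emeasure lborel (ball (0::real^'n) 1) = emeasure lborel (ball (0::real^'m) 1)" .
  have "(\<lambda>y. h (permute_coords f y)) \<in> borel_measurable borel" by measurable
  thus ?thesis by (simp add: nn_integral_sphere_measure 1 2)
qed

lemma sphere_moebius_permute_coords:
  "sphere_moebius (permute_coords f p) (permute_coords f z) = permute_coords f (sphere_moebius p z)"
  by (simp only: sphere_moebius_def norm_permute_coords linear_scale[OF linear_permute_coords, symmetric]
      linear_diff[OF linear_permute_coords, symmetric])

end

lemma nn_integral_sphere_moebius:
  fixes p :: "real^'n::finite"
  assumes p: "norm p < 1" and [measurable]: "f \<in> borel_measurable borel"
  shows "(\<integral>\<^sup>+z. f (sphere_moebius p z) * ennreal (((1 - (norm p)\<^sup>2) / (norm (z - p))\<^sup>2) ^ (CARD('n) - 1)) \<partial>sphere_measure)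
           = (\<integral>\<^sup>+z. f z \<partial>sphere_measure)"
proof -
  obtain g :: "'n \<Rightarrow> 'n index_copy" where g: "bij g" by (rule bij_index_copy)
  let ?J = "permute_coords g"
  note [measurable] = permute_coords_measurable[OF g]
  obtain q where q: "?J q = p" by (rule surj_permute_coords[OF g])
  have nq: "norm q = norm p" using norm_permute_coords[OF g, of q] q by simp
  have "(\<integral>\<^sup>+z. f (sphere_moebius p z) * ennreal (((1 - (norm p)\<^sup>2) / (norm (z - p))\<^sup>2) ^ (CARD('n) - 1)) \<partial>sphere_measure)
     = (\<integral>\<^sup>+y. f (sphere_moebius p (?J y)) * ennreal (((1 - (norm p)\<^sup>2) / (norm (?J y - p))\<^sup>2) ^ (CARD('n) - 1)) \<partial>sphere_measure)"
    by (rule nn_integral_sphere_permute_coords[OF g]) measurable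
  also have "\<dots> = (\<integral>\<^sup>+y. f (?J (sphere_moebius q y)) * ennreal (((1 - (norm q)\<^sup>2) / (norm (y - q))\<^sup>2) ^ (CARD('n index_copy) - 1)) \<partial>sphere_measure)"
    unfolding q[symmetric] sphere_moebius_permute_coords[OF g] linear_diff[OF linear_permute_coords[OF g], symmetric]
      norm_permute_coords[OF g] CARD_index_copy ..
  also have "\<dots> = (\<integral>\<^sup>+y. f (?J y) \<partial>sphere_measure)"
    by (rule nn_integral_sphere_moebius_wellorder) (use p nq in \<open>simp_all\<close>)
  also have "\<dots> = (\<integral>\<^sup>+z. f z \<partial>sphere_measure)"
    by (rule nn_integral_sphere_permute_coords[OF g, symmetric]) measurable
  finally show ?thesis .
qed

text \<open>The mean of the kernel about the unit vector \<open>sphere_moebius p x\<close> is the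
  universal constant. Substituting the Moebius map and using the distance formula turns it into the
  kernel at \<open>x\<close> against a density in \<open>z\<close> alone, times a power of
  \<open>norm (x - p)\<close>. So the potential of this density on the sphere is a constant multiple
  of that of the point mass at \<open>p\<close>: it sweeps the point mass onto the sphere.\<close>

lemma nn_integral_riesz_moebius:
  fixes p x :: "real^'n::finite" and s :: real
  assumes d: "CARD('n) = d + 1" and p: "norm p < 1" and x: "norm x = 1"
  defines "c \<equiv> 1 - (norm p)\<^sup>2"
  shows "(\<integral>\<^sup>+z. ennreal (norm (x - z) powr (-s) * (c powr (real d - s) * norm (z - p) powr (s - 2 * real d))) \<partial>sphere_measure)
           = ennreal (norm (x - p) powr (-s)) * (\<integral>\<^sup>+r. ennreal (r powr (-s)) \<partial>chord_measure TYPE(real^'n))"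
proof -
  have c: "c > 0" using norm_power2_lt_1[OF p] by (simp add: c_def)
  have xp: "norm (x - p) > 0" using x p by auto
  let ?\<phi> = "sphere_moebius p"
  have "(\<integral>\<^sup>+r. ennreal (r powr (-s)) \<partial>chord_measure TYPE(real^'n)) = (\<integral>\<^sup>+z. ennreal (norm (?\<phi> x - z) powr (-s)) \<partial>sphere_measure)"
    by (rule nn_integral_chord[symmetric]) (simp_all add: norm_moebius p x)
  also have "\<dots> = (\<integral>\<^sup>+z. ennreal (norm (?\<phi> x - ?\<phi> z) powr (-s)) * ennreal ((c / (norm (z - p))\<^sup>2) ^ (CARD('n) - 1)) \<partial>sphere_measure)"
    unfolding c_def by (rule nn_integral_sphere_moebius[symmetric]) (use p in simp_all)
  also have "\<dots> = (\<integral>\<^sup>+z. ennreal (norm (x - p) powr s) *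
      ennreal (norm (x - z) powr (-s) * (c powr (real d - s) * norm (z - p) powr (s - 2 * real d))) \<partial>sphere_measure)"
  proof (rule nn_integral_cong_AE)
    show "AE z in sphere_measure. ennreal (norm (?\<phi> x - ?\<phi> z) powr (-s)) * ennreal ((c / (norm (z - p))\<^sup>2) ^ (CARD('n) - 1))
      = ennreal (norm (x - p) powr s) * ennreal (norm (x - z) powr (-s) * (c powr (real d - s) * norm (z - p) powr (s - 2 * real d)))"
      using AE_sphere_measure
    proof eventually_elim
      case (elim z)
      hence z: "norm z = 1" by simp
      hence zp: "norm (z - p) > 0" using p by auto
      have 1: "norm (?\<phi> x - ?\<phi> z) powr (-s)
          = c powr (-s) * norm (x - z) powr (-s) * norm (x - p) powr s * norm (z - p) powr s"
        unfolding norm_moebius_diff[OF p x z] c_def[symmetric] using c xp zp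
        by (simp add: powr_mult powr_divide powr_minus field_simps)
      have 2: "(c / (norm (z - p))\<^sup>2) ^ (CARD('n) - 1) = c powr real d * norm (z - p) powr (- 2 * real d)"
      proof -
        have "(c / (norm (z - p))\<^sup>2) ^ (CARD('n) - 1) = (c / (norm (z - p)) powr 2) powr real d"
          using c zp d by (simp add: powr_realpow)
        also have "\<dots> = c powr real d / norm (z - p) powr (2 * real d)"
          using c zp by (simp add: powr_divide square_powr_half[OF zp])
        finally show ?thesis by (simp add: powr_minus divide_inverse)
      qed
      have 3: "c powr (-s) * c powr real d = c powr (real d - s)" by (simp flip: powr_add)
      have 4: "norm (z - p) powr s * norm (z - p) powr (- 2 * real d) = norm (z - p) powr (s - 2 * real d)"
        by (simp flip: powr_add)
      have "norm (?\<phi> x - ?\<phi> z) powr (-s) * (c / (norm (z - p))\<^sup>2) ^ (CARD('n) - 1)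
          = norm (x - p) powr s * (norm (x - z) powr (-s) * (c powr (real d - s) * norm (z - p) powr (s - 2 * real d)))"
        unfolding 1 2 3[symmetric] 4[symmetric] by (simp only: mult_ac)
      thus ?case using c by (simp flip: ennreal_mult)
    qed
  qed
  also have "\<dots> = ennreal (norm (x - p) powr s) *
      (\<integral>\<^sup>+z. ennreal (norm (x - z) powr (-s) * (c powr (real d - s) * norm (z - p) powr (s - 2 * real d))) \<partial>sphere_measure)"
    by (rule nn_integral_cmult) measurable
  finally have eq: "(\<integral>\<^sup>+r. ennreal (r powr (-s)) \<partial>chord_measure TYPE(real^'n)) = \<dots>" .
  have "norm (x - p) powr (-s) * norm (x - p) powr s = 1" using xp by (simp flip: powr_add)
  thus ?thesis unfolding eq mult.assoc[symmetric] by (simp flip: ennreal_mult)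
qed

section \<open>Polarization for Riesz kernels\<close>

text \<open>The swept density of a pole near \<open>y\<close> as a function of the chord
  \<open>r\<close> to \<open>y\<close>, scaled so that its potential is the mean of the kernel times
  \<open>(r\<^sup>2 + h) powr (-s/2)\<close>. The factor \<open>h * (4 + h)\<close> is
  \<open>((1 - \<rho>\<^sup>2) / \<rho>)\<^sup>2\<close> for a pole at distance
  \<open>\<rho>\<close> from the origin.\<close>

definition riesz_sweep :: "nat \<Rightarrow> real \<Rightarrow> real \<Rightarrow> real \<Rightarrow> real" where
  "riesz_sweep d s h r = (h * (4 + h)) powr ((real d - s) / 2) * (r\<^sup>2 + h) powr (s / 2 - real d)"

lemma riesz_sweep_measurable [measurable]: "riesz_sweep d s h \<in> borel_measurable borel"
  unfolding riesz_sweep_def by measurable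

text \<open>The preceding identity at the pole \<open>p = \<rho> y\<close> with \<open>\<rho> + 1 / \<rho> = 2 + h\<close>, so that
  \<open>(norm (z - p))\<^sup>2 = \<rho> * ((norm (z - y))\<^sup>2 + h)\<close> on the sphere.\<close>

lemma nn_integral_riesz_sweep:
  fixes x y :: "real^'n::finite" and s :: real
  assumes d: "CARD('n) = d + 1" and x: "norm x = 1" and y: "norm y = 1" and h: "h > 0"
  shows "(\<integral>\<^sup>+z. ennreal (norm (x - z) powr (-s) * riesz_sweep d s h (norm (y - z))) \<partial>sphere_measure)
           = ennreal (((norm (x - y))\<^sup>2 + h) powr (-s/2)) * (\<integral>\<^sup>+r. ennreal (r powr (-s)) \<partial>chord_measure TYPE(real^'n))"
proof -
  define S where "S = sqrt (h * (4 + h))"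
  \<comment> \<open>The larger root of \<open>t\<^sup>2 - (2 + h) * t + 1\<close>, so that
    \<open>\<rho> = 1 / t\<close> is the smaller one and lies inside the ball.\<close>
  define t where "t = (2 + h + S) / 2"
  define \<rho> where "\<rho> = 1 / t"
  have "S > 0" using h by (simp add: S_def)
  hence "2 + h + S > 2" using h add_pos_pos[of h S] by simp
  hence t: "t > 1" by (simp add: t_def)
  hence rho: "0 < \<rho>" "\<rho> < 1" by (simp_all add: \<rho>_def)
  have "2 * t - (2 + h) = S" by (simp add: t_def field_simps)
  hence "(2 * t - (2 + h))\<^sup>2 = h * (4 + h)" using h by (simp add: S_def)
  hence t2: "t * t = (2 + h) * t - 1" by (simp add: power2_eq_square algebra_simps)
  have s1: "1 + \<rho>\<^sup>2 = (2 + h) * \<rho>"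
    using t t2 by (simp add: \<rho>_def field_simps power2_eq_square)
  define p where "p = \<rho> *\<^sub>R y"
  have np: "norm p = \<rho>" using rho y by (simp add: p_def)
  have dist: "norm (z - p) = sqrt \<rho> * sqrt ((norm (y - z))\<^sup>2 + h)" if z: "norm z = 1" for z
  proof -
    have zz: "z \<bullet> z = 1" "y \<bullet> y = 1" using z y by (simp_all add: dot_square_norm)
    have "(norm (z - p))\<^sup>2 = 1 + \<rho>\<^sup>2 - 2 * \<rho> * (z \<bullet> y)"
      unfolding power2_norm_eq_inner p_def using zz
      by (simp add: inner_diff_left inner_diff_right inner_commute power2_eq_square)
    also have "\<dots> = \<rho> * ((norm (y - z))\<^sup>2 + h)"
      unfolding s1 power2_norm_eq_inner using zz
      by (simp add: inner_diff_left inner_diff_right inner_commute algebra_simps)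
    finally have "norm (z - p) = sqrt (\<rho> * ((norm (y - z))\<^sup>2 + h))"
      by (metis abs_norm_cancel real_sqrt_abs)
    thus ?thesis by (simp add: real_sqrt_mult)
  qed
  have pw: "norm (z - p) powr q = \<rho> powr (q / 2) * ((norm (y - z))\<^sup>2 + h) powr (q / 2)" if "norm z = 1" for z q
    unfolding dist[OF that] using rho h
    by (simp add: powr_mult powr_half_sqrt[symmetric] powr_powr add_nonneg_pos)
  define c where "c = 1 - \<rho>\<^sup>2"
  have c: "c > 0" using rho by (simp add: c_def power_less_one_iff)
  have "c / \<rho> = sqrt (h * (4 + h))"
  proof -
    have "c / \<rho> = t - 1 / t" using t by (simp add: c_def \<rho>_def field_simps power2_eq_square)
    also have "1 / t = 2 + h - t" using t t2 by (simp add: field_simps)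
    also have "t - (2 + h - t) = sqrt (h * (4 + h))" by (simp add: t_def S_def[symmetric])
    finally show ?thesis .
  qed
  hence cr: "c powr (real d - s) = \<rho> powr (real d - s) * (h * (4 + h)) powr ((real d - s) / 2)"
    using rho h c by (simp add: divide_eq_eq powr_mult powr_half_sqrt[symmetric] powr_powr mult_ac)
  have "(\<integral>\<^sup>+z. ennreal (norm (x - z) powr (-s) * riesz_sweep d s h (norm (y - z))) \<partial>sphere_measure)
     = (\<integral>\<^sup>+z. ennreal (\<rho> powr (s / 2)) * ennreal (norm (x - z) powr (-s) * (c powr (real d - s) * norm (z - p) powr (s - 2 * real d))) \<partial>sphere_measure)"
  proof (rule nn_integral_cong_AE)
    show "AE z in sphere_measure. ennreal (norm (x - z) powr (-s) * riesz_sweep d s h (norm (y - z)))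
      = ennreal (\<rho> powr (s / 2)) * ennreal (norm (x - z) powr (-s) * (c powr (real d - s) * norm (z - p) powr (s - 2 * real d)))"
      using AE_sphere_measure
    proof eventually_elim
      case (elim z)
      hence z: "norm z = 1" by simp
      have r1: "\<rho> powr (s / 2) * (\<rho> powr (real d - s) * \<rho> powr ((s - 2 * real d) / 2)) = 1"
        using rho by (simp add: diff_divide_distrib flip: powr_add)
      have e: "(s - 2 * real d) / 2 = s / 2 - real d" by (simp add: diff_divide_distrib)
      have eq: "\<rho> powr (s / 2) * (norm (x - z) powr (-s) * (c powr (real d - s) * norm (z - p) powr (s - 2 * real d)))
         = norm (x - z) powr (-s) * riesz_sweep d s h (norm (y - z))" (is "?l = ?r")
      proof -
        have "?l = (\<rho> powr (s / 2) * (\<rho> powr (real d - s) * \<rho> powr ((s - 2 * real d) / 2))) * ?r"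
          unfolding pw[OF z] cr riesz_sweep_def e by (simp only: mult_ac)
        thus ?thesis unfolding r1 by simp
      qed
      show ?case unfolding eq[symmetric] using c by (intro ennreal_mult) auto
    qed
  qed
  also have "\<dots> = ennreal (\<rho> powr (s / 2)) * (\<integral>\<^sup>+z. ennreal (norm (x - z) powr (-s) * (c powr (real d - s) * norm (z - p) powr (s - 2 * real d))) \<partial>sphere_measure)"
    by (rule nn_integral_cmult) measurable
  also have "\<dots> = ennreal (\<rho> powr (s / 2) * norm (x - p) powr (-s)) * (\<integral>\<^sup>+r. ennreal (r powr (-s)) \<partial>chord_measure TYPE(real^'n))"
    using nn_integral_riesz_moebius[OF d, of p x s] np rho x by (simp add: c_def mult.assoc ennreal_mult)
  also have "\<rho> powr (s / 2) * norm (x - p) powr (-s) = ((norm (x - y))\<^sup>2 + h) powr (-s/2)"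
    unfolding pw[OF x] using rho by (simp add: norm_minus_commute flip: powr_add mult.assoc)
  finally show ?thesis .
qed

lemma AE_sphere_neq:
  fixes x :: "'a::euclidean_space"
  assumes "DIM('a) \<ge> 2" "norm x = 1"
  shows "AE y in sphere_measure. y \<noteq> x"
proof -
  have "AE r in chord_measure TYPE('a). r \<noteq> 0"
    using AE_chord_measure_pos[OF assms(1)] by eventually_elim auto
  hence "AE y in sphere_measure. norm (x - y) \<noteq> 0"
    unfolding distr_chord[OF assms(2), symmetric] by (subst (asm) AE_distr_iff) auto
  thus ?thesis by eventually_elim auto
qed

text \<open>Integrate over the union of the caps.\<close>

lemma integral_ge_bumps:
  fixes x :: "'i \<Rightarrow> 'a::euclidean_space" and g :: "real \<Rightarrow> real"
  assumes dim: "DIM('a) \<ge> 2" and I: "finite I" "\<And>i. i \<in> I \<Longrightarrow> norm (x i) = 1"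
    and f: "integrable sphere_measure f" "AE y in sphere_measure. f y \<ge> 0"
      "AE y in sphere_measure. f y \<ge> (\<Sum>i\<in>I. g (norm (x i - y))) - real (card I) * c"
    and g: "integrable (chord_measure TYPE('a)) g" "\<And>r. r > 0 \<Longrightarrow> g r \<ge> 0" and c: "c \<ge> 0"
  shows "real (card I) * ((\<integral>r. g r * indicator {..R} r \<partial>chord_measure TYPE('a))
            - c * (real (card I) * measure (chord_measure TYPE('a)) {..R}))
          \<le> (\<integral>y. f y \<partial>sphere_measure)"
proof -
  interpret S: prob_space "sphere_measure :: 'a measure" by (rule prob_space_sphere_measure)
  interpret M: prob_space "chord_measure TYPE('a)" by (rule prob_space_chord_measure)
  define N where "N = real (card I)"
  have [measurable]: "g \<in> borel_measurable borel"
    using borel_measurable_integrable[OF g(1)] by simp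
  have [measurable]: "f \<in> borel_measurable borel"
    using borel_measurable_integrable[OF f(1)] by simp
  define F where "F = (\<Union>i\<in>I. {y. norm (x i - y) \<in> {..R}})"
  have cap [measurable]: "{y. norm (x i - y) \<in> {..R}} \<in> sets borel" for i
  proof -
    have "{y \<in> space borel. norm (x i - y) \<in> {..R}} \<in> sets borel" by measurable
    thus ?thesis by simp
  qed
  have F [measurable]: "F \<in> sets borel" unfolding F_def using I by (intro sets.finite_UN cap) auto
  have cap_measure: "measure sphere_measure {y. norm (x i - y) \<in> {..R}} = measure (chord_measure TYPE('a)) {..R}" if "i \<in> I" for i
    using emeasure_chord[OF I(2)[OF that], of "{..R}"] by (simp add: measure_def)
  have "measure sphere_measure F \<le> (\<Sum>i\<in>I. measure sphere_measure {y. norm (x i - y) \<in> {..R}})"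
    unfolding F_def using I by (intro S.finite_measure_subadditive_finite) (auto simp del: atMost_iff)
  also have "\<dots> = (\<Sum>i\<in>I. measure (chord_measure TYPE('a)) {..R})"
    by (intro sum.cong refl cap_measure)
  also have "\<dots> = N * measure (chord_measure TYPE('a)) {..R}"
    by (simp add: N_def)
  finally have mF: "measure sphere_measure F \<le> N * measure (chord_measure TYPE('a)) {..R}" .
  let ?h = "\<lambda>r. g r * indicator {..R} r"
  have ih: "integrable (chord_measure TYPE('a)) ?h"
    using g(1) by (rule integrable_real_mult_indicator[rotated]) simp
  have ihx: "integrable sphere_measure (\<lambda>y. ?h (norm (x i - y)))" if "i \<in> I" for i
    using ih integrable_chord[OF I(2)[OF that], of ?h] by simp
  have iF: "integrable sphere_measure (\<lambda>y. N * c * indicator F y)"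
    by (intro integrable_mult_right integrable_real_indicator) (auto simp: S.emeasure_eq_measure)
  have pos: "AE y in sphere_measure. \<forall>i\<in>I. y \<noteq> x i"
    using I by (intro AE_finite_allI AE_sphere_neq[OF dim]) auto
  have "(\<integral>y. (\<Sum>i\<in>I. ?h (norm (x i - y))) - N * c * indicator F y \<partial>sphere_measure)
      \<le> (\<integral>y. f y \<partial>sphere_measure)"
  proof (rule integral_mono_AE)
    \<comment> \<open>On the union \<open>F\<close> of the caps the bump estimate is used, off
      \<open>F\<close> only nonnegativity. The loss \<open>N * c\<close> is thus paid only on
      \<open>F\<close>, whose measure is at most \<open>N\<close> times that of one cap.\<close>
    show "AE y in sphere_measure. (\<Sum>i\<in>I. ?h (norm (x i - y))) - N * c * indicator F y \<le> f y"
      using f(2,3) pos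
    proof eventually_elim
      case (elim y)
      show ?case
      proof (cases "y \<in> F")
        case True
        have "(\<Sum>i\<in>I. ?h (norm (x i - y))) \<le> (\<Sum>i\<in>I. g (norm (x i - y)))"
          using elim(3) by (intro sum_mono) (auto simp: indicator_def intro!: g(2))
        thus ?thesis using elim(2) True by (simp add: N_def)
      next
        case False
        hence "(\<Sum>i\<in>I. ?h (norm (x i - y))) = 0"
          by (intro sum.neutral) (auto simp: F_def)
        thus ?thesis using elim(1) False by simp
      qed
    qed
  qed (use ihx iF f in auto)
  also have "(\<integral>y. (\<Sum>i\<in>I. ?h (norm (x i - y))) - N * c * indicator F y \<partial>sphere_measure)
      = (\<Sum>i\<in>I. \<integral>y. ?h (norm (x i - y)) \<partial>sphere_measure) - N * c * measure sphere_measure F"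
    using ihx iF by (subst Bochner_Integration.integral_diff) (auto simp: Bochner_Integration.integral_sum)
  also have "(\<Sum>i\<in>I. \<integral>y. ?h (norm (x i - y)) \<partial>sphere_measure) = (\<Sum>i\<in>I. \<integral>r. ?h r \<partial>chord_measure TYPE('a))"
    by (intro sum.cong refl integral_chord I) measurable
  also have "\<dots> = N * (\<integral>r. ?h r \<partial>chord_measure TYPE('a))" by (simp add: N_def)
  finally have 1: "N * (\<integral>r. ?h r \<partial>chord_measure TYPE('a)) - N * c * measure sphere_measure F \<le> (\<integral>y. f y \<partial>sphere_measure)" .
  have "N * c * measure sphere_measure F \<le> N * c * (N * measure (chord_measure TYPE('a)) {..R})"
    using c mF by (intro mult_left_mono) (auto simp: N_def)
  with 1 show ?thesis by (simp add: N_def algebra_simps)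
qed

definition riesz_mean :: "'a::euclidean_space itself \<Rightarrow> real \<Rightarrow> real" where
  "riesz_mean _ s = (\<integral>r. r powr (-s) \<partial>chord_measure TYPE('a))"

lemma riesz_mean_pos:
  assumes d: "DIM('a::euclidean_space) = d + 1" "d \<ge> 1" and s: "0 \<le> s" "s < real d"
  shows "riesz_mean TYPE('a) s > 0"
proof -
  interpret M: prob_space "chord_measure TYPE('a)" by (rule prob_space_chord_measure)
  have "(\<integral>r. 2 powr (-s) \<partial>chord_measure TYPE('a)) \<le> riesz_mean TYPE('a) s"
    unfolding riesz_mean_def
  proof (rule integral_mono_AE)
    show "AE r in chord_measure TYPE('a). 2 powr (-s) \<le> r powr (-s)"
      using AE_chord_measure_pos[where 'a = 'a] d s
      by (auto simp del: AE_conj_iff elim!: eventually_mono intro!: powr_mono2')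
  qed (use integrable_chord_powr[OF d s] in auto)
  moreover have "(\<integral>r. 2 powr (-s) \<partial>chord_measure TYPE('a)) = 2 powr (-s)" using M.prob_space by simp
  moreover have "2 powr (-s) > 0" by simp
  ultimately show ?thesis by linarith
qed

lemma nn_integral_riesz_mean:
  assumes d: "DIM('a::euclidean_space) = d + 1" "d \<ge> 1" and s: "0 \<le> s" "s < real d"
  shows "(\<integral>\<^sup>+r. ennreal (r powr (-s)) \<partial>chord_measure TYPE('a)) = ennreal (riesz_mean TYPE('a) s)"
  unfolding riesz_mean_def using integrable_chord_powr[OF d s] by (intro nn_integral_eq_integral) auto

lemma integrable_chord_shifted:
  fixes h p :: real
  assumes "h > 0" "p \<ge> 0"
  shows "integrable (chord_measure TYPE('a::euclidean_space)) (\<lambda>r. (r\<^sup>2 + h) powr (-p))"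
proof -
  interpret M: prob_space "chord_measure TYPE('a)" by (rule prob_space_chord_measure)
  show ?thesis
    using assms by (intro M.integrable_const_bound[of _ "h powr (-p)"] AE_I2) (auto intro!: powr_mono2')
qed

context
  fixes d :: nat and s :: real
  assumes d: "d \<ge> 2" "CARD('n::finite) = d + 1" and s: "0 < s" "s < real d"
begin

lemma DIM_eq: "DIM(real^'n) = d + 1"
  using d by simp

lemma DIM_ge_2: "DIM(real^'n) \<ge> 2"
  using d by simp

lemma has_integral_riesz_sweep:
  fixes x y :: "real^'n"
  assumes x: "norm x = 1" and y: "norm y = 1" and h: "h > 0"
  shows "has_bochner_integral sphere_measure (\<lambda>z. norm (x - z) powr (-s) * riesz_sweep d s h (norm (y - z)))
           (riesz_mean TYPE(real^'n) s * ((norm (x - y))\<^sup>2 + h) powr (-s/2))"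
proof (rule has_bochner_integral_nn_integral)
  have "(\<integral>\<^sup>+z. ennreal (norm (x - z) powr (-s) * riesz_sweep d s h (norm (y - z))) \<partial>sphere_measure)
           = ennreal (((norm (x - y))\<^sup>2 + h) powr (-s/2)) * ennreal (riesz_mean TYPE(real^'n) s)"
    using nn_integral_riesz_sweep[OF d(2) x y h, of s] nn_integral_riesz_mean[OF DIM_eq _, of s] d s by simp
  also have "\<dots> = ennreal (riesz_mean TYPE(real^'n) s * ((norm (x - y))\<^sup>2 + h) powr (-s/2))"
    using riesz_mean_pos[OF DIM_eq _, of s] d s by (simp add: ennreal_mult mult.commute)
  finally show "(\<integral>\<^sup>+z. ennreal (norm (x - z) powr (-s) * riesz_sweep d s h (norm (y - z))) \<partial>sphere_measure)
     = ennreal (riesz_mean TYPE(real^'n) s * ((norm (x - y))\<^sup>2 + h) powr (-s/2))" .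
  show "0 \<le> riesz_mean TYPE(real^'n) s * ((norm (x - y))\<^sup>2 + h) powr (-s/2)"
    using riesz_mean_pos[OF DIM_eq _, of s] d s by (intro mult_nonneg_nonneg) auto
qed (auto simp: riesz_sweep_def intro!: AE_I2)

text \<open>Integrate the potential identity over \<open>x\<close> as well. By Tonelli the left side
  becomes the mean of the kernel times the mass of the density, the right side the same mean times
  the mean of the regularised kernel.\<close>

lemma integral_chord_riesz_sweep:
  assumes h: "h > 0"
  shows "(\<integral>r. riesz_sweep d s h r \<partial>chord_measure TYPE(real^'n))
           = (\<integral>r. (r\<^sup>2 + h) powr (-s/2) \<partial>chord_measure TYPE(real^'n))"
    and "integrable (chord_measure TYPE(real^'n)) (riesz_sweep d s h)"
proof -
  interpret S: prob_space "sphere_measure :: (real^'n) measure" by (rule prob_space_sphere_measure)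
  interpret SS: pair_sigma_finite "sphere_measure :: (real^'n) measure" "sphere_measure :: (real^'n) measure" ..
  let ?W = "riesz_mean TYPE(real^'n) s"
  have W: "?W > 0" using riesz_mean_pos[OF DIM_eq _, of s] d s by simp
  obtain y :: "real^'n" where y: "norm y = 1" using ex_unit_vector by blast
  show int: "integrable (chord_measure TYPE(real^'n)) (riesz_sweep d s h)"
    unfolding riesz_sweep_def using integrable_chord_shifted[OF h, of "real d - s/2", where 'a = "real^'n"] d s
    by (intro integrable_mult_right) simp
  let ?f = "\<lambda>x z. ennreal (norm (x - z) powr (-s) * riesz_sweep d s h (norm (y - z)))"
  have sw0: "riesz_sweep d s h r \<ge> 0" for r by (simp add: riesz_sweep_def)
  have "(\<integral>\<^sup>+x. (\<integral>\<^sup>+z. ?f x z \<partial>sphere_measure) \<partial>sphere_measure) = (\<integral>\<^sup>+x. ennreal (?W * ((norm (y - x))\<^sup>2 + h) powr (-s/2)) \<partial>sphere_measure)"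
  proof (rule nn_integral_cong_AE)
    show "AE x in sphere_measure. (\<integral>\<^sup>+z. ?f x z \<partial>sphere_measure) = ennreal (?W * ((norm (y - x))\<^sup>2 + h) powr (-s/2))"
      using AE_sphere_measure
    proof eventually_elim
      case (elim x)
      hence x: "norm x = 1" by simp
      show ?case
        using nn_integral_riesz_sweep[OF d(2) x y h, of s] nn_integral_riesz_mean[OF DIM_eq _, of s] d s W
        by (simp add: norm_minus_commute ennreal_mult mult.commute)
    qed
  qed
  also have "\<dots> = (\<integral>\<^sup>+r. ennreal (?W * (r\<^sup>2 + h) powr (-s/2)) \<partial>chord_measure TYPE(real^'n))"
    by (rule nn_integral_chord[OF y]) measurable
  also have "\<dots> = ennreal (\<integral>r. ?W * (r\<^sup>2 + h) powr (-s/2) \<partial>chord_measure TYPE(real^'n))"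
    using W integrable_chord_shifted[OF h, of "s/2", where 'a = "real^'n"] s by (intro nn_integral_eq_integral integrable_mult_right) auto
  finally have 1: "(\<integral>\<^sup>+x. (\<integral>\<^sup>+z. ?f x z \<partial>sphere_measure) \<partial>sphere_measure)
      = ennreal (?W * (\<integral>r. (r\<^sup>2 + h) powr (-s/2) \<partial>chord_measure TYPE(real^'n)))" by simp
  have "(\<integral>\<^sup>+x. (\<integral>\<^sup>+z. ?f x z \<partial>sphere_measure) \<partial>sphere_measure) = (\<integral>\<^sup>+z. (\<integral>\<^sup>+x. ?f x z \<partial>sphere_measure) \<partial>sphere_measure)"
    by (rule SS.Fubini'[symmetric]) measurable
  also have "\<dots> = (\<integral>\<^sup>+z. ennreal (?W * riesz_sweep d s h (norm (y - z))) \<partial>sphere_measure)"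
  proof (rule nn_integral_cong_AE)
    show "AE z in sphere_measure. (\<integral>\<^sup>+x. ?f x z \<partial>sphere_measure) = ennreal (?W * riesz_sweep d s h (norm (y - z)))"
      using AE_sphere_measure
    proof eventually_elim
      case (elim z)
      hence z: "norm z = 1" by simp
      have "(\<integral>\<^sup>+x. ?f x z \<partial>sphere_measure) = (\<integral>\<^sup>+x. ennreal (norm (z - x) powr (-s)) * ennreal (riesz_sweep d s h (norm (y - z))) \<partial>sphere_measure)"
        using sw0 by (simp add: ennreal_mult norm_minus_commute)
      also have "\<dots> = (\<integral>\<^sup>+x. ennreal (norm (z - x) powr (-s)) \<partial>sphere_measure) * ennreal (riesz_sweep d s h (norm (y - z)))"
        by (rule nn_integral_multc) measurable
      also have "(\<integral>\<^sup>+x. ennreal (norm (z - x) powr (-s)) \<partial>sphere_measure) = ennreal ?W"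
        using nn_integral_chord[OF z, of "\<lambda>r. ennreal (r powr (-s))"] nn_integral_riesz_mean[OF DIM_eq _, of s] d s by simp
      finally show ?case using W sw0 by (simp add: ennreal_mult)
    qed
  qed
  also have "\<dots> = (\<integral>\<^sup>+r. ennreal (?W * riesz_sweep d s h r) \<partial>chord_measure TYPE(real^'n))"
    by (rule nn_integral_chord[OF y]) measurable
  also have "\<dots> = ennreal (\<integral>r. ?W * riesz_sweep d s h r \<partial>chord_measure TYPE(real^'n))"
    using W int sw0 by (intro nn_integral_eq_integral integrable_mult_right) auto
  finally have "ennreal (?W * (\<integral>r. riesz_sweep d s h r \<partial>chord_measure TYPE(real^'n)))
      = ennreal (?W * (\<integral>r. (r\<^sup>2 + h) powr (-s/2) \<partial>chord_measure TYPE(real^'n)))"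
    unfolding 1 by simp
  hence "?W * (\<integral>r. riesz_sweep d s h r \<partial>chord_measure TYPE(real^'n))
      = ?W * (\<integral>r. (r\<^sup>2 + h) powr (-s/2) \<partial>chord_measure TYPE(real^'n))"
    using W sw0 by (subst (asm) ennreal_inj) (auto intro!: mult_nonneg_nonneg integral_nonneg_AE)
  thus "(\<integral>r. riesz_sweep d s h r \<partial>chord_measure TYPE(real^'n))
           = (\<integral>r. (r\<^sup>2 + h) powr (-s/2) \<partial>chord_measure TYPE(real^'n))" using W by simp
qed

end

section \<open>Combination of two swept measures\<close>

lemma square_add_pos [simp]: "h > 0 \<Longrightarrow> 0 < r\<^sup>2 + h" for r h :: real
  by (simp add: add_nonneg_pos)

text \<open>The weight \<open>b\<close> with \<open>1 + b = b * q\<close>, where \<open>q\<close> is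
  the ratio of the values of \<open>h * (4 + h)\<close> at levels \<open>2 * h\<close> and
  \<open>h\<close>. Positivity of the combined density then reduces to
  \<open>q powr ((d - s) / 2) \<le> q\<close>. For small \<open>h\<close> it is close to 1, the
  weight of the plain second difference.\<close>

definition swept_weight :: "real \<Rightarrow> real" where
  "swept_weight h = (4 + h) / (4 + 3 * h)"

definition swept_gap :: "real \<Rightarrow> real \<Rightarrow> real \<Rightarrow> real" where
  "swept_gap s h r = r powr (-s) - (1 + swept_weight h) * (r\<^sup>2 + h) powr (-s/2)
     + swept_weight h * (r\<^sup>2 + 2 * h) powr (-s/2)"

lemma swept_gap_measurable [measurable]: "swept_gap s h \<in> borel_measurable borel"
  unfolding swept_gap_def by measurable

lemma swept_weight_bounds:
  assumes "h > 0"
  shows "0 < swept_weight h" "swept_weight h < 1" "1 - swept_weight h \<le> h / 2"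
    "1 + swept_weight h = swept_weight h * (2 * (4 + 2 * h) / (4 + h))"
proof -
  show "0 < swept_weight h" "swept_weight h < 1" "1 - swept_weight h \<le> h / 2"
    using assms by (simp_all add: swept_weight_def field_simps)
  have "swept_weight h * (2 * (4 + 2 * h) / (4 + h)) = 2 * (4 + 2 * h) / (4 + 3 * h)"
    using assms by (simp add: swept_weight_def)
  moreover have "1 + swept_weight h = 2 * (4 + 2 * h) / (4 + 3 * h)"
    using assms by (simp add: swept_weight_def field_simps)
  ultimately show "1 + swept_weight h = swept_weight h * (2 * (4 + 2 * h) / (4 + h))" by simp
qed

lemma swept_gap_eq:
  "swept_gap s h r = riesz_gap s h r + (1 - swept_weight h) * ((r\<^sup>2 + h) powr (-s/2) - (r\<^sup>2 + 2 * h) powr (-s/2))"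
  by (simp add: swept_gap_def riesz_gap_def algebra_simps)

text \<open>The deviation of the weight from 1 adds a nonnegative correction of size at most
  \<open>h / 2 * r powr (-s)\<close>. Its mean is of order \<open>h\<close>, hence for
  \<open>h \<le> 1\<close> not larger than \<open>h powr ((d - s) / 2)\<close> when
  \<open>d - s \<le> 2\<close>.\<close>

lemma swept_gap_bounds:
  assumes "s > 0" "h > 0" "r > 0"
  shows "riesz_gap s h r \<le> swept_gap s h r" "0 < swept_gap s h r"
    "swept_gap s h r \<le> riesz_gap s h r + h / 2 * r powr (-s)"
proof -
  have 1: "(r\<^sup>2 + 2 * h) powr (-s/2) \<le> (r\<^sup>2 + h) powr (-s/2)"
    using assms by (intro powr_mono2') auto
  thus *: "riesz_gap s h r \<le> swept_gap s h r"
    unfolding swept_gap_eq using swept_weight_bounds[OF assms(2)] by (simp add: mult_nonneg_nonneg)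
  show "0 < swept_gap s h r" using * riesz_gap_bounds(2)[OF assms] by linarith
  have "(r\<^sup>2 + h) powr (-s/2) \<le> (r\<^sup>2) powr (-s/2)" using assms by (intro powr_mono2') auto
  also have "(r\<^sup>2) powr (-s/2) = r powr (-s)" using square_powr_half[OF assms(3), of "-s/2"] by simp
  finally have "(r\<^sup>2 + h) powr (-s/2) - (r\<^sup>2 + 2 * h) powr (-s/2) \<le> r powr (-s)"
    using powr_ge_zero[of "r\<^sup>2 + 2 * h" "-s/2"] by linarith
  hence "(1 - swept_weight h) * ((r\<^sup>2 + h) powr (-s/2) - (r\<^sup>2 + 2 * h) powr (-s/2)) \<le> h / 2 * r powr (-s)"
    using swept_weight_bounds[OF assms(2)] 1 by (intro mult_mono) auto
  thus "swept_gap s h r \<le> riesz_gap s h r + h / 2 * r powr (-s)" unfolding swept_gap_eq by simp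
qed

text \<open>The combination of the two swept measures is positive exactly because \<open>d - s \<le> 2\<close>.\<close>

lemma swept_density_nonneg:
  assumes "h > 0" "0 \<le> s" "s \<le> real d" "real d - 2 \<le> s"
  shows "0 \<le> (1 + swept_weight h) * riesz_sweep d s h r - swept_weight h * riesz_sweep d s (2 * h) r"
proof -
  let ?a = "(real d - s) / 2"
  let ?q = "2 * (4 + 2 * h) / (4 + h)"
  have q: "?q \<ge> 1" using assms by (simp add: field_simps)
  have "2 * h * (4 + 2 * h) = ?q * (h * (4 + h))" using assms by (simp add: field_simps)
  hence "(2 * h * (4 + 2 * h)) powr ?a = ?q powr ?a * (h * (4 + h)) powr ?a"
    using assms by (simp only: powr_mult)
  also have "\<dots> \<le> ?q powr 1 * (h * (4 + h)) powr ?a"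
    using q assms by (intro mult_right_mono powr_mono) auto
  also have "?q powr 1 = ?q" by (rule powr_one) (use q in linarith)
  finally have 1: "(2 * h * (4 + 2 * h)) powr ?a \<le> ?q * (h * (4 + h)) powr ?a" .
  have "(r\<^sup>2 + 2 * h) powr (s / 2 - real d) \<le> (r\<^sup>2 + h) powr (s / 2 - real d)"
    using assms by (intro powr_mono2') (auto intro: add_nonneg_pos)
  hence "(2 * h * (4 + 2 * h)) powr ?a * (r\<^sup>2 + 2 * h) powr (s / 2 - real d)
      \<le> ?q * (h * (4 + h)) powr ?a * (r\<^sup>2 + h) powr (s / 2 - real d)"
    using 1 q assms by (intro mult_mono) auto
  hence "swept_weight h * riesz_sweep d s (2 * h) r \<le> swept_weight h * (?q * riesz_sweep d s h r)"
    using swept_weight_bounds[OF assms(1)] by (intro mult_left_mono) (auto simp: riesz_sweep_def mult_ac)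
  also have "\<dots> = (1 + swept_weight h) * riesz_sweep d s h r"
    using swept_weight_bounds(4)[OF assms(1)] by (simp add: mult_ac)
  finally show ?thesis by simp
qed

lemma integrable_swept_gap:
  assumes d: "DIM('a::euclidean_space) = d + 1" "d \<ge> 1" and s: "0 < s" "s < real d" and h: "h > 0"
  shows "integrable (chord_measure TYPE('a)) (swept_gap s h)"
proof -
  have "integrable (chord_measure TYPE('a)) (\<lambda>r. (r\<^sup>2 + h) powr (-s/2))"
    "integrable (chord_measure TYPE('a)) (\<lambda>r. (r\<^sup>2 + 2 * h) powr (-s/2))"
    using integrable_chord_shifted[of h "s/2", where 'a = 'a] integrable_chord_shifted[of "2 * h" "s/2", where 'a = 'a] s h by simp_all
  moreover have "integrable (chord_measure TYPE('a)) (\<lambda>r. r powr (-s))"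
    using integrable_chord_powr[OF d, of s] s by simp
  ultimately show ?thesis unfolding swept_gap_def[abs_def] by auto
qed

context
  fixes d :: nat and s :: real
  assumes d: "d \<ge> 2" "CARD('n::finite) = d + 1" and s: "0 < s" "s < real d" "real d - 2 \<le> s"
begin

text \<open>The combined density \<open>Q\<close> is nonnegative, has mass \<open>W - c\<close>, and
  integrates the kernel about \<open>x i\<close> to \<open>W\<close> times the kernel minus the gap.
  Integrating the lower bound \<open>u\<close> of the potential against \<open>Q\<close> and
  dividing by \<open>W\<close> gives the claim; the term \<open>u * c / W\<close> is due to
  \<open>Q\<close> having mass less than \<open>W\<close>.\<close>

lemma riesz_potential_ge:
  fixes x :: "'i \<Rightarrow> real^'n" and y :: "real^'n"
  assumes I: "finite I" "\<And>i. i \<in> I \<Longrightarrow> norm (x i) = 1" and y: "norm y = 1" and h: "h > 0"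
    and u: "\<And>z. norm z = 1 \<Longrightarrow> z \<notin> x ` I \<Longrightarrow> u \<le> (\<Sum>i\<in>I. norm (x i - z) powr (-s))"
  defines "W \<equiv> riesz_mean TYPE(real^'n) s" and "c \<equiv> \<integral>r. swept_gap s h r \<partial>chord_measure TYPE(real^'n)"
  shows "u - u * c / W + (\<Sum>i\<in>I. swept_gap s h (norm (x i - y))) \<le> (\<Sum>i\<in>I. norm (x i - y) powr (-s))"
proof -
  note D = DIM_eq[OF d s(1,2)]
  have W: "W > 0" unfolding W_def using riesz_mean_pos[OF D, of s] d s by simp
  let ?b = "swept_weight h"
  define Q where "Q z = (1 + ?b) * riesz_sweep d s h (norm (y - z)) - ?b * riesz_sweep d s (2 * h) (norm (y - z))" for z
  have Q0: "Q z \<ge> 0" for z unfolding Q_def using h s d by (intro swept_density_nonneg) auto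
  have sw: "has_bochner_integral sphere_measure (\<lambda>z. riesz_sweep d s k (norm (y - z)))
      (\<integral>r. (r\<^sup>2 + k) powr (-s/2) \<partial>chord_measure TYPE(real^'n))" if "k > 0" for k
    using integral_chord_riesz_sweep[OF d s(1,2) that] integral_chord[OF y, of "riesz_sweep d s k"]
      integrable_chord[OF y, of "riesz_sweep d s k"] by (simp add: has_bochner_integral_iff)
  have "has_bochner_integral sphere_measure Q
     ((1 + ?b) * (\<integral>r. (r\<^sup>2 + h) powr (-s/2) \<partial>chord_measure TYPE(real^'n))
       - ?b * (\<integral>r. (r\<^sup>2 + 2 * h) powr (-s/2) \<partial>chord_measure TYPE(real^'n)))"
    unfolding Q_def using h by (intro has_bochner_integral_diff has_bochner_integral_mult_right sw) auto
  also have "(1 + ?b) * (\<integral>r. (r\<^sup>2 + h) powr (-s/2) \<partial>chord_measure TYPE(real^'n))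
       - ?b * (\<integral>r. (r\<^sup>2 + 2 * h) powr (-s/2) \<partial>chord_measure TYPE(real^'n)) = W - c"
  proof -
    have "integrable (chord_measure TYPE(real^'n)) (\<lambda>r. (r\<^sup>2 + h) powr (-s/2))"
      "integrable (chord_measure TYPE(real^'n)) (\<lambda>r. (r\<^sup>2 + 2 * h) powr (-s/2))"
      using integrable_chord_shifted[of h "s/2", where 'a = "real^'n"] integrable_chord_shifted[of "2 * h" "s/2", where 'a = "real^'n"] s h by simp_all
    moreover have "integrable (chord_measure TYPE(real^'n)) (\<lambda>r. r powr (-s))"
      using integrable_chord_powr[OF D, of s] s d by simp
    ultimately show ?thesis unfolding W_def c_def riesz_mean_def swept_gap_def
      by (subst Bochner_Integration.integral_add Bochner_Integration.integral_diff; auto)+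
  qed
  finally have iQ: "has_bochner_integral sphere_measure Q (W - c)" .
  have iK: "has_bochner_integral sphere_measure (\<lambda>z. norm (x i - z) powr (-s) * Q z)
      (W * (norm (x i - y) powr (-s) - swept_gap s h (norm (x i - y))))" if i: "i \<in> I" for i
  proof -
    have "has_bochner_integral sphere_measure
       (\<lambda>z. (1 + ?b) * (norm (x i - z) powr (-s) * riesz_sweep d s h (norm (y - z)))
          - ?b * (norm (x i - z) powr (-s) * riesz_sweep d s (2 * h) (norm (y - z))))
       ((1 + ?b) * (W * ((norm (x i - y))\<^sup>2 + h) powr (-s/2)) - ?b * (W * ((norm (x i - y))\<^sup>2 + 2 * h) powr (-s/2)))"
      unfolding W_def using h
      by (intro has_bochner_integral_diff has_bochner_integral_mult_right has_integral_riesz_sweep[OF d s(1,2)] I i y) auto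
    thus ?thesis by (simp add: Q_def swept_gap_def algebra_simps)
  qed
  have b1: "has_bochner_integral sphere_measure (\<lambda>z. \<Sum>i\<in>I. norm (x i - z) powr (-s) * Q z)
      (\<Sum>i\<in>I. W * (norm (x i - y) powr (-s) - swept_gap s h (norm (x i - y))))"
    by (intro has_bochner_integral_sum iK)
  have b2: "has_bochner_integral sphere_measure (\<lambda>z. u * Q z) (u * (W - c))"
    by (intro has_bochner_integral_mult_right iQ)
  have b3: "AE z in sphere_measure. u * Q z \<le> (\<Sum>i\<in>I. norm (x i - z) powr (-s) * Q z)"
  proof -
    have "AE z in sphere_measure. \<forall>i\<in>I. z \<noteq> x i"
      using I by (intro AE_finite_allI AE_sphere_neq DIM_ge_2[OF d s(1,2)]) auto
    thus ?thesis using AE_sphere_measure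
    proof eventually_elim
      case (elim z)
      have "u * Q z \<le> (\<Sum>i\<in>I. norm (x i - z) powr (-s)) * Q z"
        using elim by (intro mult_right_mono u Q0) auto
      thus ?case by (simp add: sum_distrib_right)
    qed
  qed
  have "u * (W - c) \<le> (\<Sum>i\<in>I. W * (norm (x i - y) powr (-s) - swept_gap s h (norm (x i - y))))"
    using integral_mono_AE[OF _ _ b3] b1[unfolded has_bochner_integral_iff] b2[unfolded has_bochner_integral_iff]
    by (simp only: conj_assoc)
  also have "\<dots> = W * ((\<Sum>i\<in>I. norm (x i - y) powr (-s)) - (\<Sum>i\<in>I. swept_gap s h (norm (x i - y))))"
    by (simp add: sum_distrib_left sum_subtractf right_diff_distrib)
  finally have "u * (W - c) / W \<le> (\<Sum>i\<in>I. norm (x i - y) powr (-s)) - (\<Sum>i\<in>I. swept_gap s h (norm (x i - y)))"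
    using W by (simp add: pos_divide_le_eq mult.commute)
  moreover have "u * (W - c) / W = u - u * c / W" using W by (simp add: field_simps)
  ultimately show ?thesis by linarith
qed

lemma riesz_polarization:
  obtains C where "C > 0"
    "\<And>I (x :: 'i \<Rightarrow> real^'n) u. finite I \<Longrightarrow> I \<noteq> {} \<Longrightarrow> (\<And>i. i \<in> I \<Longrightarrow> norm (x i) = 1) \<Longrightarrow> u \<ge> 0 \<Longrightarrow>
      (\<And>z. norm z = 1 \<Longrightarrow> z \<notin> x ` I \<Longrightarrow> u \<le> (\<Sum>i\<in>I. norm (x i - z) powr (-s))) \<Longrightarrow>
      u \<le> real (card I) * riesz_mean TYPE(real^'n) s - C * real (card I) powr (s / real d)"
proof -
  note D = DIM_eq[OF d s(1,2)]
  note D2 = DIM_ge_2[OF d s(1,2)]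
  let ?\<mu> = "chord_measure TYPE(real^'n)"
  interpret S: prob_space "sphere_measure :: (real^'n) measure" by (rule prob_space_sphere_measure)
  interpret M: prob_space ?\<mu> by (rule prob_space_chord_measure)
  define W where "W = riesz_mean TYPE(real^'n) s"
  have W: "W > 0" unfolding W_def using riesz_mean_pos[OF D, of s] d s by simp
  obtain C0 where C0: "C0 > 0" "\<And>r. r \<ge> 0 \<Longrightarrow> emeasure ?\<mu> {..r} \<le> ennreal (C0 * r ^ d)"
    using chord_measure_le[where 'a = "real^'n"] d by auto
  obtain c0 where c0: "c0 > 0" "\<And>r. 0 < r \<Longrightarrow> r \<le> 1 \<Longrightarrow> emeasure ?\<mu> {..r} \<ge> ennreal (c0 * r ^ d)"
    using chord_measure_ge[where 'a = "real^'n"] d by auto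
  obtain C1 where C1: "C1 > 0"
    "\<And>h. h > 0 \<Longrightarrow> (\<integral>\<^sup>+r. ennreal (riesz_gap s h r) \<partial>?\<mu>) \<le> ennreal (C1 * h powr ((real d - s) / 2))"
    using nn_integral_riesz_gap_le[OF D _ s(1,2)] d s by auto
  define C2 where "C2 = C1 + W / 2"
  define \<delta> where "\<delta> = s/2 * (s/2 + 1) * 3 powr (-s/2 - 2)"
  have pos: "C2 > 0" "\<delta> > 0" using C1 W s by (auto simp: C2_def \<delta>_def)
  \<comment> \<open>Small enough that the loss over the union of the caps is at most half of what
    the bumps yield on them.\<close>
  define \<kappa> where "\<kappa> = min 1 (\<delta> * c0 / (2 * C2 * C0))"
  have kappa: "0 < \<kappa>" "\<kappa> \<le> 1" "C2 * (C0 * \<kappa>) \<le> \<delta> * c0 / 2"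
  proof -
    show "0 < \<kappa>" "\<kappa> \<le> 1" using pos C0 c0 by (auto simp: \<kappa>_def)
    have "\<kappa> \<le> \<delta> * c0 / (2 * C2 * C0)" by (simp add: \<kappa>_def)
    thus "C2 * (C0 * \<kappa>) \<le> \<delta> * c0 / 2" using pos C0 by (simp add: field_simps)
  qed
  show ?thesis
  proof (rule that[of "\<delta> * c0 / 2 * \<kappa> powr ((real d - s) / real d)"])
    show "0 < \<delta> * c0 / 2 * \<kappa> powr ((real d - s) / real d)" using pos c0 kappa by simp
    fix I and x :: "'i \<Rightarrow> real^'n" and u :: real
    assume I: "finite I" "I \<noteq> {}" "\<And>i. i \<in> I \<Longrightarrow> norm (x i) = 1" and u0: "u \<ge> 0"
      and u: "\<And>z. norm z = 1 \<Longrightarrow> z \<notin> x ` I \<Longrightarrow> u \<le> (\<Sum>i\<in>I. norm (x i - z) powr (-s))"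
    define N where "N = real (card I)"
    have N: "N \<ge> 1" using I by (simp add: N_def card_gt_0_iff Suc_leI)
    \<comment> \<open>The radius \<open>sqrt h\<close> then satisfies
      \<open>sqrt h ^ d = \<kappa> / N\<close>, so the \<open>N\<close> caps together cover a
      fraction of the sphere of order \<open>\<kappa>\<close>.\<close>
    define h where "h = (\<kappa> / N) powr (2 / real d)"
    have h: "h > 0" using kappa N by (simp add: h_def)
    have h1: "h \<le> 1" unfolding h_def using kappa N by (intro powr_le1) auto
    have hd: "sqrt h ^ d = \<kappa> / N"
    proof -
      have "sqrt h ^ d = (h powr (1/2)) powr real d" using h by (simp add: powr_half_sqrt powr_realpow)
      also have "\<dots> = \<kappa> / N" using kappa N d by (simp add: h_def powr_powr)
      finally show ?thesis .
    qed
    define c where "c = (\<integral>r. swept_gap s h r \<partial>?\<mu>)"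
    have ig: "integrable ?\<mu> (swept_gap s h)" by (intro integrable_swept_gap[OF D]) (use d s h in auto)
    have iK: "integrable ?\<mu> (\<lambda>r. r powr (-s))" using integrable_chord_powr[OF D, of s] d s by simp
    have irg: "integrable ?\<mu> (riesz_gap s h)"
    proof (rule Bochner_Integration.integrable_bound[OF iK])
      show "AE r in ?\<mu>. norm (riesz_gap s h r) \<le> norm (r powr (-s))"
        using AE_chord_measure_pos[OF D2]
      proof eventually_elim
        case (elim r)
        thus ?case using riesz_gap_bounds[OF s(1) h, of r] by auto
      qed
    qed simp
    have gap0: "AE r in ?\<mu>. 0 \<le> riesz_gap s h r \<and> 0 \<le> swept_gap s h r \<and> swept_gap s h r \<le> riesz_gap s h r + h / 2 * r powr (-s)"
      using AE_chord_measure_pos[OF D2]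
    proof eventually_elim
      case (elim r)
      thus ?case using riesz_gap_bounds[OF s(1) h, of r] swept_gap_bounds[OF s(1) h, of r] by auto
    qed
    have c_nn: "c \<ge> 0" unfolding c_def using gap0 by (intro integral_nonneg_AE) (auto simp del: AE_conj_iff elim!: eventually_mono)
    have "ennreal (\<integral>r. riesz_gap s h r \<partial>?\<mu>) = (\<integral>\<^sup>+r. ennreal (riesz_gap s h r) \<partial>?\<mu>)"
      using gap0 irg by (intro nn_integral_eq_integral[symmetric]) (auto simp del: AE_conj_iff elim!: eventually_mono)
    also have "\<dots> \<le> ennreal (C1 * h powr ((real d - s) / 2))" by (rule C1(2)[OF h])
    finally have rg: "(\<integral>r. riesz_gap s h r \<partial>?\<mu>) \<le> C1 * h powr ((real d - s) / 2)"
      using C1 by (simp add: ennreal_le_iff)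
    have "c \<le> (\<integral>r. riesz_gap s h r + h / 2 * r powr (-s) \<partial>?\<mu>)"
      unfolding c_def using ig irg iK gap0
      by (intro integral_mono_AE) (auto simp del: AE_conj_iff elim!: eventually_mono)
    also have "\<dots> = (\<integral>r. riesz_gap s h r \<partial>?\<mu>) + h / 2 * W"
      using irg iK by (simp add: W_def riesz_mean_def)
    also have "\<dots> \<le> C1 * h powr ((real d - s) / 2) + h powr ((real d - s) / 2) / 2 * W"
    proof -
      \<comment> \<open>Here \<open>d - s \<le> 2\<close> absorbs the correction from the weight
        into the main order.\<close>
      have "h powr 1 \<le> h powr ((real d - s) / 2)" using h h1 s by (intro powr_mono') auto
      thus ?thesis using rg W h by (intro add_mono mult_right_mono) auto
    qed
    also have "\<dots> = C2 * h powr ((real d - s) / 2)" by (simp add: C2_def algebra_simps)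
    finally have c_le: "c \<le> C2 * h powr ((real d - s) / 2)" .
    define U where "U y = (\<Sum>i\<in>I. norm (x i - y) powr (-s))" for y
    have iKx: "has_bochner_integral sphere_measure (\<lambda>y. norm (x i - y) powr (-s)) W" if "i \<in> I" for i
      using integral_chord[OF I(3)[OF that], of "\<lambda>r. r powr (-s)"] integrable_chord[OF I(3)[OF that], of "\<lambda>r. r powr (-s)"] iK
      by (simp add: has_bochner_integral_iff W_def riesz_mean_def)
    have "has_bochner_integral sphere_measure U (\<Sum>i\<in>I. W)"
      unfolding U_def by (intro has_bochner_integral_sum iKx)
    hence iU: "integrable sphere_measure U" "(\<integral>y. U y \<partial>sphere_measure) = N * W"
      by (simp_all add: has_bochner_integral_iff N_def)
    have pts: "AE y in sphere_measure. \<forall>i\<in>I. y \<noteq> x i"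
      using I by (intro AE_finite_allI AE_sphere_neq[OF D2]) auto
    have Uu: "AE y in sphere_measure. U y - u \<ge> 0"
      using pts AE_sphere_measure
    proof eventually_elim
      case (elim y)
      thus ?case using u[of y] by (auto simp: U_def)
    qed
    have iUu: "integrable sphere_measure (\<lambda>y. U y - u)" using iU by simp
    have int_Uu: "(\<integral>y. U y - u \<partial>sphere_measure) = N * W - u"
      using iU S.prob_space by simp
    have "(\<integral>y. U y - u \<partial>sphere_measure) \<ge> 0" using Uu by (rule integral_nonneg_AE)
    hence uW: "u \<le> N * W" using int_Uu by simp
    \<comment> \<open>The lower bound \<open>u\<close> is at most the mean \<open>N * W\<close> of
      the potential, so the loss in the averaged inequality is at most \<open>N * c\<close>.\<close>
    have ucW: "u * c / W \<le> N * c"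
      using uW W c_nn mult_right_mono[OF uW c_nn] by (simp add: pos_divide_le_eq mult_ac)
    have low: "AE y in sphere_measure. U y - u \<ge> (\<Sum>i\<in>I. swept_gap s h (norm (x i - y))) - real (card I) * c"
      using AE_sphere_measure
    proof (rule eventually_mono)
      fix y :: "real^'n" assume *: "y \<in> sphere 0 1"
      have "u - u * c / W + (\<Sum>i\<in>I. swept_gap s h (norm (x i - y))) \<le> U y"
        unfolding U_def W_def c_def using I u h * by (intro riesz_potential_ge) auto
      thus "U y - u \<ge> (\<Sum>i\<in>I. swept_gap s h (norm (x i - y))) - real (card I) * c"
        using ucW by (simp add: N_def)
    qed
    have main: "N * ((\<integral>r. swept_gap s h r * indicator {..sqrt h} r \<partial>?\<mu>) - c * (N * measure ?\<mu> {..sqrt h})) \<le> N * W - u"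
      using integral_ge_bumps[OF D2 I(1,3) iUu Uu low ig _ c_nn, of "sqrt h"] swept_gap_bounds(2)[OF s(1) h]
      by (simp add: int_Uu N_def less_imp_le)
    have m_le: "measure ?\<mu> {..sqrt h} \<le> C0 * (\<kappa> / N)"
      using C0(2)[of "sqrt h"] C0(1) h kappa N hd by (simp add: M.emeasure_eq_measure ennreal_le_iff)
    have m_ge: "measure ?\<mu> {..sqrt h} \<ge> c0 * (\<kappa> / N)"
      using c0(2)[of "sqrt h"] h h1 hd by (simp add: M.emeasure_eq_measure ennreal_le_iff)
    have "(\<integral>r. swept_gap s h r * indicator {..sqrt h} r \<partial>?\<mu>) \<ge> (\<integral>r. \<delta> * h powr (-s/2) * indicator {..sqrt h} r \<partial>?\<mu>)"
    proof (rule integral_mono_AE)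
      show "integrable ?\<mu> (\<lambda>r. swept_gap s h r * indicator {..sqrt h} r)"
        using ig by (rule integrable_real_mult_indicator[rotated]) simp
      show "integrable ?\<mu> (\<lambda>r. \<delta> * h powr (-s/2) * indicator {..sqrt h} r)"
        by (intro integrable_mult_right integrable_real_indicator) (auto simp: M.emeasure_eq_measure)
      show "AE r in ?\<mu>. \<delta> * h powr (-s/2) * indicator {..sqrt h} r \<le> swept_gap s h r * indicator {..sqrt h} r"
        using AE_chord_measure_pos[OF D2]
      proof eventually_elim
        case (elim r)
        show ?case
        proof (cases "r \<le> sqrt h")
          case True
          have "r\<^sup>2 \<le> h" using True elim h by (metis less_imp_le power2_eq_square power_mono real_sqrt_pow2)
          \<comment> \<open>On the cap \<open>r\<^sup>2 + 2 * h \<le> 3 * h\<close>; this is the 3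
            in \<open>\<delta>\<close>.\<close>
          hence "(3 * h) powr (-s/2 - 2) \<le> (r\<^sup>2 + 2 * h) powr (-s/2 - 2)"
            using h s by (intro powr_mono2') (auto intro: add_nonneg_pos)
          hence "s/2 * (s/2 + 1) * h\<^sup>2 * (3 * h) powr (-s/2 - 2) \<le> s/2 * (s/2 + 1) * h\<^sup>2 * (r\<^sup>2 + 2 * h) powr (-s/2 - 2)"
            using s by (intro mult_left_mono) auto
          also have "\<dots> \<le> swept_gap s h r"
            using riesz_gap_bounds(1)[OF s(1) h, of r] swept_gap_bounds(1)[OF s(1) h, of r] elim by linarith
          also have "s/2 * (s/2 + 1) * h\<^sup>2 * (3 * h) powr (-s/2 - 2) = \<delta> * h powr (-s/2)"
          proof -
            have "(3 * h) powr (-s/2 - 2) = 3 powr (-s/2 - 2) * h powr (-s/2 - 2)" using h by (simp add: powr_mult)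
            moreover have "h\<^sup>2 * h powr (-s/2 - 2) = h powr (-s/2)"
              using h by (simp add: powr_diff)
            ultimately show ?thesis by (simp add: \<delta>_def mult_ac)
          qed
          finally show ?thesis using True by simp
        qed simp
      qed
    qed
    also have "(\<integral>r. \<delta> * h powr (-s/2) * indicator {..sqrt h} r \<partial>?\<mu>) = \<delta> * h powr (-s/2) * measure ?\<mu> {..sqrt h}"
      by simp
    finally have G: "\<delta> * h powr (-s/2) * measure ?\<mu> {..sqrt h} \<le> (\<integral>r. swept_gap s h r * indicator {..sqrt h} r \<partial>?\<mu>)" .
    define P where "P = h powr ((real d - s) / 2)"
    have P: "h powr (-s/2) * (\<kappa> / N) = P"
    proof -
      have "\<kappa> / N = h powr (real d / 2)" using kappa N d by (simp add: h_def powr_powr)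
      thus ?thesis by (simp add: P_def diff_divide_distrib add.commute flip: powr_add)
    qed
    have "\<delta> * h powr (-s/2) * (c0 * (\<kappa> / N)) \<le> \<delta> * h powr (-s/2) * measure ?\<mu> {..sqrt h}"
      using m_ge pos by (intro mult_left_mono) auto
    moreover have "\<delta> * h powr (-s/2) * (c0 * (\<kappa> / N)) = \<delta> * c0 * P"
      unfolding P[symmetric] by (simp only: mult_ac)
    ultimately have 1: "\<delta> * c0 * P \<le> (\<integral>r. swept_gap s h r * indicator {..sqrt h} r \<partial>?\<mu>)"
      using G by linarith
    have "N * measure ?\<mu> {..sqrt h} \<le> C0 * \<kappa>" using m_le N by (simp add: field_simps)
    hence "c * (N * measure ?\<mu> {..sqrt h}) \<le> C2 * P * (C0 * \<kappa>)"
      using c_le pos N by (intro mult_mono[of c]) (auto simp: P_def)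
    also have "\<dots> = C2 * (C0 * \<kappa>) * P" by (simp only: mult_ac)
    also have "\<dots> \<le> \<delta> * c0 / 2 * P" using kappa(3) by (intro mult_right_mono) (auto simp: P_def)
    finally have "\<delta> * c0 / 2 * P \<le> (\<integral>r. swept_gap s h r * indicator {..sqrt h} r \<partial>?\<mu>) - c * (N * measure ?\<mu> {..sqrt h})"
      using 1 by (simp add: field_simps)
    hence "N * (\<delta> * c0 / 2 * P) \<le> N * ((\<integral>r. swept_gap s h r * indicator {..sqrt h} r \<partial>?\<mu>) - c * (N * measure ?\<mu> {..sqrt h}))"
      using N by (intro mult_left_mono) auto
    also note main
    finally have 2: "\<delta> * c0 / 2 * (N * P) \<le> N * W - u" by (simp only: mult_ac)
    have 3: "N * P = \<kappa> powr ((real d - s) / real d) * N powr (s / real d)"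
    proof -
      have "2 / real d * ((real d - s) / 2) = (real d - s) / real d"
        using d by (simp add: frac_eq_eq algebra_simps)
      hence "h powr ((real d - s) / 2) = (\<kappa> / N) powr ((real d - s) / real d)"
        by (simp only: h_def powr_powr)
      also have "\<dots> = \<kappa> powr ((real d - s) / real d) / N powr ((real d - s) / real d)"
        by (rule powr_divide)
      finally have "N * P = \<kappa> powr ((real d - s) / real d) * (N powr 1 / N powr ((real d - s) / real d))"
        using N unfolding P_def by simp
      also have "N powr 1 / N powr ((real d - s) / real d) = N powr (s / real d)"
      proof -
        have "1 - (real d - s) / real d = s / real d" using d by (simp add: diff_divide_distrib)
        thus ?thesis by (simp only: powr_diff[symmetric])
      qed
      finally show ?thesis .
    qed
    show "u \<le> real (card I) * riesz_mean TYPE(real^'n) s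
        - \<delta> * c0 / 2 * \<kappa> powr ((real d - s) / real d) * real (card I) powr (s / real d)"
      using 2 unfolding W_def[symmetric] N_def[symmetric] 3 by (simp add: mult_ac)
  qed
qed

end

section \<open>Greedy sequences for positive exponents\<close>

lemma real_of_riesz_kernel:
  "real_of_ereal (riesz_kernel s x y) = (if s = 0 then - ln (norm (x - y)) else 1 / s * norm (x - y) powr (-s))"
  by (simp add: riesz_kernel_def)

lemma sphere_energy_eq:
  "sphere_energy TYPE('a::euclidean_space) s
     = (\<integral>r. (if s = 0 then - ln r else 1 / s * r powr (-s)) \<partial>chord_measure TYPE('a))"
proof -
  interpret S: prob_space "sphere_measure :: 'a measure" by (rule prob_space_sphere_measure)
  let ?k = "\<lambda>r. if s = 0 then - ln r else 1 / s * r powr (-s)"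
  have [measurable]: "?k \<in> borel_measurable borel" by measurable
  have "sphere_energy TYPE('a) s = (\<integral>x. (\<integral>y. ?k (norm (x - y)) \<partial>sphere_measure) \<partial>(sphere_measure :: 'a measure))"
    unfolding sphere_energy_def real_of_riesz_kernel ..
  also have "\<dots> = (\<integral>x. (\<integral>r. ?k r \<partial>chord_measure TYPE('a)) \<partial>(sphere_measure :: 'a measure))"
  proof (rule integral_cong_AE)
    show "AE x in (sphere_measure :: 'a measure). (\<integral>y. ?k (norm (x - y)) \<partial>sphere_measure) = (\<integral>r. ?k r \<partial>chord_measure TYPE('a))"
      using AE_sphere_measure
    proof eventually_elim
      case (elim x)
      show ?case using integral_chord[of x ?k] elim by simp
    qed
    show "(\<lambda>x::'a. \<integral>y. ?k (norm (x - y)) \<partial>sphere_measure) \<in> borel_measurable sphere_measure"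
      by (rule S.borel_measurable_lebesgue_integral) measurable
  qed auto
  also have "\<dots> = (\<integral>r. ?k r \<partial>chord_measure TYPE('a))" using S.prob_space by simp
  finally show ?thesis .
qed

definition kernel_real :: "real \<Rightarrow> real \<Rightarrow> real" where
  "kernel_real s r = (if s = 0 then - ln r else 1 / s * r powr (-s))"

lemma riesz_kernel_neq: "x \<noteq> y \<Longrightarrow> riesz_kernel s x y = ereal (kernel_real s (norm (x - y)))"
  by (simp add: riesz_kernel_def kernel_real_def)

lemma riesz_kernel_diag: "s \<ge> 0 \<Longrightarrow> riesz_kernel s x x = \<infinity>"
  by (simp add: riesz_kernel_def)

text \<open>A finite sphere would be a null set for a probability measure carried by it.\<close>

lemma infinite_sphere:
  assumes "DIM('a::euclidean_space) \<ge> 2"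
  shows "infinite (sphere (0::'a) 1)"
proof
  assume f: "finite (sphere (0::'a) 1)"
  have "AE y in sphere_measure. \<forall>x\<in>sphere (0::'a) 1. y \<noteq> x"
    using f assms by (intro AE_finite_allI AE_sphere_neq) auto
  hence "AE y in (sphere_measure :: 'a measure). False"
    using AE_sphere_measure by eventually_elim auto
  thus False
    using prob_space.AE_False[OF prob_space_sphere_measure[where 'a = 'a]] by simp
qed

text \<open>At an earlier point the potential is infinite, while it is finite at every other unit
  vector, and such vectors exist because the sphere is infinite. So a minimiser never repeats a
  point, and all extended-real sums occurring later are real.\<close>

lemma greedy_sequenceD:
  fixes x :: "nat \<Rightarrow> 'a::euclidean_space"
  assumes g: "greedy_sequence s x" and s: "s \<ge> 0" and dim: "DIM('a) \<ge> 2"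
  shows "n \<ge> 1 \<Longrightarrow> norm (x n) = 1"
    and "n \<ge> 1 \<Longrightarrow> x (Suc n) \<notin> x ` {1..n}"
    and "inj_on x {1..}"
    and "n \<ge> 1 \<Longrightarrow> norm y = 1 \<Longrightarrow> y \<notin> x ` {1..n} \<Longrightarrow>
      (\<Sum>i\<in>{1..n}. kernel_real s (norm (x i - x (Suc n)))) \<le> (\<Sum>i\<in>{1..n}. kernel_real s (norm (x i - y)))"
proof -
  have min: "x (Suc n) \<in> sphere 0 1"
    "\<And>y. y \<in> sphere 0 1 \<Longrightarrow> (\<Sum>i\<in>{1..n}. riesz_kernel s (x (Suc n)) (x i)) \<le> (\<Sum>i\<in>{1..n}. riesz_kernel s y (x i))"
    if "n \<ge> 1" for n
    using g that unfolding greedy_sequence_def is_arg_min_linorder by auto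
  show unit: "norm (x n) = 1" if "n \<ge> 1" for n
  proof (cases "n = 1")
    case True
    thus ?thesis using g by (simp add: greedy_sequence_def)
  next
    case False
    thus ?thesis using min(1)[of "n - 1"] that by simp
  qed
  have sum_eq: "(\<Sum>i\<in>{1..n}. riesz_kernel s y (x i)) = ereal (\<Sum>i\<in>{1..n}. kernel_real s (norm (x i - y)))"
    if "y \<notin> x ` {1..n}" for y n
  proof -
    have "(\<Sum>i\<in>{1..n}. riesz_kernel s y (x i)) = (\<Sum>i\<in>{1..n}. ereal (kernel_real s (norm (x i - y))))"
      using that by (intro sum.cong refl) (subst riesz_kernel_neq, auto simp: norm_minus_commute)
    thus ?thesis by simp
  qed
  show notin: "x (Suc n) \<notin> x ` {1..n}" if n: "n \<ge> 1" for n
  proof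
    assume "x (Suc n) \<in> x ` {1..n}"
    then obtain i where i: "i \<in> {1..n}" "x (Suc n) = x i" by auto
    have "(\<Sum>i\<in>{1..n}. riesz_kernel s (x (Suc n)) (x i)) = \<infinity>"
      using i s riesz_kernel_diag[OF s, of "x i"] by (subst sum_Pinfty) (auto intro!: bexI[of _ i])
    moreover obtain y where y: "y \<in> sphere 0 1" "y \<notin> x ` {1..n}"
      using infinite_sphere[OF dim] by (meson finite_atLeastAtMost finite_imageI finite_subset subsetI)
    ultimately show False using min(2)[OF n y(1)] sum_eq[OF y(2)] by simp
  qed
  show "inj_on x {1..}"
  proof (rule linorder_inj_onI)
    fix i j :: nat assume "i < j" "i \<in> {1..}" "j \<in> {1..}"
    thus "x i \<noteq> x j" using notin[of "j - 1"] by (metis Suc_diff_1 Suc_leI atLeastAtMost_iff atLeast_iff gr_implies_not0 imageI less_Suc_eq_le not_gr_zero One_nat_def le_less_trans diff_Suc_1)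
  qed auto
  show "(\<Sum>i\<in>{1..n}. kernel_real s (norm (x i - x (Suc n)))) \<le> (\<Sum>i\<in>{1..n}. kernel_real s (norm (x i - y)))"
    if "n \<ge> 1" "norm y = 1" "y \<notin> x ` {1..n}" for n y
    using min(2)[OF that(1), of y] that sum_eq[OF notin[OF that(1)]] sum_eq[OF that(3)] by simp
qed

lemma riesz_energy_eq:
  assumes "inj_on x {1..}"
  shows "riesz_energy s x N = ereal (\<Sum>i\<in>{1..N}. \<Sum>j\<in>{1..N} - {i}. kernel_real s (norm (x i - x j)))"
proof -
  have "riesz_energy s x N = (\<Sum>i\<in>{1..N}. \<Sum>j\<in>{1..N} - {i}. ereal (kernel_real s (norm (x i - x j))))"
    unfolding riesz_energy_def using assms
    by (intro sum.cong refl riesz_kernel_neq) (auto simp: inj_on_def)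
  thus ?thesis by simp
qed

lemma offdiag_sum_Suc:
  fixes K :: "nat \<Rightarrow> nat \<Rightarrow> real"
  assumes "\<And>i j. K i j = K j i"
  shows "(\<Sum>i\<in>{1..Suc N}. \<Sum>j\<in>{1..Suc N} - {i}. K i j)
    = (\<Sum>i\<in>{1..N}. \<Sum>j\<in>{1..N} - {i}. K i j) + 2 * (\<Sum>i\<in>{1..N}. K i (Suc N))"
proof -
  have "(\<Sum>i\<in>{1..Suc N}. \<Sum>j\<in>{1..Suc N} - {i}. K i j)
      = (\<Sum>i\<in>{1..N}. \<Sum>j\<in>{1..Suc N} - {i}. K i j) + (\<Sum>j\<in>{1..Suc N} - {Suc N}. K (Suc N) j)"
    by simp
  also have "(\<Sum>j\<in>{1..Suc N} - {Suc N}. K (Suc N) j) = (\<Sum>i\<in>{1..N}. K i (Suc N))"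
    using assms by (intro sum.cong) auto
  also have "(\<Sum>i\<in>{1..N}. \<Sum>j\<in>{1..Suc N} - {i}. K i j) = (\<Sum>i\<in>{1..N}. (\<Sum>j\<in>{1..N} - {i}. K i j) + K i (Suc N))"
  proof (intro sum.cong refl)
    fix i assume i: "i \<in> {1..N}"
    hence "{1..Suc N} - {i} = insert (Suc N) ({1..N} - {i})" by auto
    thus "(\<Sum>j\<in>{1..Suc N} - {i}. K i j) = (\<Sum>j\<in>{1..N} - {i}. K i j) + K i (Suc N)" by simp
  qed
  finally show ?thesis by (simp add: sum.distrib)
qed

text \<open>Every pair is counted when its later member is added; the last point added is number
  \<open>N\<close>, so \<open>n\<close> stops at \<open>N - 1\<close>.\<close>

lemma offdiag_sum_eq:
  fixes K :: "nat \<Rightarrow> nat \<Rightarrow> real"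
  assumes "\<And>i j. K i j = K j i"
  shows "(\<Sum>i\<in>{1..N}. \<Sum>j\<in>{1..N} - {i}. K i j) = 2 * (\<Sum>n\<in>{1..<N}. \<Sum>i\<in>{1..n}. K i (Suc n))"
proof (induction N)
  case (Suc N)
  show ?case
  proof (cases "N = 0")
    case False
    hence "{1..<Suc N} = insert N {1..<N}" by auto
    thus ?thesis unfolding offdiag_sum_Suc[of K, OF assms] Suc.IH by simp
  qed simp
qed simp

lemma sum_real_upto: "(\<Sum>n\<in>{1..<N}. real n) = real N * (real N - 1) / 2"
  by (induction N) (auto simp: field_simps not_less_eq_eq atLeastLessThanSuc)

text \<open>As \<open>p \<le> 1\<close>, \<open>n powr p\<close> is at least the linear function
  \<open>N powr (p - 1) * n\<close>, whose sum is known. The factor 1/4 accounts for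
  \<open>N - 1 \<ge> N / 2\<close>.\<close>

lemma sum_powr_ge:
  fixes p :: real
  assumes "0 \<le> p" "p \<le> 1" "N \<ge> 2"
  shows "real N powr (1 + p) / 4 \<le> (\<Sum>n\<in>{1..<N}. real n powr p)"
proof -
  have "real N powr (p - 1) * real n \<le> real n powr p" if "n \<in> {1..<N}" for n
  proof -
    have "real N powr (p - 1) \<le> real n powr (p - 1)" using that assms by (intro powr_mono2') auto
    hence "real N powr (p - 1) * real n \<le> real n powr (p - 1) * real n" by (intro mult_right_mono) auto
    also have "\<dots> = real n powr p" using that by (simp add: powr_diff)
    finally show ?thesis .
  qed
  hence 1: "(\<Sum>n\<in>{1..<N}. real N powr (p - 1) * real n) \<le> (\<Sum>n\<in>{1..<N}. real n powr p)"
    by (rule sum_mono)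
  have "real N powr (1 + p) / 4 = real N powr (p - 1) * (real N * real N / 4)"
    using assms by (simp add: powr_diff powr_add)
  also have "\<dots> \<le> real N powr (p - 1) * (real N * (real N - 1) / 2)"
    using assms by (intro mult_left_mono) (auto simp: field_simps)
  also have "\<dots> = (\<Sum>n\<in>{1..<N}. real N powr (p - 1) * real n)"
    by (simp only: sum_distrib_left[symmetric] sum_real_upto)
  also note 1
  finally show ?thesis .
qed

lemma greedy_riesz_energy_bounds:
  fixes d :: nat and s :: real
  assumes d: "d \<ge> 2" "CARD('n::finite) = d + 1" and s: "0 < s" "s < real d" "real d - 2 \<le> s"
  shows "\<exists>c C :: real. c > 0 \<and> C > 0 \<and>
          (\<forall>x :: nat \<Rightarrow> real ^ 'n. greedy_sequence s x \<longrightarrow>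
            (\<forall>N\<ge>2.
              ereal (- c * real N powr (1 + s / real d))
                \<le> riesz_energy s x N - ereal (sphere_energy TYPE(real ^ 'n) s * (real N)\<^sup>2) \<and>
              riesz_energy s x N - ereal (sphere_energy TYPE(real ^ 'n) s * (real N)\<^sup>2)
                \<le> ereal (- C * real N powr (1 + s / real d))))"
proof -
  note D = DIM_eq[OF d s(1,2)]
  note D2 = DIM_ge_2[OF d s(1,2)]
  define W where "W = riesz_mean TYPE(real^'n) s"
  have W: "W > 0" unfolding W_def using riesz_mean_pos[OF D, of s] d s by simp
  have I: "sphere_energy TYPE(real^'n) s = W / s"
    using s by (simp add: sphere_energy_eq W_def riesz_mean_def)
  obtain c where c: "c > 0"
    "\<And>I (x :: nat \<Rightarrow> real^'n). finite I \<Longrightarrow> I \<noteq> {} \<Longrightarrow> (\<And>i. i \<in> I \<Longrightarrow> norm (x i) = 1) \<Longrightarrow> inj_on x I \<Longrightarrow>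
      (real (card I))\<^sup>2 * W - c * real (card I) powr (1 + s / real d)
        \<le> (\<Sum>i\<in>I. \<Sum>j\<in>I - {i}. norm (x i - x j) powr (-s))"
    unfolding W_def riesz_mean_def
    by (rule riesz_energy_ge[OF D, of s]) (use d s in auto)
  obtain C where C: "C > 0"
    "\<And>I (x :: nat \<Rightarrow> real^'n) u. finite I \<Longrightarrow> I \<noteq> {} \<Longrightarrow> (\<And>i. i \<in> I \<Longrightarrow> norm (x i) = 1) \<Longrightarrow> u \<ge> 0 \<Longrightarrow>
      (\<And>z. norm z = 1 \<Longrightarrow> z \<notin> x ` I \<Longrightarrow> u \<le> (\<Sum>i\<in>I. norm (x i - z) powr (-s))) \<Longrightarrow>
      u \<le> real (card I) * W - C * real (card I) powr (s / real d)"
    unfolding W_def by (rule riesz_polarization[OF d s]) auto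
  have "ereal (- (c / s) * real N powr (1 + s / real d)) \<le> riesz_energy s x N - ereal (sphere_energy TYPE(real ^ 'n) s * (real N)\<^sup>2) \<and>
        riesz_energy s x N - ereal (sphere_energy TYPE(real ^ 'n) s * (real N)\<^sup>2) \<le> ereal (- (C / (2 * s)) * real N powr (1 + s / real d))"
    if g: "greedy_sequence s x" and N: "N \<ge> 2" for x :: "nat \<Rightarrow> real^'n" and N
  proof -
    note G = greedy_sequenceD[OF g _ D2]
    have s0: "0 \<le> s" using s by simp
    have inj: "inj_on x {1..}" by (rule G(3)[OF s0])
    define E where "E = (\<Sum>i\<in>{1..N}. \<Sum>j\<in>{1..N} - {i}. norm (x i - x j) powr (-s))"
    have en: "riesz_energy s x N = ereal (E / s)"
      unfolding riesz_energy_eq[OF inj] E_def kernel_real_def using s by (simp add: sum_divide_distrib)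
    have "(real (card {1..N}))\<^sup>2 * W - c * real (card {1..N}) powr (1 + s / real d) \<le> E"
      unfolding E_def using N by (intro c(2) inj_on_subset[OF inj] G(1)[OF s0]) auto
    hence low: "(real N)\<^sup>2 * W - c * real N powr (1 + s / real d) \<le> E" by simp
    define u where "u n = (\<Sum>i\<in>{1..n}. norm (x i - x (Suc n)) powr (-s))" for n
    have Eu: "E = 2 * (\<Sum>n\<in>{1..<N}. u n)"
      unfolding E_def u_def by (rule offdiag_sum_eq) (simp add: norm_minus_commute)
    have un: "u n \<le> real n * W - C * real n powr (s / real d)" if n: "n \<in> {1..<N}" for n
    proof -
      have "u n \<le> real (card {1..n}) * W - C * real (card {1..n}) powr (s / real d)"
      proof (rule C(2))
        show "u n \<le> (\<Sum>i\<in>{1..n}. norm (x i - z) powr (-s))" if "norm z = 1" "z \<notin> x ` {1..n}" for z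
        proof -
          have "(\<Sum>i\<in>{1..n}. kernel_real s (norm (x i - x (Suc n)))) \<le> (\<Sum>i\<in>{1..n}. kernel_real s (norm (x i - z)))"
            using n that by (intro G(4)[OF s0]) auto
          hence "u n / s \<le> (\<Sum>i\<in>{1..n}. norm (x i - z) powr (-s)) / s"
            using s by (simp add: kernel_real_def u_def sum_divide_distrib)
          thus ?thesis using s by (simp add: divide_le_cancel)
        qed
        show "u n \<ge> 0" unfolding u_def by (intro sum_nonneg) simp
      qed (use n G(1)[OF s0] in auto)
      thus ?thesis by simp
    qed
    have "(\<Sum>n\<in>{1..<N}. u n) \<le> (\<Sum>n\<in>{1..<N}. real n * W - C * real n powr (s / real d))"
      by (rule sum_mono) (rule un)
    also have "\<dots> = (\<Sum>n\<in>{1..<N}. real n) * W - C * (\<Sum>n\<in>{1..<N}. real n powr (s / real d))"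
      by (simp add: sum_subtractf sum_distrib_left sum_distrib_right)
    also note sum_real_upto
    also have "real N * (real N - 1) / 2 * W \<le> (real N)\<^sup>2 / 2 * W"
      using W by (intro mult_right_mono) (auto simp: power2_eq_square algebra_simps)
    finally have "(\<Sum>n\<in>{1..<N}. u n) \<le> (real N)\<^sup>2 / 2 * W - C * (\<Sum>n\<in>{1..<N}. real n powr (s / real d))" by simp
    moreover have "C * (real N powr (1 + s / real d) / 4) \<le> C * (\<Sum>n\<in>{1..<N}. real n powr (s / real d))"
      using C N s by (intro mult_left_mono sum_powr_ge) auto
    ultimately have up: "E \<le> (real N)\<^sup>2 * W - C / 2 * real N powr (1 + s / real d)"
      unfolding Eu by (simp add: field_simps)
    show ?thesis
      unfolding en I using divide_right_mono[OF low, of s] divide_right_mono[OF up, of s] s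
      by (simp add: diff_divide_distrib mult_ac)
  qed
  thus ?thesis using c(1) C(1) s by (intro exI[of _ "c / s"] exI[of _ "C / (2 * s)"]) auto
qed

section \<open>Lower bound for the logarithmic energy\<close>

text \<open>The analogue of \<open>riesz_gap\<close>: the second difference with step
  \<open>h\<close> of \<open>- ln v / 2\<close> at \<open>v = r\<^sup>2\<close>.\<close>

definition log_gap :: "real \<Rightarrow> real \<Rightarrow> real" where
  "log_gap h r = - ln r + ln (r\<^sup>2 + h) - ln (r\<^sup>2 + 2 * h) / 2"

lemma log_gap_measurable [measurable]: "log_gap h \<in> borel_measurable borel"
  unfolding log_gap_def by measurable

text \<open>The gap is \<open>ln (1 + x) / 2\<close> with
  \<open>x = h\<^sup>2 / (r\<^sup>2 * (r\<^sup>2 + 2 * h))\<close>. From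
  \<open>ln (1 + x) \<le> x\<close> comes the decay at large \<open>r\<close>. Near 0 the estimate
  \<open>ln (1 + x) \<le> 2 * sqrt x\<close> replaces the logarithmic singularity by a power, to
  which the dyadic estimates apply.\<close>

lemma log_gap_bounds:
  assumes h: "h > 0" and r: "r > 0"
  shows "0 \<le> log_gap h r" "log_gap h r \<le> sqrt h * r powr (-1)" "log_gap h r \<le> h\<^sup>2 / 2 * r powr (-4)"
proof -
  define x where "x = h\<^sup>2 / (r\<^sup>2 * (r\<^sup>2 + 2 * h))"
  have p: "r\<^sup>2 > 0" "r\<^sup>2 + h > 0" "r\<^sup>2 + 2 * h > 0" using h r by (auto intro: add_pos_pos)
  have x0: "x \<ge> 0" using p h by (simp add: x_def)
  have "1 + x = (r\<^sup>2 + h)\<^sup>2 / (r\<^sup>2 * (r\<^sup>2 + 2 * h))"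
  proof -
    have "(r\<^sup>2 + h)\<^sup>2 = r\<^sup>2 * (r\<^sup>2 + 2 * h) + h\<^sup>2" by (simp add: power2_eq_square algebra_simps)
    thus ?thesis using p by (simp add: x_def add_divide_distrib)
  qed
  hence "ln (1 + x) = 2 * ln (r\<^sup>2 + h) - (2 * ln r + ln (r\<^sup>2 + 2 * h))"
    using p r by (simp add: ln_div ln_mult ln_realpow)
  hence eq: "log_gap h r = ln (1 + x) / 2" by (simp add: log_gap_def)
  show "0 \<le> log_gap h r" unfolding eq using x0 by simp
  have "ln (1 + x) \<le> x" by (rule ln_add_one_self_le_self[OF x0])
  also have "x \<le> h\<^sup>2 / (r\<^sup>2 * r\<^sup>2)"
    unfolding x_def using p h by (intro divide_left_mono mult_left_mono mult_pos_pos) auto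
  also have "\<dots> = h\<^sup>2 * r powr (-4)"
    using r by (simp add: powr_minus divide_inverse flip: power_add)
  finally show "log_gap h r \<le> h\<^sup>2 / 2 * r powr (-4)" unfolding eq by simp
  have "1 + x \<le> (1 + sqrt x)\<^sup>2" using x0 by (simp add: power2_sum)
  hence "ln (1 + x) \<le> ln ((1 + sqrt x)\<^sup>2)" using x0 by (intro ln_mono) auto
  also have "\<dots> = 2 * ln (1 + sqrt x)" using x0 by (simp add: ln_realpow add_pos_nonneg)
  also have "\<dots> \<le> 2 * sqrt x" using x0 by (simp add: ln_add_one_self_le_self)
  finally have "log_gap h r \<le> sqrt x" unfolding eq by simp
  also have "x \<le> h\<^sup>2 / (r\<^sup>2 * h)"
    unfolding x_def using p h by (intro divide_left_mono mult_left_mono mult_pos_pos) auto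
  hence "sqrt x \<le> sqrt (h / r\<^sup>2)" using h by (simp add: power2_eq_square)
  also have "\<dots> = sqrt h * r powr (-1)" using r by (simp add: real_sqrt_divide powr_minus_divide)
  finally show "log_gap h r \<le> sqrt h * r powr (-1)" .
qed

lemma nn_integral_log_gap_le:
  assumes dim: "DIM('a::euclidean_space) = 3"
  obtains C where "C > 0"
    "\<And>h. h > 0 \<Longrightarrow> (\<integral>\<^sup>+r. ennreal (log_gap h r) \<partial>chord_measure TYPE('a)) \<le> ennreal (C * h)"
proof -
  obtain C where C: "C > 0" "\<And>r. r \<ge> 0 \<Longrightarrow> emeasure (chord_measure TYPE('a)) {..r} \<le> ennreal (C * r ^ 2)"
    using chord_measure_le[where 'a = 'a] dim by auto
  hence C': "emeasure (chord_measure TYPE('a)) {..r} \<le> ennreal (C * r powr 2)" if "r \<ge> 0" for r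
    using that by simp
  define A where "A = C * 2 powr 1 / (1 - 2 powr (1 - 2))"
  define B where "B = C * 2 powr 2 / (1 - 2 powr (2 - 4))"
  have "2 powr (1 - 2) < 2 powr (0::real)" "2 powr (2 - 4) < 2 powr (0::real)"
    by (intro powr_less_mono; simp)+
  hence pos: "A > 0" "B > 0" using C by (auto simp: A_def B_def intro!: divide_pos_pos mult_pos_pos)
  show ?thesis
  proof (rule that[of "A + B / 2"])
    fix h :: real assume h: "h > 0"
    let ?x = "sqrt h"
    have x: "?x > 0" using h by simp
    have "(\<integral>\<^sup>+r. ennreal (log_gap h r) \<partial>chord_measure TYPE('a))
        \<le> (\<integral>\<^sup>+r. ennreal (sqrt h) * ennreal (r powr (-1)) * indicator {0<..?x} r \<partial>chord_measure TYPE('a))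
          + (\<integral>\<^sup>+r. ennreal (h\<^sup>2 / 2) * ennreal (r powr (-4)) * indicator {?x<..} r \<partial>chord_measure TYPE('a))"
    proof (rule nn_integral_near_far)
      show "AE r in chord_measure TYPE('a). 0 < r"
        using AE_chord_measure_pos[where 'a = 'a] dim by (auto simp del: AE_conj_iff elim!: eventually_mono)
      show "ennreal (log_gap h r) \<le> ennreal (h\<^sup>2 / 2) * ennreal (r powr (-4))" if "r > ?x" for r
      proof -
        have "r > 0" using that x by linarith
        thus ?thesis using log_gap_bounds(3)[OF h, of r] by (simp add: ennreal_leI flip: ennreal_mult)
      qed
      show "ennreal (log_gap h r) \<le> ennreal (sqrt h) * ennreal (r powr (-1))" if "0 < r" "r \<le> ?x" for r
        using log_gap_bounds(2)[OF h that(1)] h by (simp add: ennreal_leI flip: ennreal_mult)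
    qed (use x in auto)
    also have "(\<integral>\<^sup>+r. ennreal (h\<^sup>2 / 2) * ennreal (r powr (-4)) * indicator {?x<..} r \<partial>chord_measure TYPE('a))
        = ennreal (h\<^sup>2 / 2) * (\<integral>\<^sup>+r. ennreal (r powr (-4)) * indicator {?x<..} r \<partial>chord_measure TYPE('a))"
      unfolding mult.assoc by (intro nn_integral_cmult) auto
    also have "\<dots> \<le> ennreal (h\<^sup>2 / 2) * ennreal (B * ?x powr (2 - 4))"
      unfolding B_def using C C' x by (intro mult_left_mono nn_integral_powr_far) auto
    also have "\<dots> = ennreal (h\<^sup>2 / 2 * (B * ?x powr (2 - 4)))"
      using pos by (intro ennreal_mult[symmetric]) auto
    also have "h\<^sup>2 / 2 * (B * ?x powr (2 - 4)) = B / 2 * h"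
    proof -
      have "?x powr (2 - 4) = inverse (?x ^ 2)" using x by (simp add: powr_minus)
      thus ?thesis using h by (simp add: power2_eq_square)
    qed
    also have "(\<integral>\<^sup>+r. ennreal (sqrt h) * ennreal (r powr (-1)) * indicator {0<..?x} r \<partial>chord_measure TYPE('a))
        = ennreal (sqrt h) * (\<integral>\<^sup>+r. ennreal (r powr (-1)) * indicator {0<..?x} r \<partial>chord_measure TYPE('a))"
      unfolding mult.assoc by (intro nn_integral_cmult) auto
    also have "\<dots> \<le> ennreal (sqrt h) * ennreal (A * ?x powr (2 - 1))"
      unfolding A_def using C C' x by (intro mult_left_mono nn_integral_powr_near) auto
    also have "\<dots> = ennreal (sqrt h * (A * ?x powr (2 - 1)))"
      using pos h by (intro ennreal_mult[symmetric]) auto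
    also have "sqrt h * (A * ?x powr (2 - 1)) = A * h" using h by simp
    finally show "(\<integral>\<^sup>+r. ennreal (log_gap h r) \<partial>chord_measure TYPE('a)) \<le> ennreal ((A + B / 2) * h)"
      using pos h by (simp add: distrib_right add_increasing flip: ennreal_plus)
  qed (use pos in auto)
qed

lemma integrable_chord_ln:
  assumes dim: "DIM('a::euclidean_space) = 3"
  shows "integrable (chord_measure TYPE('a)) ln"
proof -
  interpret M: prob_space "chord_measure TYPE('a)" by (rule prob_space_chord_measure)
  have D: "DIM('a) = 2 + 1" and dim2: "DIM('a) \<ge> 2" using dim by simp_all
  have i1: "integrable (chord_measure TYPE('a)) (\<lambda>r. r powr (-1))"
    using integrable_chord_powr[OF D, of 1] by simp
  hence i: "integrable (chord_measure TYPE('a)) (\<lambda>r. r powr (-1) + 1)" by simp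
  show ?thesis
  proof (rule Bochner_Integration.integrable_bound[OF i])
    show "AE r in chord_measure TYPE('a). norm (ln r) \<le> norm (r powr (-1) + 1)"
      using AE_chord_measure_pos[OF dim2]
    proof eventually_elim
      case r: (elim r)
      have "ln r \<le> r - 1" using r by (intro ln_le_minus_one) auto
      moreover have "ln (1 / r) \<le> 1 / r - 1" using r by (intro ln_le_minus_one) auto
      moreover have "r powr (-1) = 1 / r" using r by (simp add: powr_minus divide_inverse)
      moreover have "1 / r > 0" using r by simp
      ultimately show ?case using r by (simp add: ln_div abs_le_iff)
    qed
  qed simp
qed

lemma ln_kernel_sums:
  fixes h r :: real
  assumes h: "h > 0" and r: "0 \<le> r" "r \<le> 2"
  shows "(\<lambda>k. (if k = 0 then ln (2 + h) else - ((2 / (2 + h)) ^ k / real k)) * (1 - r\<^sup>2 / 2) ^ k) sums ln (r\<^sup>2 + h)"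
proof -
  define t where "t = 1 - r\<^sup>2 / 2"
  define q where "q = 2 / (2 + h)"
  have q: "0 < q" "q < 1" using h by (simp_all add: q_def)
  have "r\<^sup>2 \<le> 2\<^sup>2" using r by (intro power_mono) auto
  hence t: "\<bar>t\<bar> \<le> 1" by (auto simp: t_def abs_le_iff)
  have qt: "\<bar>- (q * t)\<bar> < 1"
  proof -
    have "\<bar>- (q * t)\<bar> = q * \<bar>t\<bar>" using q by (simp add: abs_mult)
    also have "\<dots> \<le> q * 1" using q t by (intro mult_left_mono) auto
    finally show ?thesis using q by linarith
  qed
  have "(\<lambda>k. - ((- (- (q * t))) ^ k) / of_nat k) sums ln (1 + - (q * t))"
    by (rule ln_series'[OF qt])
  hence s: "(\<lambda>k. - (q ^ k / real k) * t ^ k) sums ln (1 - q * t)"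
    by (simp add: power_mult_distrib)
  \<comment> \<open>The term of index 0 of the logarithmic series is \<open>1 / 0 = 0\<close> up to
    sign, which leaves that place free for the constant.\<close>
  have "(\<lambda>k. (if k = 0 then ln (2 + h) else 0) + - (q ^ k / real k) * t ^ k) sums (ln (2 + h) + ln (1 - q * t))"
    by (intro sums_add s sums_single[of 0 "\<lambda>_. ln (2 + h)"])
  also have "(\<lambda>k. (if k = 0 then ln (2 + h) else 0) + - (q ^ k / real k) * t ^ k)
      = (\<lambda>k. (if k = 0 then ln (2 + h) else - (q ^ k / real k)) * t ^ k)"
    by (auto simp: fun_eq_iff)
  also have "ln (2 + h) + ln (1 - q * t) = ln ((2 + h) * (1 - q * t))"
    using h qt by (subst ln_mult) (auto simp: abs_less_iff)
  also have "(2 + h) * (1 - q * t) = r\<^sup>2 + h" using h by (simp add: q_def t_def field_simps)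
  finally show ?thesis unfolding t_def q_def .
qed

lemma log_energy_ge:
  assumes dim: "DIM('a::euclidean_space) = 3"
  obtains c where "c > 0"
    "\<And>I (x :: 'i \<Rightarrow> 'a). finite I \<Longrightarrow> I \<noteq> {} \<Longrightarrow> (\<And>i. i \<in> I \<Longrightarrow> norm (x i) = 1) \<Longrightarrow> inj_on x I \<Longrightarrow>
      (real (card I))\<^sup>2 * (\<integral>r. - ln r \<partial>chord_measure TYPE('a))
          - real (card I) * ln (real (card I)) / 2 - c * real (card I)
        \<le> (\<Sum>i\<in>I. \<Sum>j\<in>I - {i}. - ln (norm (x i - x j)))"
proof -
  interpret prob_space "chord_measure TYPE('a)" by (rule prob_space_chord_measure)
  have dim2: "DIM('a) \<ge> 2" using dim by simp
  obtain C where C: "C > 0"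
    "\<And>h. h > 0 \<Longrightarrow> (\<integral>\<^sup>+r. ennreal (log_gap h r) \<partial>chord_measure TYPE('a)) \<le> ennreal (C * h)"
    using nn_integral_log_gap_le[OF dim] by metis
  show ?thesis
  proof (rule that[of "C + ln 2 / 2"])
    fix I and x :: "'i \<Rightarrow> 'a"
    assume I: "finite I" "I \<noteq> {}" "\<And>i. i \<in> I \<Longrightarrow> norm (x i) = 1" "inj_on x I"
    define N where "N = real (card I)"
    have N: "N \<ge> 1" using I by (simp add: N_def card_gt_0_iff Suc_leI)
    define h where "h = 1 / N"
    have h: "h > 0" using N by (simp add: h_def)
    define u where "u r = - ln (r\<^sup>2 + h) + ln (r\<^sup>2 + 2 * h) / 2" for r
    have [measurable]: "u \<in> borel_measurable borel" unfolding u_def by measurable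
    define b where "b k h = (if k = 0 then ln (2 + h) else - ((2 / (2 + h)) ^ k / real k))" for k :: nat and h :: real
    define a where "a k = - b k h + b k (2 * h) / 2" for k
    have a: "a k \<ge> 0" if "k > 0" for k
    proof -
      have "(2 / (2 + 2 * h)) ^ k \<le> (2 / (2 + h)) ^ k"
        using h by (intro power_mono divide_left_mono) auto
      moreover have "0 \<le> (2 / (2 + h)) ^ k" using h by simp
      ultimately have "(2 / (2 + 2 * h)) ^ k / 2 \<le> (2 / (2 + h)) ^ k" by linarith
      hence "(2 / (2 + 2 * h)) ^ k / 2 / real k \<le> (2 / (2 + h)) ^ k / real k" by (rule divide_right_mono) simp
      thus ?thesis using that by (simp add: a_def b_def)
    qed
    have sums: "(\<lambda>k. a k * (1 - r\<^sup>2 / 2) ^ k) sums u r" if "0 \<le> r" "r \<le> 2" for r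
    proof -
      have "(\<lambda>k. - (b k h * (1 - r\<^sup>2 / 2) ^ k) + (b k (2 * h) * (1 - r\<^sup>2 / 2) ^ k) / 2) sums u r"
        unfolding u_def b_def using h that by (intro sums_add sums_minus sums_divide ln_kernel_sums) auto
      thus ?thesis by (simp add: a_def algebra_simps)
    qed
    have gap: "u r = - ln r - log_gap h r" for r by (simp add: u_def log_gap_def)
    have ge: "N\<^sup>2 * (\<integral>r. u r \<partial>chord_measure TYPE('a)) - N * u 0 \<le> (\<Sum>i\<in>I. \<Sum>j\<in>I - {i}. - ln (norm (x i - x j)))"
      unfolding N_def
    proof (rule sum_offdiag_ge[where a = a])
      show "u r \<le> - ln r" if "0 < r" "r \<le> 2" for r
        using log_gap_bounds(1)[OF h that(1)] by (simp add: gap)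
    qed (use I a sums in auto)
    have gap0: "AE r in chord_measure TYPE('a). 0 \<le> log_gap h r"
      using AE_chord_measure_pos[OF dim2] log_gap_bounds[OF h]
      by (auto simp del: AE_conj_iff elim!: eventually_mono)
    have ig: "integrable (chord_measure TYPE('a)) (log_gap h)"
    proof (rule integrableI_bounded)
      have "(\<integral>\<^sup>+r. ennreal (norm (log_gap h r)) \<partial>chord_measure TYPE('a)) = (\<integral>\<^sup>+r. ennreal (log_gap h r) \<partial>chord_measure TYPE('a))"
        using gap0 by (intro nn_integral_cong_AE) (auto elim!: eventually_mono)
      also have "\<dots> \<le> ennreal (C * h)" by (rule C(2)[OF h])
      also have "\<dots> < \<infinity>" by simp
      finally show "(\<integral>\<^sup>+r. ennreal (norm (log_gap h r)) \<partial>chord_measure TYPE('a)) < \<infinity>" .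
    qed simp
    have "ennreal (\<integral>r. log_gap h r \<partial>chord_measure TYPE('a)) = (\<integral>\<^sup>+r. ennreal (log_gap h r) \<partial>chord_measure TYPE('a))"
      using gap0 ig by (intro nn_integral_eq_integral[symmetric]) auto
    also have "\<dots> \<le> ennreal (C * h)" by (rule C(2)[OF h])
    finally have "(\<integral>r. log_gap h r \<partial>chord_measure TYPE('a)) \<le> C * h" using C h by (simp add: ennreal_le_iff)
    hence "N\<^sup>2 * (\<integral>r. log_gap h r \<partial>chord_measure TYPE('a)) \<le> N\<^sup>2 * (C * h)" by (intro mult_left_mono) auto
    also have "\<dots> = C * N" using N by (simp add: h_def power2_eq_square)
    finally have 1: "N\<^sup>2 * (\<integral>r. log_gap h r \<partial>chord_measure TYPE('a)) \<le> C * N" .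
    \<comment> \<open>The diagonal term is where the coefficient 1/2 of \<open>N * ln N\<close>
      originates; the choice \<open>h = 1 / N\<close> makes everything else of order
      \<open>N\<close>.\<close>
    have 2: "u 0 = ln N / 2 + ln 2 / 2"
      using N by (simp add: u_def h_def ln_div diff_divide_distrib)
    have "(\<integral>r. u r \<partial>chord_measure TYPE('a))
        = (\<integral>r. - ln r \<partial>chord_measure TYPE('a)) - (\<integral>r. log_gap h r \<partial>chord_measure TYPE('a))"
      unfolding gap using ig integrable_chord_ln[OF dim] by (intro Bochner_Integration.integral_diff) auto
    hence "N\<^sup>2 * (\<integral>r. - ln r \<partial>chord_measure TYPE('a)) - N\<^sup>2 * (\<integral>r. log_gap h r \<partial>chord_measure TYPE('a)) - N * (ln N / 2 + ln 2 / 2)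
       \<le> (\<Sum>i\<in>I. \<Sum>j\<in>I - {i}. - ln (norm (x i - x j)))"
      using ge unfolding 2 by (simp add: right_diff_distrib)
    with 1 show "(real (card I))\<^sup>2 * (\<integral>r. - ln r \<partial>chord_measure TYPE('a))
          - real (card I) * ln (real (card I)) / 2 - (C + ln 2 / 2) * real (card I)
        \<le> (\<Sum>i\<in>I. \<Sum>j\<in>I - {i}. - ln (norm (x i - x j)))"
      unfolding N_def[symmetric] by (simp add: algebra_simps)
  qed (use C in \<open>auto intro: add_pos_pos\<close>)
qed

section \<open>Circle means of the logarithmic potential\<close>

text \<open>The mean value property of a harmonic function. After scaling by \<open>p\<close> it is
  the real part of Cauchy's formula for \<open>Ln (1 - q * w)\<close> at the centre, where the value
  is 0; \<open>cmod q < 1\<close> keeps \<open>1 - q * w\<close> in the right half plane, away from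
  the branch cut.\<close>

lemma has_integral_ln_norm_circle:
  fixes B :: complex and p :: real
  assumes p: "cmod B < p"
  shows "((\<lambda>t. ln (cmod (of_real p - B * exp (2 * of_real pi * \<i> * of_real t)))) has_integral ln p) {0..1}"
proof -
  define q where "q = B / of_real p"
  have p0: "p > 0" using p norm_ge_zero[of B] by linarith
  have q: "cmod q < 1" using p p0 by (simp add: q_def norm_divide)
  define e where "e t = exp (2 * of_real pi * \<i> * of_real t)" for t :: real
  have ne: "cmod (e t) = 1" for t by (simp add: e_def)
  have re: "1 - q * w \<notin> \<real>\<^sub>\<le>\<^sub>0" if "cmod w \<le> 1" for w
  proof -
    have "cmod (q * w) \<le> cmod q * 1" unfolding norm_mult using that by (intro mult_left_mono) auto
    hence "cmod (q * w) < 1" using q by linarith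
    hence "Re (q * w) < 1" using complex_Re_le_cmod[of "q * w"] by linarith
    thus ?thesis by (auto simp: complex_nonpos_Reals_iff)
  qed
  have hol: "(\<lambda>w. Ln (1 - q * w)) holomorphic_on ball 0 1"
    by (intro holomorphic_intros) (use re in auto)
  have cont: "continuous_on (cball 0 1) (\<lambda>w. Ln (1 - q * w))"
    by (intro continuous_intros) (use re in auto)
  have "((\<lambda>u. Ln (1 - q * u) / (u - 0)) has_contour_integral (2 * of_real pi * \<i> * Ln (1 - q * 0))) (circlepath 0 1)"
    by (rule Cauchy_integral_circlepath[OF cont hol]) simp
  hence "((\<lambda>t. Ln (1 - q * circlepath 0 1 t) / (circlepath 0 1 t - 0) * vector_derivative (circlepath 0 1) (at t within {0..1}))
      has_integral 0) {0..1}"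
    by (simp add: has_contour_integral_def)
  hence "((\<lambda>t. 2 * of_real pi * \<i> * Ln (1 - q * e t)) has_integral 0) {0..1}"
  proof (rule has_integral_eq[rotated])
    fix t :: real assume "t \<in> {0..1}"
    hence "vector_derivative (circlepath 0 1) (at t within {0..1}) = 2 * of_real pi * \<i> * e t"
      by (simp add: vector_derivative_circlepath01 e_def)
    moreover have "circlepath 0 1 t = e t" by (simp add: circlepath e_def)
    moreover have "e t \<noteq> 0" by (simp add: e_def)
    ultimately show "Ln (1 - q * circlepath 0 1 t) / (circlepath 0 1 t - 0) * vector_derivative (circlepath 0 1) (at t within {0..1})
        = 2 * of_real pi * \<i> * Ln (1 - q * e t)" by simp
  qed
  hence "((\<lambda>t. 1 / (2 * of_real pi * \<i>) * (2 * of_real pi * \<i> * Ln (1 - q * e t))) has_integral 1 / (2 * of_real pi * \<i>) * 0) {0..1}"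
    by (rule has_integral_mult_right)
  hence "((\<lambda>t. Ln (1 - q * e t)) has_integral 0) {0..1}" by simp
  hence "((\<lambda>t. Re (Ln (1 - q * e t))) has_integral Re 0) {0..1}"
    by (rule has_integral_Re)
  moreover have "Re (Ln (1 - q * e t)) = ln (cmod (1 - q * e t))" for t
    using re[of "e t"] ne[of t] by (intro Re_Ln) auto
  ultimately have i0: "((\<lambda>t. ln (cmod (1 - q * e t))) has_integral 0) {0..1}" by simp
  have "((\<lambda>t. ln p + ln (cmod (1 - q * e t))) has_integral ln p + 0) {0..1}"
    by (intro has_integral_add i0) (use has_integral_const_real[of "ln p" 0 1] in simp)
  moreover have "ln p + ln (cmod (1 - q * e t)) = ln (cmod (of_real p - B * e t))" for t
  proof -
    have "1 - q * e t \<noteq> 0" using re[of "e t"] ne[of t] by auto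
    moreover have "of_real p - B * e t = of_real p * (1 - q * e t)" using p0 by (simp add: q_def algebra_simps)
    ultimately show ?thesis using p0 by (simp add: norm_mult ln_mult)
  qed
  ultimately show ?thesis by (simp add: e_def)
qed

lemma has_integral_ln_trig:
  fixes p b1 b2 :: real
  assumes p: "p > 0" "b1\<^sup>2 + b2\<^sup>2 < p\<^sup>2"
  shows "((\<lambda>t. ln (p\<^sup>2 + (b1\<^sup>2 + b2\<^sup>2) - 2 * p * (b1 * cos (2 * pi * t) + b2 * sin (2 * pi * t)))) has_integral 2 * ln p) {0..1}"
proof -
  \<comment> \<open>The argument of the logarithm is the squared modulus of
    \<open>p - B * exp (2 * pi * \<i> * t)\<close> for this \<open>B\<close>.\<close>
  define B where "B = Complex b1 (- b2)"
  have "cmod B = sqrt (b1\<^sup>2 + b2\<^sup>2)" by (simp add: B_def cmod_def)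
  also have "\<dots> < sqrt (p\<^sup>2)" using p by (intro real_sqrt_less_mono)
  finally have B: "cmod B < p" using p by simp
  have eq: "2 * ln (cmod (of_real p - B * exp (2 * of_real pi * \<i> * of_real t)))
      = ln (p\<^sup>2 + (b1\<^sup>2 + b2\<^sup>2) - 2 * p * (b1 * cos (2 * pi * t) + b2 * sin (2 * pi * t)))" for t
  proof -
    define c s where "c = cos (2 * pi * t)" and "s = sin (2 * pi * t)"
    have cs: "c\<^sup>2 + s\<^sup>2 = 1" by (simp add: c_def s_def)
    have e: "exp (2 * of_real pi * \<i> * of_real t) = Complex c s"
      by (simp add: c_def s_def complex_eq_iff exp_eq_polar cis.ctr Re_exp Im_exp)
    have B1: "of_real p - B * Complex c s = Complex (p - (b1 * c + b2 * s)) (- (b1 * s - b2 * c))"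
      by (simp add: B_def complex_eq_iff)
    have "cmod (B * exp (2 * of_real pi * \<i> * of_real t)) < p"
      using B by (simp add: norm_mult)
    hence nz: "cmod (of_real p - B * exp (2 * of_real pi * \<i> * of_real t)) > 0"
      using p by (metis abs_of_pos less_irrefl norm_of_real right_minus_eq zero_less_norm_iff)
    have "(cmod (of_real p - B * exp (2 * of_real pi * \<i> * of_real t)))\<^sup>2
        = (p - (b1 * c + b2 * s))\<^sup>2 + (b1 * s - b2 * c)\<^sup>2"
      unfolding e B1 by (simp add: cmod_power2 power2_commute)
    also have "\<dots> = p\<^sup>2 + (b1\<^sup>2 + b2\<^sup>2) * (c\<^sup>2 + s\<^sup>2) - 2 * p * (b1 * c + b2 * s)"
      by (simp add: power2_eq_square algebra_simps)
    finally have "(cmod (of_real p - B * exp (2 * of_real pi * \<i> * of_real t)))\<^sup>2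
        = p\<^sup>2 + (b1\<^sup>2 + b2\<^sup>2) - 2 * p * (b1 * c + b2 * s)" unfolding cs by simp
    hence "ln ((cmod (of_real p - B * exp (2 * of_real pi * \<i> * of_real t)))\<^sup>2)
        = ln (p\<^sup>2 + (b1\<^sup>2 + b2\<^sup>2) - 2 * p * (b1 * c + b2 * s))" by simp
    thus ?thesis using nz by (simp add: ln_realpow c_def s_def)
  qed
  have "((\<lambda>t. 2 * ln (cmod (of_real p - B * exp (2 * of_real pi * \<i> * of_real t)))) has_integral 2 * ln p) {0..1}"
    by (intro has_integral_mult_right has_integral_ln_norm_circle B)
  thus ?thesis unfolding eq .
qed

text \<open>The excess of the kernel at \<open>y\<close> over its mean on the circle of points at
  distance \<open>2 * sqrt b\<close> from \<open>y\<close>, seen from a point at distance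
  \<open>r\<close> from \<open>y\<close>. With \<open>\<beta> = r\<^sup>2 / 4\<close> the mean of
  the logarithm of the squared distance is the logarithm of the larger of
  \<open>4 * \<beta> * (1 - b)\<close> and \<open>4 * b * (1 - \<beta>)\<close>; dividing by
  \<open>r\<^sup>2 = 4 * \<beta>\<close> gives the maximum in the formula.\<close>

definition circle_gap :: "real \<Rightarrow> real \<Rightarrow> real" where
  "circle_gap b r = ln (max (1 - b) (b * (1 - r\<^sup>2 / 4) / (r\<^sup>2 / 4))) / 2"

text \<open>The squared distance along the circle has mean \<open>P + Q\<close> and an oscillating
  part of amplitude \<open>2 * sqrt (P * Q)\<close>, so it is the squared modulus treated by
  \<open>has_integral_ln_trig\<close> with \<open>p = sqrt P\<close>. The condition
  \<open>neq\<close> means \<open>P \<noteq> Q\<close>, that is, \<open>x\<close> is not at the same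
  distance from \<open>y\<close> as the circle. The vectors \<open>v\<close>, \<open>v'\<close> are
  left general so that the statement also covers the orbit of a point under rotation about
  \<open>y\<close>.\<close>

lemma has_integral_ln_circle:
  fixes x y v v' :: "'a::euclidean_space" and b :: real
  assumes x: "norm x = 1" and y: "norm y = 1" and xy: "x \<noteq> y" and b: "0 < b" "b < 1"
    and vv: "(x \<bullet> v)\<^sup>2 + (x \<bullet> v')\<^sup>2 = (1 - (1 - 2 * b)\<^sup>2) * (1 - (x \<bullet> y)\<^sup>2)"
    and nz: "\<And>t. norm ((1 - 2 * b) *\<^sub>R y + cos (2 * pi * t) *\<^sub>R v + sin (2 * pi * t) *\<^sub>R v') = 1"
    and neq: "(norm (x - y))\<^sup>2 / 4 \<noteq> b"
  shows "((\<lambda>t. - ln (norm (x - ((1 - 2 * b) *\<^sub>R y + cos (2 * pi * t) *\<^sub>R v + sin (2 * pi * t) *\<^sub>R v'))))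
           has_integral (- ln (norm (x - y)) - circle_gap b (norm (x - y)))) {0..1}"
proof -
  define \<beta> where "\<beta> = (norm (x - y))\<^sup>2 / 4"
  define z where "z t = (1 - 2 * b) *\<^sub>R y + cos (2 * pi * t) *\<^sub>R v + sin (2 * pi * t) *\<^sub>R v'" for t
  have t: "x \<bullet> y = 1 - 2 * \<beta>" using inner_eq_chord[OF x y] by (simp add: \<beta>_def)
  have b0: "\<beta> > 0" using xy by (simp add: \<beta>_def)
  have "\<bar>x \<bullet> y\<bar> \<le> 1" using Cauchy_Schwarz_ineq2[of x y] x y by simp
  hence b1: "\<beta> \<le> 1" using t by (simp add: abs_le_iff)
  have vv': "(x \<bullet> v)\<^sup>2 + (x \<bullet> v')\<^sup>2 = (4 * \<beta> * (1 - b)) * (4 * b * (1 - \<beta>))"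
    unfolding vv t by (simp add: power2_eq_square algebra_simps)
  have dist: "(norm (x - z t))\<^sup>2 = 4 * \<beta> * (1 - b) + 4 * b * (1 - \<beta>) - 2 * ((x \<bullet> v) * cos (2 * pi * t) + (x \<bullet> v') * sin (2 * pi * t))" for t
  proof -
    have "z t \<bullet> z t = 1" "x \<bullet> x = 1" using nz[of t] x by (simp_all add: z_def dot_square_norm)
    hence "(norm (x - z t))\<^sup>2 = 2 - 2 * (x \<bullet> z t)"
      by (simp add: power2_norm_eq_inner inner_diff_left inner_diff_right inner_commute)
    also have "x \<bullet> z t = (1 - 2 * b) * (1 - 2 * \<beta>) + cos (2 * pi * t) * (x \<bullet> v) + sin (2 * pi * t) * (x \<bullet> v')"
      by (simp add: z_def inner_add_right t)
    finally show ?thesis by (simp add: algebra_simps)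
  qed
  define P Q where "P = max (4 * \<beta> * (1 - b)) (4 * b * (1 - \<beta>))" and "Q = min (4 * \<beta> * (1 - b)) (4 * b * (1 - \<beta>))"
  have ab: "4 * \<beta> * (1 - b) > 0" "4 * b * (1 - \<beta>) \<ge> 0" using b b0 b1 by auto
  have ne: "4 * \<beta> * (1 - b) \<noteq> 4 * b * (1 - \<beta>)" using neq by (simp add: \<beta>_def algebra_simps)
  have PQ: "P > 0" "Q \<ge> 0" "Q < P" "P + Q = 4 * \<beta> * (1 - b) + 4 * b * (1 - \<beta>)"
    "P * Q = (4 * \<beta> * (1 - b)) * (4 * b * (1 - \<beta>))"
    using ab ne by (auto simp: P_def Q_def max_def min_def)
  define p where "p = sqrt P"
  have p: "p > 0" "p\<^sup>2 = P" using PQ by (simp_all add: p_def)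
  define b1' b2' where "b1' = (x \<bullet> v) / p" and "b2' = (x \<bullet> v') / p"
  have "b1'\<^sup>2 + b2'\<^sup>2 = ((x \<bullet> v)\<^sup>2 + (x \<bullet> v')\<^sup>2) / P"
    using p by (simp add: b1'_def b2'_def power_divide add_divide_distrib)
  also have "\<dots> = Q" unfolding vv' PQ(5)[symmetric] using PQ(1) by simp
  finally have Q: "b1'\<^sup>2 + b2'\<^sup>2 = Q" .
  have "((\<lambda>t. ln (p\<^sup>2 + (b1'\<^sup>2 + b2'\<^sup>2) - 2 * p * (b1' * cos (2 * pi * t) + b2' * sin (2 * pi * t)))) has_integral 2 * ln p) {0..1}"
    by (rule has_integral_ln_trig) (use p Q PQ in simp_all)
  also have "(\<lambda>t. ln (p\<^sup>2 + (b1'\<^sup>2 + b2'\<^sup>2) - 2 * p * (b1' * cos (2 * pi * t) + b2' * sin (2 * pi * t))))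
      = (\<lambda>t. 2 * ln (norm (x - z t)))"
  proof
    fix t
    have "p * b1' = x \<bullet> v" "p * b2' = x \<bullet> v'" using p by (simp_all add: b1'_def b2'_def)
    hence "2 * p * (b1' * cos (2 * pi * t) + b2' * sin (2 * pi * t)) = 2 * ((x \<bullet> v) * cos (2 * pi * t) + (x \<bullet> v') * sin (2 * pi * t))"
      by (simp add: distrib_left flip: mult.assoc) (simp add: mult.assoc)
    hence e: "p\<^sup>2 + (b1'\<^sup>2 + b2'\<^sup>2) - 2 * p * (b1' * cos (2 * pi * t) + b2' * sin (2 * pi * t)) = (norm (x - z t))\<^sup>2"
      unfolding dist p Q using PQ(4) by simp
    show "ln (p\<^sup>2 + (b1'\<^sup>2 + b2'\<^sup>2) - 2 * p * (b1' * cos (2 * pi * t) + b2' * sin (2 * pi * t))) = 2 * ln (norm (x - z t))"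
      unfolding e by (cases "x = z t") (simp_all add: ln_realpow)
  qed
  finally have "((\<lambda>t. - (1 / 2) * (2 * ln (norm (x - z t)))) has_integral - (1 / 2) * (2 * ln p)) {0..1}"
    by (rule has_integral_mult_right)
  moreover have "- (1 / 2) * (2 * ln p) = - ln (norm (x - y)) - circle_gap b (norm (x - y))"
  proof -
    have m: "P = 4 * \<beta> * max (1 - b) (b * (1 - \<beta>) / \<beta>)"
    proof -
      have "0 \<le> 4 * \<beta>" using b0 by simp
      hence "4 * \<beta> * max (1 - b) (b * (1 - \<beta>) / \<beta>) = max (4 * \<beta> * (1 - b)) (4 * \<beta> * (b * (1 - \<beta>) / \<beta>))"
        by (simp only: max_mult_distrib_left if_True)
      moreover have "4 * \<beta> * (b * (1 - \<beta>) / \<beta>) = 4 * b * (1 - \<beta>)" using b0 by simp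
      ultimately show ?thesis by (simp only: P_def)
    qed
    have mp: "max (1 - b) (b * (1 - \<beta>) / \<beta>) > 0" using b by simp
    have "2 * ln p = ln P" using p by (simp add: ln_realpow flip: p(2))
    also have "\<dots> = ln (4 * \<beta>) + ln (max (1 - b) (b * (1 - \<beta>) / \<beta>))"
      unfolding m using b0 mp by (subst ln_mult) auto
    also have "ln (4 * \<beta>) = 2 * ln (norm (x - y))" using xy by (simp add: \<beta>_def ln_realpow)
    finally show ?thesis by (simp add: circle_gap_def \<beta>_def add_divide_distrib)
  qed
  ultimately show ?thesis by (simp add: z_def)
qed

text \<open>The image of the standard basis under an orthogonal map that sends one basis vector to
  \<open>y\<close>.\<close>

lemma orthonormal_frame:
  fixes y :: "'a::euclidean_space"
  assumes dim: "DIM('a) = 3" and y: "norm y = 1"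
  obtains e f where "\<And>z w. z \<bullet> w = (z \<bullet> y) * (w \<bullet> y) + (z \<bullet> e) * (w \<bullet> e) + (z \<bullet> f) * (w \<bullet> f)"
    "y \<bullet> e = 0" "y \<bullet> f = 0" "e \<bullet> f = 0" "e \<bullet> e = 1" "f \<bullet> f = 1"
proof -
  obtain a b c :: 'a where B: "Basis = {a, b, c}" "a \<noteq> b" "a \<noteq> c" "b \<noteq> c"
    using dim card_3_iff[of "Basis :: 'a set"] by auto
  have "a \<in> Basis" unfolding B(1) by simp
  hence "norm a = norm y" using y by simp
  then obtain T where T: "orthogonal_transformation T" "T a = y"
    by (rule orthogonal_transformation_exists_unit)
  have inn: "T u \<bullet> T w = u \<bullet> w" for u w using T by (simp add: orthogonal_transformation_def)
  have bas: "a \<in> Basis" "b \<in> Basis" "c \<in> Basis" unfolding B(1) by auto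
  show ?thesis
  proof (rule that[of "T b" "T c"])
    fix z w
    obtain u u' where u: "z = T u" "w = T u'" using orthogonal_transformation_surj[OF T(1)] by (metis surjD)
    have "u \<bullet> u' = (u \<bullet> a) * (u' \<bullet> a) + (u \<bullet> b) * (u' \<bullet> b) + (u \<bullet> c) * (u' \<bullet> c)"
      by (subst euclidean_inner, subst B(1)) (use B(2-4) in simp)
    thus "z \<bullet> w = (z \<bullet> y) * (w \<bullet> y) + (z \<bullet> T b) * (w \<bullet> T b) + (z \<bullet> T c) * (w \<bullet> T c)"
      unfolding u T(2)[symmetric] inn .
  qed (use B(2-4) bas in \<open>auto simp: inn inner_Basis simp flip: T(2)\<close>)
qed

lemma circle_frame:
  fixes y e f :: "'a::euclidean_space"
  assumes ex: "\<And>z w. z \<bullet> w = (z \<bullet> y) * (w \<bullet> y) + (z \<bullet> e) * (w \<bullet> e) + (z \<bullet> f) * (w \<bullet> f)"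
    and on: "y \<bullet> e = 0" "y \<bullet> f = 0" "e \<bullet> f = 0" "e \<bullet> e = 1" "f \<bullet> f = 1" "norm y = 1"
    and b: "0 < b" "b < (1::real)"
  defines "\<rho> \<equiv> sqrt (1 - (1 - 2 * b)\<^sup>2)"
  shows "norm x = 1 \<Longrightarrow> (x \<bullet> (\<rho> *\<^sub>R e))\<^sup>2 + (x \<bullet> (\<rho> *\<^sub>R f))\<^sup>2 = (1 - (1 - 2 * b)\<^sup>2) * (1 - (x \<bullet> y)\<^sup>2)"
    and "norm ((1 - 2 * b) *\<^sub>R y + cos t *\<^sub>R \<rho> *\<^sub>R e + sin t *\<^sub>R \<rho> *\<^sub>R f) = 1"
    and "((1 - 2 * b) *\<^sub>R y + cos t *\<^sub>R \<rho> *\<^sub>R e + sin t *\<^sub>R \<rho> *\<^sub>R f) \<bullet> y = 1 - 2 * b"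
proof -
  have "0 \<le> 4 * b * (1 - b)" using b by simp
  hence r2: "\<rho>\<^sup>2 = 1 - (1 - 2 * b)\<^sup>2" by (simp add: \<rho>_def power2_eq_square algebra_simps)
  have yy: "y \<bullet> y = 1" using on by (simp add: dot_square_norm)
  show "(x \<bullet> (\<rho> *\<^sub>R e))\<^sup>2 + (x \<bullet> (\<rho> *\<^sub>R f))\<^sup>2 = (1 - (1 - 2 * b)\<^sup>2) * (1 - (x \<bullet> y)\<^sup>2)" if "norm x = 1"
  proof -
    have "x \<bullet> x = 1" using that by (simp add: dot_square_norm)
    hence "(x \<bullet> e)\<^sup>2 + (x \<bullet> f)\<^sup>2 = 1 - (x \<bullet> y)\<^sup>2" using ex[of x x] by (simp add: power2_eq_square)
    thus ?thesis unfolding r2[symmetric] by (simp add: power_mult_distrib flip: distrib_left)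
  qed
  let ?z = "(1 - 2 * b) *\<^sub>R y + cos t *\<^sub>R \<rho> *\<^sub>R e + sin t *\<^sub>R \<rho> *\<^sub>R f"
  have zy: "?z \<bullet> y = 1 - 2 * b" "?z \<bullet> e = \<rho> * cos t" "?z \<bullet> f = \<rho> * sin t"
    using on yy by (simp_all add: inner_add_left inner_commute[of e y] inner_commute[of f y] inner_commute[of f e])
  show "?z \<bullet> y = 1 - 2 * b" by (rule zy)
  have "?z \<bullet> ?z = (1 - 2 * b)\<^sup>2 + \<rho>\<^sup>2 * ((cos t)\<^sup>2 + (sin t)\<^sup>2)"
    unfolding ex[of ?z ?z] zy by (simp only: power2_eq_square distrib_left mult_ac add.assoc)
  hence "?z \<bullet> ?z = 1" by (simp add: r2)
  thus "norm ?z = 1" by (simp add: norm_eq_1)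
qed

text \<open>Average the lower bound \<open>u\<close> over the circle of level \<open>b\<close> about
  \<open>y\<close>, on which the mean of each kernel is known. Levels at which a point
  \<open>x i\<close> has the same distance from \<open>y\<close> as the circle are excluded at
  first; there are finitely many, and both sides are continuous in \<open>b\<close>.\<close>

lemma log_potential_ge:
  fixes x :: "'i \<Rightarrow> 'a::euclidean_space" and y :: 'a
  assumes dim: "DIM('a) = 3" and I: "finite I" "\<And>i. i \<in> I \<Longrightarrow> norm (x i) = 1"
    and y: "norm y = 1" "y \<notin> x ` I" and b: "0 < b" "b < 1"
    and u: "\<And>z. norm z = 1 \<Longrightarrow> z \<notin> x ` I \<Longrightarrow> u \<le> (\<Sum>i\<in>I. - ln (norm (x i - z)))"
  shows "u + (\<Sum>i\<in>I. circle_gap b (norm (x i - y))) \<le> (\<Sum>i\<in>I. - ln (norm (x i - y)))"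
proof -
  obtain e f where fr: "\<And>z w. z \<bullet> w = (z \<bullet> y) * (w \<bullet> y) + (z \<bullet> e) * (w \<bullet> e) + (z \<bullet> f) * (w \<bullet> f)"
    "y \<bullet> e = 0" "y \<bullet> f = 0" "e \<bullet> f = 0" "e \<bullet> e = 1" "f \<bullet> f = 1"
    using orthonormal_frame[OF dim y(1)] by metis
  have good: "u + (\<Sum>i\<in>I. circle_gap b (norm (x i - y))) \<le> (\<Sum>i\<in>I. - ln (norm (x i - y)))"
    if b: "0 < b" "b < 1" and ne: "\<And>i. i \<in> I \<Longrightarrow> (norm (x i - y))\<^sup>2 / 4 \<noteq> b" for b :: real
  proof -
    note cf = circle_frame[OF fr y(1) b]
    define z where "z t = (1 - 2 * b) *\<^sub>R y + cos (2 * pi * t) *\<^sub>R sqrt (1 - (1 - 2 * b)\<^sup>2) *\<^sub>R e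
        + sin (2 * pi * t) *\<^sub>R sqrt (1 - (1 - 2 * b)\<^sup>2) *\<^sub>R f" for t :: real
    have "((\<lambda>t. \<Sum>i\<in>I. - ln (norm (x i - z t))) has_integral
        (\<Sum>i\<in>I. - ln (norm (x i - y)) - circle_gap b (norm (x i - y)))) {0..1}"
    proof (intro has_integral_sum I(1))
      fix i assume i: "i \<in> I"
      have "x i \<noteq> y" using i y(2) by blast
      thus "((\<lambda>t. - ln (norm (x i - z t))) has_integral - ln (norm (x i - y)) - circle_gap b (norm (x i - y))) {0..1}"
        unfolding z_def using i I y(1) b ne by (intro has_integral_ln_circle cf) auto
    qed
    moreover have "((\<lambda>t. u) has_integral u) {0..1::real}"
      using has_integral_const_real[of u 0 1] by simp
    moreover have "u \<le> (\<Sum>i\<in>I. - ln (norm (x i - z t)))" for t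
    proof (rule u)
      show nz: "norm (z t) = 1" unfolding z_def by (rule cf)
      have "z t \<bullet> y = 1 - 2 * b" unfolding z_def by (rule cf)
      hence "(norm (z t - y))\<^sup>2 / 4 = b" using inner_eq_chord[OF nz y(1)] by simp
      thus "z t \<notin> x ` I" using ne by auto
    qed
    ultimately have "u \<le> (\<Sum>i\<in>I. - ln (norm (x i - y)) - circle_gap b (norm (x i - y)))"
      by (meson has_integral_le)
    thus ?thesis by (simp add: sum_subtractf)
  qed
  have lim: "((\<lambda>b. u + (\<Sum>i\<in>I. circle_gap b (norm (x i - y)))) \<longlongrightarrow> u + (\<Sum>i\<in>I. circle_gap b (norm (x i - y)))) (at b)"
  proof -
    have "x i \<noteq> y" if "i \<in> I" for i using y(2) that by blast
    thus ?thesis unfolding circle_gap_def using b by (intro tendsto_intros tendsto_max) (auto simp: max_def)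
  qed
  have "\<forall>\<^sub>F c in at b. c \<notin> (\<lambda>i. (norm (x i - y))\<^sup>2 / 4) ` I - {b}"
  proof -
    let ?S = "(\<lambda>i. (norm (x i - y))\<^sup>2 / 4) ` I - {b}"
    have "closed ?S" using I(1) by (intro finite_imp_closed) auto
    hence "open (- ?S)" by (rule open_Compl)
    hence "\<forall>\<^sub>F c in at b. c \<in> - ?S" by (rule eventually_at_in_open') simp
    thus ?thesis by (rule eventually_mono) blast
  qed
  moreover have "\<forall>\<^sub>F c in at b. c \<in> {0<..<1}"
    using b by (intro eventually_at_in_open') auto
  moreover have "\<forall>\<^sub>F c in at b. c \<noteq> b" by (simp add: eventually_neq_at_within)
  ultimately have "\<forall>\<^sub>F c in at b. u + (\<Sum>i\<in>I. circle_gap c (norm (x i - y))) \<le> (\<Sum>i\<in>I. - ln (norm (x i - y)))"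
  proof eventually_elim
    case (elim c)
    show ?case
    proof (rule good)
      show "(norm (x i - y))\<^sup>2 / 4 \<noteq> c" if "i \<in> I" for i using elim(1,3) that by blast
    qed (use elim in auto)
  qed
  thus ?thesis using tendsto_upperbound[OF lim] by simp
qed

section \<open>Compactly supported bumps\<close>

lemma circle_gap_measurable [measurable]: "circle_gap b \<in> borel_measurable borel"
  unfolding circle_gap_def by measurable

text \<open>Outside the cap of radius \<open>2 * sqrt b\<close> the circle gap is the negative
  constant \<open>ln (1 - b) / 2\<close>. Subtracting it gives a nonnegative function supported in
  the cap.\<close>

definition log_bump :: "real \<Rightarrow> real \<Rightarrow> real" where
  "log_bump b r = circle_gap b r - ln (1 - b) / 2"

lemma log_bump_measurable [measurable]: "log_bump b \<in> borel_measurable borel"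
  unfolding log_bump_def by measurable

lemma log_bump_nonneg: "0 < b \<Longrightarrow> b < 1 \<Longrightarrow> 0 \<le> log_bump b r"
  by (simp add: log_bump_def circle_gap_def ln_mono)

lemma log_bump_outside:
  assumes "0 < b" "b < 1" "b \<le> r\<^sup>2 / 4"
  shows "log_bump b r = 0"
proof -
  have "b * (1 - r\<^sup>2 / 4) \<le> (1 - b) * (r\<^sup>2 / 4)" using assms by (simp add: algebra_simps)
  moreover have "r\<^sup>2 / 4 > 0" using assms by linarith
  ultimately have "b * (1 - r\<^sup>2 / 4) / (r\<^sup>2 / 4) \<le> 1 - b" by (simp only: pos_divide_le_eq)
  thus ?thesis by (simp add: log_bump_def circle_gap_def max_def)
qed

text \<open>In this form \<open>b\<close> enters only through an additive constant. Hence the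
  difference of two bumps is constant on the smaller cap, which is what the determination of the cap
  measures rests on.\<close>

lemma log_bump_inside:
  assumes "0 < b" "b < 1" "0 < r" "r\<^sup>2 / 4 \<le> b"
  shows "log_bump b r = ln (b / (1 - b)) / 2 - ln ((r\<^sup>2 / 4) / (1 - r\<^sup>2 / 4)) / 2"
proof -
  define \<beta> where "\<beta> = r\<^sup>2 / 4"
  have p: "0 < \<beta>" "\<beta> \<le> b" "0 < 1 - \<beta>" using assms by (auto simp: \<beta>_def)
  have "(1 - b) * \<beta> \<le> b * (1 - \<beta>)" using assms p by (simp add: algebra_simps)
  hence "1 - b \<le> b * (1 - \<beta>) / \<beta>" using p by (simp only: pos_le_divide_eq)
  hence "log_bump b r = ln (b * (1 - \<beta>) / \<beta>) / 2 - ln (1 - b) / 2"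
    by (simp add: log_bump_def circle_gap_def max_def flip: \<beta>_def)
  also have "\<dots> = ln (b / (1 - b)) / 2 - ln (\<beta> / (1 - \<beta>)) / 2"
  proof -
    have "ln (b * (1 - \<beta>) / \<beta>) = ln b + ln (1 - \<beta>) - ln \<beta>" using assms p by (simp add: ln_div ln_mult)
    moreover have "ln (b / (1 - b)) = ln b - ln (1 - b)" using assms by (simp add: ln_div)
    moreover have "ln (\<beta> / (1 - \<beta>)) = ln \<beta> - ln (1 - \<beta>)" using p by (simp add: ln_div)
    ultimately show ?thesis by (simp add: diff_divide_distrib add_divide_distrib)
  qed
  finally show ?thesis by (simp add: \<beta>_def)
qed

text \<open>Averaging the circle means over \<open>x\<close> gives, by Tonelli, the average over the
  circle of the means of the kernel, which are all the same; so the gap has mean 0. The hypothesis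
  \<open>atom\<close> ensures that almost no \<open>x\<close> lies at the distance of the
  circle.\<close>

lemma integral_circle_gap:
  assumes dim: "DIM('a::euclidean_space) = 3" and b: "0 < b" "b < 1"
    and atom: "measure (chord_measure TYPE('a)) {2 * sqrt b} = 0"
  shows "has_bochner_integral (chord_measure TYPE('a)) (circle_gap b) 0"
proof -
  interpret M: prob_space "chord_measure TYPE('a)" by (rule prob_space_chord_measure)
  interpret S: prob_space "sphere_measure :: 'a measure" by (rule prob_space_sphere_measure)
  interpret SL: pair_sigma_finite "sphere_measure :: 'a measure" "lborel :: real measure" ..
  have dim2: "DIM('a) \<ge> 2" using dim by simp
  let ?\<mu> = "chord_measure TYPE('a)"
  define A where "A = (\<integral>r. ln 2 - ln r \<partial>?\<mu>)"
  have iA: "integrable ?\<mu> (\<lambda>r. ln 2 - ln r)" using integrable_chord_ln[OF dim] by simp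
  have posA: "AE r in ?\<mu>. 0 \<le> ln 2 - ln r"
    using AE_chord_measure_pos[OF dim2] by eventually_elim (simp add: ln_mono)
  obtain y :: 'a where y: "norm y = 1" using ex_unit_vector by blast
  obtain e f where fr: "\<And>z w. z \<bullet> w = (z \<bullet> y) * (w \<bullet> y) + (z \<bullet> e) * (w \<bullet> e) + (z \<bullet> f) * (w \<bullet> f)"
    "y \<bullet> e = 0" "y \<bullet> f = 0" "e \<bullet> f = 0" "e \<bullet> e = 1" "f \<bullet> f = 1"
    using orthonormal_frame[OF dim y] by metis
  note cf = circle_frame[OF fr y b]
  define z where "z t = (1 - 2 * b) *\<^sub>R y + cos (2 * pi * t) *\<^sub>R sqrt (1 - (1 - 2 * b)\<^sup>2) *\<^sub>R e
      + sin (2 * pi * t) *\<^sub>R sqrt (1 - (1 - 2 * b)\<^sup>2) *\<^sub>R f" for t :: real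
  have nz: "norm (z t) = 1" for t unfolding z_def by (rule cf)
  have zm [measurable]: "z \<in> borel_measurable borel"
    unfolding z_def by (intro borel_measurable_continuous_onI continuous_intros)
  \<comment> \<open>Chords have length at most 2, so adding \<open>ln 2\<close> makes the kernel
    nonnegative.\<close>
  let ?F = "\<lambda>x t. ennreal (ln 2 - ln (norm (x - z t))) * indicator {0..1} t"
  define G where "G r = ln 2 - ln r - circle_gap b r" for r
  have [measurable]: "G \<in> borel_measurable borel" unfolding G_def by measurable
  have "AE r in ?\<mu>. r \<notin> {2 * sqrt b}"
    using atom by (intro AE_not_in) (auto simp: null_sets_def M.emeasure_eq_measure)
  hence "AE r in ?\<mu>. r \<noteq> 2 * sqrt b" by simp
  hence "AE r in ?\<mu>. r > 0 \<and> r\<^sup>2 / 4 \<noteq> b" using AE_chord_measure_pos[OF dim2]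
  proof eventually_elim
    case (elim r)
    have "r = 2 * sqrt (r\<^sup>2 / 4)" using elim by (simp add: real_sqrt_divide)
    thus ?case using elim by metis
  qed
  hence "AE x in sphere_measure. norm (y - x) > 0 \<and> (norm (y - x))\<^sup>2 / 4 \<noteq> b"
    unfolding distr_chord[OF y, symmetric] by (subst (asm) AE_distr_iff) auto
  hence inner: "AE x in sphere_measure. (\<integral>\<^sup>+t. ?F x t \<partial>lborel) = ennreal (G (norm (y - x))) \<and> 0 \<le> G (norm (y - x))"
    using AE_sphere_measure
  proof eventually_elim
    case (elim x)
    hence x: "norm x = 1" "x \<noteq> y" "(norm (x - y))\<^sup>2 / 4 \<noteq> b" by (auto simp: norm_minus_commute)
    have "((\<lambda>t. ln 2 + - ln (norm (x - z t))) has_integral (ln 2 + (- ln (norm (x - y)) - circle_gap b (norm (x - y))))) {0..1}"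
      unfolding z_def using has_integral_const_real[of "ln 2" 0 1] x y b
      by (intro has_integral_add has_integral_ln_circle cf) auto
    hence hi: "((\<lambda>t. ln 2 - ln (norm (x - z t))) has_integral G (norm (y - x))) {0..1}"
      by (simp add: G_def norm_minus_commute algebra_simps)
    have nn: "0 \<le> ln 2 - ln (norm (x - z t))" for t
    proof (cases "x = z t")
      case False
      have "norm (x - z t) \<le> 2" using norm_triangle_ineq4[of x "z t"] x nz by simp
      thus ?thesis using False by (simp add: ln_mono)
    qed simp
    show ?case using nn_integral_has_integral_lebesgue'[OF nn hi] has_integral_nonneg[OF hi nn] by simp
  qed
  have "(\<integral>\<^sup>+x. (\<integral>\<^sup>+t. ?F x t \<partial>lborel) \<partial>sphere_measure) = (\<integral>\<^sup>+x. ennreal (G (norm (y - x))) \<partial>sphere_measure)"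
    using inner by (intro nn_integral_cong_AE) (auto elim!: eventually_mono)
  also have "\<dots> = (\<integral>\<^sup>+r. ennreal (G r) \<partial>?\<mu>)"
    by (rule nn_integral_chord[OF y]) measurable
  finally have 1: "(\<integral>\<^sup>+x. (\<integral>\<^sup>+t. ?F x t \<partial>lborel) \<partial>sphere_measure) = (\<integral>\<^sup>+r. ennreal (G r) \<partial>?\<mu>)" .
  have "(\<integral>\<^sup>+x. (\<integral>\<^sup>+t. ?F x t \<partial>lborel) \<partial>sphere_measure) = (\<integral>\<^sup>+t. (\<integral>\<^sup>+x. ?F x t \<partial>sphere_measure) \<partial>lborel)"
    by (rule SL.Fubini'[symmetric]) measurable
  also have "\<dots> = (\<integral>\<^sup>+t. ennreal A * indicator {0..1::real} t \<partial>lborel)"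
  proof (rule nn_integral_cong)
    fix t :: real
    have "(\<integral>\<^sup>+x. ?F x t \<partial>sphere_measure) = (\<integral>\<^sup>+x. ennreal (ln 2 - ln (norm (z t - x))) \<partial>sphere_measure) * indicator {0..1} t"
      by (subst nn_integral_multc) (auto simp: norm_minus_commute)
    also have "(\<integral>\<^sup>+x. ennreal (ln 2 - ln (norm (z t - x))) \<partial>sphere_measure) = (\<integral>\<^sup>+r. ennreal (ln 2 - ln r) \<partial>?\<mu>)"
      by (rule nn_integral_chord[OF nz]) measurable
    also have "\<dots> = ennreal A" unfolding A_def using iA posA by (rule nn_integral_eq_integral)
    finally show "(\<integral>\<^sup>+x. ?F x t \<partial>sphere_measure) = ennreal A * indicator {0..1} t" .
  qed
  also have "\<dots> = ennreal A" by (subst nn_integral_cmult) auto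
  finally have "(\<integral>\<^sup>+r. ennreal (G r) \<partial>?\<mu>) = ennreal A" unfolding 1 .
  moreover have "AE r in ?\<mu>. 0 \<le> G r"
  proof -
    have "AE x in sphere_measure. 0 \<le> G (norm (y - x))" using inner by eventually_elim simp
    thus ?thesis unfolding distr_chord[OF y, symmetric] by (subst AE_distr_iff) auto
  qed
  moreover have "A \<ge> 0" unfolding A_def using posA by (rule integral_nonneg_AE)
  ultimately have hG: "has_bochner_integral ?\<mu> G A"
    by (intro has_bochner_integral_nn_integral) auto
  have hA: "has_bochner_integral ?\<mu> (\<lambda>r. ln 2 - ln r) A"
    using iA by (simp add: A_def has_bochner_integral_iff)
  have "has_bochner_integral ?\<mu> (\<lambda>r. (ln 2 - ln r) - G r) (A - A)"
    by (intro has_bochner_integral_diff hA hG)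
  thus ?thesis by (simp add: G_def)
qed

lemma integral_log_bump:
  assumes dim: "DIM('a::euclidean_space) = 3" and b: "0 < b" "b < 1"
    and atom: "measure (chord_measure TYPE('a)) {2 * sqrt b} = 0"
  shows "has_bochner_integral (chord_measure TYPE('a)) (log_bump b) (- ln (1 - b) / 2)"
proof -
  interpret M: prob_space "chord_measure TYPE('a)" by (rule prob_space_chord_measure)
  have "has_bochner_integral (chord_measure TYPE('a)) (\<lambda>r. ln (1 - b) / 2) (ln (1 - b) / 2)"
    by (simp add: has_bochner_integral_iff M.prob_space[simplified])
  hence "has_bochner_integral (chord_measure TYPE('a)) (\<lambda>r. circle_gap b r - ln (1 - b) / 2) (0 - ln (1 - b) / 2)"
    by (intro has_bochner_integral_diff integral_circle_gap assms)
  thus ?thesis by (simp add: log_bump_def[abs_def])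
qed

section \<open>Archimedes' law for caps of the two-dimensional sphere\<close>

text \<open>\<open>X / 2\<close> will be the difference of the means of the bumps for
  \<open>c\<close> and \<open>b\<close>, and \<open>(X + Y) / 2\<close> the constant value of their
  difference on the smaller cap. All bounds come from \<open>ln t \<le> t - 1\<close>, and they
  place the quotient of the two between \<open>b\<close> and \<open>c\<close>.\<close>

lemma ln_ratio_bounds:
  fixes b c :: real
  assumes "0 < b" "b < c" "c < 1"
  defines "X \<equiv> ln (1 - b) - ln (1 - c)" and "Y \<equiv> ln c - ln b"
  shows "0 < X + Y" "b * (X + Y) \<le> X" "X \<le> c * (X + Y)"
proof -
  have X: "X = ln ((1 - b) / (1 - c))" "- X = ln ((1 - c) / (1 - b))" and Y: "Y = ln (c / b)" "- Y = ln (b / c)"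
    using assms by (simp_all add: ln_div)
  have "X \<le> (1 - b) / (1 - c) - 1" unfolding X(1) using assms by (intro ln_le_minus_one) auto
  hence 1: "X * (1 - c) \<le> c - b" using assms by (simp add: field_simps)
  have "- X \<le> (1 - c) / (1 - b) - 1" unfolding X(2) using assms by (intro ln_le_minus_one) auto
  hence 2: "c - b \<le> X * (1 - b)" using assms by (simp add: field_simps)
  have "Y \<le> c / b - 1" unfolding Y(1) using assms by (intro ln_le_minus_one) auto
  hence 3: "b * Y \<le> c - b" using assms by (simp add: field_simps)
  have "- Y \<le> b / c - 1" unfolding Y(2) using assms by (intro ln_le_minus_one) auto
  hence 4: "c - b \<le> c * Y" using assms by (simp add: field_simps)
  show "b * (X + Y) \<le> X" using 2 3 by (simp add: algebra_simps)
  show "X \<le> c * (X + Y)" using 1 4 by (simp add: algebra_simps)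
  have "X > 0" using assms by (simp add: X_def)
  moreover have "Y > 0" using assms by (simp add: Y_def)
  ultimately show "0 < X + Y" by simp
qed

lemma has_bochner_integral_mono_AE:
  fixes f g :: "'a \<Rightarrow> real"
  assumes "has_bochner_integral M f a" "has_bochner_integral M g b" "AE x in M. f x \<le> g x"
  shows "a \<le> b"
  using integral_mono_AE[of M f g] assms by (simp add: has_bochner_integral_iff)

lemma atMost_subset_lessThan_sqrt: "q < b \<Longrightarrow> {..2 * sqrt q} \<subseteq> {..<2 * sqrt b}"
  by (rule subsetI, simp only: atMost_iff lessThan_iff, erule le_less_trans) simp

text \<open>Archimedes: on the two-dimensional sphere the squared chord length is uniformly distributed. Outside the countable
  set of atoms, comparing the bumps for \<open>b < c\<close> bounds the difference quotient of the distribution function.\<close>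

lemma measure_chord_cap_aux:
  assumes dim: "DIM('a::euclidean_space) = 3" and bc: "0 < b" "b < c" "c < 1"
    and atoms: "measure (chord_measure TYPE('a)) {2 * sqrt b} = 0" "measure (chord_measure TYPE('a)) {2 * sqrt c} = 0"
  shows "measure (chord_measure TYPE('a)) {..2 * sqrt b} \<le> c" "b \<le> measure (chord_measure TYPE('a)) {..2 * sqrt c}"
proof -
  let ?\<mu> = "chord_measure TYPE('a)"
  interpret M: prob_space ?\<mu> by (rule prob_space_chord_measure)
  have dim2: "DIM('a) \<ge> 2" using dim by simp
  define X Y where "X = ln (1 - b) - ln (1 - c)" and "Y = ln c - ln b"
  note XY = ln_ratio_bounds[OF bc, folded X_def Y_def]
  \<comment> \<open>The difference of the two bumps lies between \<open>l\<close> times the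
    indicators of the smaller and of the larger cap; between the caps it decreases from
    \<open>l\<close> to 0.\<close>
  define l where "l = (X + Y) / 2"
  have L: "ln (c / (1 - c)) / 2 - ln (b / (1 - b)) / 2 = l"
    using bc by (simp add: l_def X_def Y_def ln_div diff_divide_distrib add_divide_distrib)
  have l: "l > 0" using XY by (simp add: l_def)
  have cap: "r \<le> 2 * sqrt q \<longleftrightarrow> r\<^sup>2 / 4 \<le> q" if "r > 0" "q > 0" for r q :: real
  proof -
    have "r \<le> 2 * sqrt q \<longleftrightarrow> r\<^sup>2 \<le> (2 * sqrt q)\<^sup>2" using that by (intro power_mono_iff[symmetric]) auto
    thus ?thesis using that by (simp add: power_mult_distrib field_simps)
  qed
  have hb: "has_bochner_integral ?\<mu> (log_bump b) (- ln (1 - b) / 2)"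
    "has_bochner_integral ?\<mu> (log_bump c) (- ln (1 - c) / 2)"
    using bc atoms by (intro integral_log_bump dim; simp)+
  have hd: "has_bochner_integral ?\<mu> (\<lambda>r. log_bump c r - log_bump b r) (X / 2)"
    using has_bochner_integral_diff[OF hb(2,1)] by (simp add: X_def diff_divide_distrib)
  have ind: "has_bochner_integral ?\<mu> (\<lambda>r. l * indicator {..q} r) (l * measure ?\<mu> {..q})" for q
    by (intro has_bochner_integral_mult_right has_bochner_integral_real_indicator) (auto simp: M.emeasure_eq_measure)
  have cases: "l * indicator {..2 * sqrt b} r \<le> log_bump c r - log_bump b r \<and>
      log_bump c r - log_bump b r \<le> l * indicator {..2 * sqrt c} r" if r: "r > 0" for r
  proof -
    consider "r\<^sup>2 / 4 \<le> b" | "b < r\<^sup>2 / 4" "r\<^sup>2 / 4 \<le> c" | "c < r\<^sup>2 / 4" by linarith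
    thus ?thesis
    proof cases
      case 1
      have "log_bump c r - log_bump b r = l"
        using bc r 1 L by (subst (1 2) log_bump_inside) auto
      thus ?thesis using 1 r bc by (simp add: indicator_def cap)
    next
      case 2
      have "ln (b / (1 - b)) \<le> ln ((r\<^sup>2 / 4) / (1 - r\<^sup>2 / 4))"
        using 2 bc by (intro ln_mono frac_le) auto
      moreover have "log_bump c r = ln (c / (1 - c)) / 2 - ln ((r\<^sup>2 / 4) / (1 - r\<^sup>2 / 4)) / 2"
        using bc r 2 by (intro log_bump_inside) auto
      ultimately have "log_bump c r \<le> l" using L by linarith
      moreover have "log_bump b r = 0" using bc 2 by (intro log_bump_outside) auto
      ultimately show ?thesis using 2 r bc log_bump_nonneg[of c r] by (simp add: indicator_def cap)
    next
      case 3
      have "log_bump b r = 0" "log_bump c r = 0" using bc 3 by (intro log_bump_outside; simp)+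
      thus ?thesis using 3 r bc by (simp add: indicator_def cap)
    qed
  qed
  have pos: "AE r in ?\<mu>. r > 0" using AE_chord_measure_pos[OF dim2] by eventually_elim auto
  have "AE r in ?\<mu>. l * indicator {..2 * sqrt b} r \<le> log_bump c r - log_bump b r"
    using pos by (rule eventually_mono) (use cases in blast)
  with ind hd have "l * measure ?\<mu> {..2 * sqrt b} \<le> X / 2" by (rule has_bochner_integral_mono_AE)
  also have "X / 2 \<le> l * c" using XY by (simp add: l_def mult.commute)
  finally show "measure ?\<mu> {..2 * sqrt b} \<le> c" using l by simp
  have lb: "l * b \<le> X / 2" using XY by (simp add: l_def mult.commute)
  have "AE r in ?\<mu>. log_bump c r - log_bump b r \<le> l * indicator {..2 * sqrt c} r"
    using pos by (rule eventually_mono) (use cases in blast)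
  with hd ind have "X / 2 \<le> l * measure ?\<mu> {..2 * sqrt c}" by (rule has_bochner_integral_mono_AE)
  with lb have "l * b \<le> l * measure ?\<mu> {..2 * sqrt c}" by linarith
  thus "b \<le> measure ?\<mu> {..2 * sqrt c}" using l by simp
qed

text \<open>Only countably many levels carry atoms, so admissible levels are dense. Squeezing
  \<open>b\<close> between them from above and below determines the measures of the closed and open
  caps, and their equality rules out an atom at the boundary.\<close>

lemma measure_chord_cap:
  assumes dim: "DIM('a::euclidean_space) = 3" and b: "0 < b" "b < 1"
  shows "measure (chord_measure TYPE('a)) {..2 * sqrt b} = b"
    and "measure (chord_measure TYPE('a)) {..<2 * sqrt b} = b"
    and "measure (chord_measure TYPE('a)) {2 * sqrt b} = 0"
proof -
  let ?\<mu> = "chord_measure TYPE('a)"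
  interpret M: prob_space ?\<mu> by (rule prob_space_chord_measure)
  let ?A = "{q \<in> {0<..}. measure ?\<mu> {2 * sqrt q} \<noteq> 0}"
  have "countable {r. measure ?\<mu> {r} \<noteq> 0}" by (rule M.countable_support)
  moreover have "(\<lambda>q. 2 * sqrt q) ` ?A \<subseteq> {r. measure ?\<mu> {r} \<noteq> 0}" by auto
  ultimately have "countable ((\<lambda>q. 2 * sqrt q) ` ?A)" by (rule countable_subset[rotated])
  moreover have "inj_on (\<lambda>q. 2 * sqrt q) ?A" by (auto simp: inj_on_def)
  ultimately have cA: "countable ?A" by (rule countable_image_inj_on)
  have ex: "\<exists>q. p < q \<and> q < p' \<and> measure ?\<mu> {2 * sqrt q} = 0" if "0 \<le> p" "p < p'" for p p'
  proof (rule ccontr)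
    assume "\<not> ?thesis"
    hence "{p<..<p'} \<subseteq> ?A" using that by auto
    thus False using cA countable_subset uncountable_open_interval that by blast
  qed
  have up: "measure ?\<mu> {..2 * sqrt b} \<le> c" if b: "0 < b" "b < c" "c < 1" for b c
  proof -
    obtain q where q: "b < q" "q < c" "measure ?\<mu> {2 * sqrt q} = 0" using ex[of b c] b by auto
    obtain q' where q': "q < q'" "q' < c" "measure ?\<mu> {2 * sqrt q'} = 0" using ex[of q c] b q by auto
    have "measure ?\<mu> {..2 * sqrt b} \<le> measure ?\<mu> {..2 * sqrt q}" using q by (intro M.finite_measure_mono) auto
    also have "\<dots> \<le> q'" using q q' b by (intro measure_chord_cap_aux(1)[OF dim]) auto
    finally show ?thesis using q' by simp
  qed
  have low: "c \<le> measure ?\<mu> {..<2 * sqrt b}" if b: "0 < c" "c < b" "b < 1" for b c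
  proof -
    obtain q where q: "c < q" "q < b" "measure ?\<mu> {2 * sqrt q} = 0" using ex[of c b] b by auto
    obtain q' where q': "q < q'" "q' < b" "measure ?\<mu> {2 * sqrt q'} = 0" using ex[of q b] b q by auto
    have "q \<le> measure ?\<mu> {..2 * sqrt q'}" using q q' b by (intro measure_chord_cap_aux(2)[OF dim]) auto
    also have "\<dots> \<le> measure ?\<mu> {..<2 * sqrt b}" using q' by (intro M.finite_measure_mono atMost_subset_lessThan_sqrt) auto
    finally show ?thesis using q by simp
  qed
  have 1: "measure ?\<mu> {..2 * sqrt b} \<le> b" using up[of b] b by (intro dense_ge_bounded[of b 1]) auto
  have 2: "b \<le> measure ?\<mu> {..<2 * sqrt b}" using low[of _ b] b by (intro dense_le_bounded[of 0 b]) auto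
  have 3: "measure ?\<mu> {..2 * sqrt b} = measure ?\<mu> {..<2 * sqrt b} + measure ?\<mu> {2 * sqrt b}"
    by (subst M.finite_measure_Union[symmetric]) (auto intro!: arg_cong[of _ _ "measure ?\<mu>"])
  have "measure ?\<mu> {2 * sqrt b} \<ge> 0" by simp
  with 1 2 3 show "measure ?\<mu> {..2 * sqrt b} = b" "measure ?\<mu> {..<2 * sqrt b} = b" "measure ?\<mu> {2 * sqrt b} = 0"
    by linarith+
qed

text \<open>As \<open>r\<^sup>2 / 4\<close> is uniform on the unit interval,
  \<open>- ln (r\<^sup>2 / 4)\<close> is exponentially distributed with mean 1; solving
  \<open>1 = 2 * m + 2 * ln 2\<close> for the mean \<open>m\<close> of \<open>- ln r\<close> gives
  the value.\<close>

lemma integral_chord_neg_ln: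
  assumes dim: "DIM('a::euclidean_space) = 3"
  shows "(\<integral>r. - ln r \<partial>chord_measure TYPE('a)) = 1 / 2 - ln 2"
proof -
  let ?\<mu> = "chord_measure TYPE('a)"
  interpret M: prob_space ?\<mu> by (rule prob_space_chord_measure)
  have dim2: "DIM('a) \<ge> 2" using dim by simp
  let ?X = "\<lambda>r::real. - ln (r\<^sup>2 / 4)"
  have lt: "measure ?\<mu> {..<2 * sqrt b} = b" if b: "0 < b" "b \<le> 1" for b
  proof (cases "b = 1")
    case True
    have "1 \<le> measure ?\<mu> {..<2 * sqrt b}"
    proof (rule dense_le_bounded[of 0 1])
      fix q :: real assume q: "0 < q" "q < 1"
      have "q = measure ?\<mu> {..2 * sqrt q}" using measure_chord_cap[OF dim q] by simp
      also have "\<dots> \<le> measure ?\<mu> {..<2 * sqrt b}" using q True by (intro M.finite_measure_mono atMost_subset_lessThan_sqrt) auto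
      finally show "q \<le> measure ?\<mu> {..<2 * sqrt b}" .
    qed simp
    thus ?thesis using True M.prob_le_1[of "{..<2 * sqrt b}"] by linarith
  qed (use measure_chord_cap(2)[OF dim, of b] b in simp)
  have "distributed ?\<mu> lborel ?X (exponential_density 1)"
  proof (rule exponential_distributedI)
    fix a :: real assume a: "0 \<le> a"
    define b where "b = exp (- a)"
    have b: "0 < b" "b \<le> 1" using a by (simp_all add: b_def)
    have "emeasure ?\<mu> {r \<in> space ?\<mu>. ?X r \<le> a} = emeasure ?\<mu> (UNIV - {..<2 * sqrt b})"
    proof (rule emeasure_eq_AE)
      show "AE r in ?\<mu>. r \<in> {r \<in> space ?\<mu>. ?X r \<le> a} \<longleftrightarrow> r \<in> UNIV - {..<2 * sqrt b}"
        using AE_chord_measure_pos[OF dim2]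
      proof eventually_elim
        case (elim r)
        have "?X r \<le> a \<longleftrightarrow> - a \<le> ln (r\<^sup>2 / 4)" by linarith
        also have "\<dots> \<longleftrightarrow> b \<le> r\<^sup>2 / 4" unfolding b_def using elim by (subst ln_ge_iff) auto
        also have "\<dots> \<longleftrightarrow> (2 * sqrt b)\<^sup>2 \<le> r\<^sup>2" using b by (simp add: power_mult_distrib field_simps)
        also have "\<dots> \<longleftrightarrow> 2 * sqrt b \<le> r" using b elim by (intro power_mono_iff) auto
        finally show ?case by (auto simp: not_less)
      qed
    qed auto
    also have "\<dots> = 1 - emeasure ?\<mu> {..<2 * sqrt b}"
      using M.emeasure_space_1 by (subst emeasure_Diff) auto
    also have "\<dots> = 1 - ennreal (exp (- a * 1))"
      using lt[OF b] by (simp add: M.emeasure_eq_measure b_def)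
    finally show "emeasure ?\<mu> {r \<in> space ?\<mu>. ?X r \<le> a} = 1 - ennreal (exp (- a * 1))" .
  qed auto
  hence eX: "(\<integral>r. ?X r \<partial>?\<mu>) = 1" using M.exponential_distributed_expectation[of 1 ?X] by simp
  have "(\<integral>r. ?X r \<partial>?\<mu>) = (\<integral>r. 2 * (- ln r) + 2 * ln 2 \<partial>?\<mu>)"
  proof (rule integral_cong_AE)
    show "AE r in ?\<mu>. ?X r = 2 * (- ln r) + 2 * ln 2"
      using AE_chord_measure_pos[OF dim2]
    proof eventually_elim
      case (elim r)
      have "ln (4::real) = 2 * ln 2" using ln_realpow[of 2 2] by simp
      thus ?case using elim by (simp add: ln_div ln_realpow)
    qed
  qed auto
  also have "\<dots> = 2 * (\<integral>r. - ln r \<partial>?\<mu>) + 2 * ln 2"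
    using integrable_chord_ln[OF dim] M.prob_space by (subst Bochner_Integration.integral_add) auto
  finally show ?thesis using eX by simp
qed

section \<open>Cap means of the logarithmic kernel\<close>

definition rotate_about :: "'a::real_inner \<Rightarrow> 'a \<Rightarrow> 'a \<Rightarrow> real \<Rightarrow> 'a \<Rightarrow> 'a" where
  "rotate_about y e f t z = (z \<bullet> y) *\<^sub>R y + cos t *\<^sub>R ((z \<bullet> e) *\<^sub>R e + (z \<bullet> f) *\<^sub>R f)
     + sin t *\<^sub>R ((z \<bullet> e) *\<^sub>R f - (z \<bullet> f) *\<^sub>R e)"

lemma rotate_about:
  fixes y e f :: "'a::euclidean_space"
  assumes ex: "\<And>z w. z \<bullet> w = (z \<bullet> y) * (w \<bullet> y) + (z \<bullet> e) * (w \<bullet> e) + (z \<bullet> f) * (w \<bullet> f)"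
    and on: "y \<bullet> e = 0" "y \<bullet> f = 0" "e \<bullet> f = 0" "e \<bullet> e = 1" "f \<bullet> f = 1" "norm y = 1"
  shows "orthogonal_transformation (rotate_about y e f t)"
    and "norm (y - rotate_about y e f t z) = norm (y - z)"
proof -
  have yy: "y \<bullet> y = 1" using on by (simp add: dot_square_norm)
  have co: "rotate_about y e f t z \<bullet> y = z \<bullet> y"
    "rotate_about y e f t z \<bullet> e = cos t * (z \<bullet> e) - sin t * (z \<bullet> f)"
    "rotate_about y e f t z \<bullet> f = cos t * (z \<bullet> f) + sin t * (z \<bullet> e)" for z
    using on yy by (simp_all add: rotate_about_def inner_add_left inner_diff_left
        inner_commute[of e y] inner_commute[of f y] inner_commute[of f e])
  have inn: "rotate_about y e f t z \<bullet> rotate_about y e f t w = z \<bullet> w" for z w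
  proof -
    define c s where "c = cos t" and "s = sin t"
    have cs: "c * c + s * s = 1" by (simp add: c_def s_def flip: power2_eq_square)
    have "rotate_about y e f t z \<bullet> rotate_about y e f t w
        = (z \<bullet> y) * (w \<bullet> y) + (c * c + s * s) * ((z \<bullet> e) * (w \<bullet> e) + (z \<bullet> f) * (w \<bullet> f))"
      unfolding ex[of "rotate_about y e f t z"] co c_def[symmetric] s_def[symmetric] by (simp add: algebra_simps)
    thus ?thesis unfolding cs ex[of z w] by simp
  qed
  have lin: "linear (rotate_about y e f t)"
    by (rule linearI) (simp_all add: rotate_about_def inner_add_left algebra_simps)
  show o: "orthogonal_transformation (rotate_about y e f t)"
    unfolding orthogonal_transformation_def using lin inn by blast
  have "rotate_about y e f t y = y" using on yy by (simp add: rotate_about_def)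
  hence "y - rotate_about y e f t z = rotate_about y e f t (y - z)"
    by (simp add: linear_diff[OF lin])
  thus "norm (y - rotate_about y e f t z) = norm (y - z)"
    using o by (simp add: orthogonal_transformation_norm)
qed

lemma integrable_sphere_ln:
  fixes x :: "'a::euclidean_space"
  assumes dim: "DIM('a) = 3" and x: "norm x = 1"
  shows "has_bochner_integral sphere_measure (\<lambda>z. - ln (norm (x - z))) (1 / 2 - ln 2)"
  using integral_chord[OF x, of "\<lambda>r. - ln r"] integrable_chord[OF x, of "\<lambda>r. - ln r"]
    integrable_chord_ln[OF dim] integral_chord_neg_ln[OF dim] by (simp add: has_bochner_integral_iff)

text \<open>Off its pole the logarithmic kernel is at most its mean over a spherical cap: rotate the cap about its centre and
  use the circle means.\<close>

lemma log_cap_mean: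
  fixes x y :: "'a::euclidean_space"
  assumes dim: "DIM('a) = 3" and x: "norm x = 1" and y: "norm y = 1" and b: "0 < b" "b < 1" "b < (norm (x - y))\<^sup>2 / 4"
  shows "- ln (norm (x - y)) * b
     \<le> (\<integral>z. - ln (norm (x - z)) * indicator {..2 * sqrt b} (norm (y - z)) \<partial>sphere_measure)"
proof -
  interpret S: prob_space "sphere_measure :: 'a measure" by (rule prob_space_sphere_measure)
  interpret M: prob_space "chord_measure TYPE('a)" by (rule prob_space_chord_measure)
  interpret SL: pair_sigma_finite "sphere_measure :: 'a measure" "lborel :: real measure" ..
  have dim2: "DIM('a) \<ge> 2" using dim by simp
  obtain e f where fr: "\<And>z w. z \<bullet> w = (z \<bullet> y) * (w \<bullet> y) + (z \<bullet> e) * (w \<bullet> e) + (z \<bullet> f) * (w \<bullet> f)"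
    "y \<bullet> e = 0" "y \<bullet> f = 0" "e \<bullet> f = 0" "e \<bullet> e = 1" "f \<bullet> f = 1"
    using orthonormal_frame[OF dim y] by metis
  note rot = rotate_about[OF fr y]
  define R where "R t z = rotate_about y e f (2 * pi * t) z" for t z
  let ?I = "\<lambda>z. indicator {..2 * sqrt b} (norm (y - z)) :: ennreal"
  have Rm [measurable]: "(\<lambda>p. R (snd p) (fst p)) \<in> borel_measurable (borel \<Otimes>\<^sub>M borel)"
    unfolding R_def rotate_about_def by measurable
  have Rm1 [measurable]: "R t \<in> borel_measurable borel" for t
    unfolding R_def rotate_about_def by measurable
  let ?F = "\<lambda>z. ennreal (ln 2 - ln (norm (x - z)))"
  \<comment> \<open>Rotations about \<open>y\<close> preserve both the measure and the cap, so the
    cap integral may be averaged over the angle.\<close>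
  have inv: "(\<integral>\<^sup>+z. ?F z * ?I z \<partial>sphere_measure) = (\<integral>\<^sup>+z. ?F (R t z) * ?I z \<partial>sphere_measure)" for t
  proof -
    have "(\<integral>\<^sup>+z. ?F z * ?I z \<partial>sphere_measure) = (\<integral>\<^sup>+z. ?F z * ?I z \<partial>distr sphere_measure borel (R t))"
      unfolding R_def by (simp only: sphere_measure_distr_orthogonal[OF rot(1)])
    also have "\<dots> = (\<integral>\<^sup>+z. ?F (R t z) * ?I (R t z) \<partial>sphere_measure)"
      by (subst nn_integral_distr) auto
    finally show ?thesis by (simp add: R_def rot(2))
  qed
  have xy: "x \<noteq> y" using b by auto
  have K0: "0 \<le> ln 2 - ln (norm (x - y))"
  proof -
    have "norm (x - y) \<le> 2" using norm_triangle_ineq4[of x y] x y by simp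
    thus ?thesis using xy by (simp add: ln_mono)
  qed
  have inner: "AE z in sphere_measure. ennreal (ln 2 - ln (norm (x - y))) * ?I z
      \<le> (\<integral>\<^sup>+t. ?F (R t z) * ?I z * indicator {0..1} t \<partial>lborel)"
    using AE_sphere_measure AE_sphere_neq[OF dim2 y]
  proof eventually_elim
    case (elim z)
    hence z: "norm z = 1" "z \<noteq> y" by auto
    show ?case
    proof (cases "norm (y - z) \<le> 2 * sqrt b")
      case True
      define \<beta> where "\<beta> = (norm (y - z))\<^sup>2 / 4"
      have "(norm (y - z))\<^sup>2 \<le> (2 * sqrt b)\<^sup>2" using True by (intro power_mono) auto
      hence beta: "0 < \<beta>" "\<beta> \<le> b" using z b by (simp_all add: \<beta>_def power_mult_distrib)
      have zy: "z \<bullet> y = 1 - 2 * \<beta>"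
        using inner_eq_chord[OF z(1) y] by (simp add: \<beta>_def norm_minus_commute)
      define v v' where "v = (z \<bullet> e) *\<^sub>R e + (z \<bullet> f) *\<^sub>R f" and "v' = (z \<bullet> e) *\<^sub>R f - (z \<bullet> f) *\<^sub>R e"
      have Rz: "R t z = (1 - 2 * \<beta>) *\<^sub>R y + cos (2 * pi * t) *\<^sub>R v + sin (2 * pi * t) *\<^sub>R v'" for t
        by (simp add: R_def rotate_about_def v_def v'_def zy)
      have nR: "norm (R t z) = 1" for t
        unfolding R_def using rot(1) z by (simp add: orthogonal_transformation_norm)
      have "x \<bullet> x = 1" "z \<bullet> z = 1" using x z by (simp_all add: dot_square_norm)
      hence pl: "(x \<bullet> e)\<^sup>2 + (x \<bullet> f)\<^sup>2 = 1 - (x \<bullet> y)\<^sup>2" "(z \<bullet> e)\<^sup>2 + (z \<bullet> f)\<^sup>2 = 1 - (z \<bullet> y)\<^sup>2"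
        using fr(1)[of x x] fr(1)[of z z] by (simp_all add: power2_eq_square)
      have "(x \<bullet> v)\<^sup>2 + (x \<bullet> v')\<^sup>2 = ((z \<bullet> e)\<^sup>2 + (z \<bullet> f)\<^sup>2) * ((x \<bullet> e)\<^sup>2 + (x \<bullet> f)\<^sup>2)"
        by (simp add: v_def v'_def inner_add_right inner_diff_right power2_eq_square algebra_simps)
      hence vv: "(x \<bullet> v)\<^sup>2 + (x \<bullet> v')\<^sup>2 = (1 - (1 - 2 * \<beta>)\<^sup>2) * (1 - (x \<bullet> y)\<^sup>2)"
        unfolding pl zy .
      have "((\<lambda>t. - ln (norm (x - R t z))) has_integral (- ln (norm (x - y)) - circle_gap \<beta> (norm (x - y)))) {0..1}"
        unfolding Rz by (rule has_integral_ln_circle) (use x y xy beta b vv nR in \<open>simp_all add: Rz\<close>)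
      hence "((\<lambda>t. ln 2 + - ln (norm (x - R t z))) has_integral (ln 2 + (- ln (norm (x - y)) - circle_gap \<beta> (norm (x - y))))) {0..1}"
        using has_integral_const_real[of "ln 2" 0 1] by (intro has_integral_add) auto
      hence hi: "((\<lambda>t. ln 2 - ln (norm (x - R t z))) has_integral (ln 2 - ln (norm (x - y)) - circle_gap \<beta> (norm (x - y)))) {0..1}"
        by (simp add: algebra_simps)
      have nn: "0 \<le> ln 2 - ln (norm (x - R t z))" for t
      proof (cases "x = R t z")
        case False
        have "norm (x - R t z) \<le> 2" using norm_triangle_ineq4[of x "R t z"] x nR by simp
        thus ?thesis using False by (simp add: ln_mono)
      qed simp
      \<comment> \<open>Seen from \<open>y\<close>, the point \<open>x\<close> is farther away than
        the circle through \<open>z\<close>. There the circle gap is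
        \<open>ln (1 - \<beta>) / 2 \<le> 0\<close>, so the circle mean is at least the kernel at
        \<open>y\<close>.\<close>
      have "log_bump \<beta> (norm (x - y)) = 0" using beta b by (intro log_bump_outside) auto
      hence "circle_gap \<beta> (norm (x - y)) = ln (1 - \<beta>) / 2" by (simp add: log_bump_def)
      also have "\<dots> \<le> 0" using beta b by simp
      finally have "ennreal (ln 2 - ln (norm (x - y))) \<le> ennreal (ln 2 - ln (norm (x - y)) - circle_gap \<beta> (norm (x - y)))"
        by (intro ennreal_leI) simp
      also have "\<dots> = (\<integral>\<^sup>+t. ?F (R t z) * indicator {0..1} t \<partial>lborel)"
        by (rule nn_integral_has_integral_lebesgue'[OF nn hi, symmetric])
      finally show ?thesis using True by simp
    qed simp
  qed
  have "ennreal ((ln 2 - ln (norm (x - y))) * b) = (\<integral>\<^sup>+z. ennreal (ln 2 - ln (norm (x - y))) * ?I z \<partial>sphere_measure)"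
  proof -
    have "(\<integral>\<^sup>+z. ?I z \<partial>sphere_measure) = (\<integral>\<^sup>+r. indicator {..2 * sqrt b} r \<partial>chord_measure TYPE('a))"
      by (rule nn_integral_chord[OF y]) measurable
    also have "\<dots> = ennreal b" using measure_chord_cap(1)[OF dim b(1,2)] by (simp add: M.emeasure_eq_measure)
    finally show ?thesis using K0 b by (subst nn_integral_cmult) (auto simp: ennreal_mult)
  qed
  also have "\<dots> \<le> (\<integral>\<^sup>+z. (\<integral>\<^sup>+t. ?F (R t z) * ?I z * indicator {0..1} t \<partial>lborel) \<partial>sphere_measure)"
    using inner by (rule nn_integral_mono_AE)
  also have "\<dots> = (\<integral>\<^sup>+t. (\<integral>\<^sup>+z. ?F (R t z) * ?I z * indicator {0..1} t \<partial>sphere_measure) \<partial>lborel)"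
  proof (rule SL.Fubini'[symmetric])
    have [measurable]: "(\<lambda>p. R (snd p) (fst p)) \<in> borel_measurable (sphere_measure \<Otimes>\<^sub>M lborel)"
      using Rm by (simp cong: measurable_cong_sets sets_pair_measure_cong)
    have "(\<lambda>p. ?F (R (snd p) (fst p)) * ?I (fst p) * indicator {0..1} (snd p)) \<in> borel_measurable (sphere_measure \<Otimes>\<^sub>M lborel)"
      by measurable
    thus "(\<lambda>(z, t). ?F (R t z) * ?I z * indicator {0..1} t) \<in> borel_measurable (sphere_measure \<Otimes>\<^sub>M lborel)"
      by (simp add: split_beta')
  qed
  also have "\<dots> = (\<integral>\<^sup>+t. (\<integral>\<^sup>+z. ?F z * ?I z \<partial>sphere_measure) * indicator {0..1::real} t \<partial>lborel)"
    by (intro nn_integral_cong) (subst nn_integral_multc, auto simp: inv[symmetric])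
  also have "\<dots> = (\<integral>\<^sup>+z. ?F z * ?I z \<partial>sphere_measure)" by (subst nn_integral_cmult) auto
  finally have le: "ennreal ((ln 2 - ln (norm (x - y))) * b) \<le> (\<integral>\<^sup>+z. ?F z * ?I z \<partial>sphere_measure)" .
  define J where "J z = indicator {..2 * sqrt b} (norm (y - z)) * (1::real)" for z
  have J: "{z. norm (y - z) \<le> 2 * sqrt b} \<in> sets borel" by measurable
  have iK: "integrable sphere_measure (\<lambda>z. - ln (norm (x - z)))"
    using integrable_sphere_ln[OF dim x] by (simp add: has_bochner_integral_iff)
  have Jm [measurable]: "J \<in> borel_measurable borel" unfolding J_def by measurable
  have ind: "integrable sphere_measure (\<lambda>z. f z * J z)" if f: "integrable sphere_measure f" for f :: "'a \<Rightarrow> real"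
  proof (rule Bochner_Integration.integrable_bound[OF f])
    show "AE z in sphere_measure. norm (f z * J z) \<le> norm (f z)" by (intro AE_I2) (simp add: J_def indicator_def)
  qed (use borel_measurable_integrable[OF f] in measurable)
  have mJ: "(\<integral>z. J z \<partial>sphere_measure) = b"
    using integral_chord[OF y, of "\<lambda>r. indicator {..2 * sqrt b} r * 1"] measure_chord_cap(1)[OF dim b(1,2)]
    by (simp add: J_def)
  have iF: "integrable sphere_measure (\<lambda>z. (ln 2 - ln (norm (x - z))) * J z)"
    using iK by (intro ind) simp
  have nn: "AE z in sphere_measure. 0 \<le> (ln 2 - ln (norm (x - z))) * J z"
    using AE_sphere_measure AE_sphere_neq[OF dim2 x]
  proof eventually_elim
    case (elim z)
    have "norm (x - z) \<le> 2" using norm_triangle_ineq4[of x z] x elim by simp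
    thus ?case using elim by (simp add: J_def ln_mono indicator_def)
  qed
  have "(\<integral>\<^sup>+z. ?F z * ?I z \<partial>sphere_measure) = (\<integral>\<^sup>+z. ennreal ((ln 2 - ln (norm (x - z))) * J z) \<partial>sphere_measure)"
    by (intro nn_integral_cong) (simp add: J_def indicator_def)
  also have "\<dots> = ennreal (\<integral>z. (ln 2 - ln (norm (x - z))) * J z \<partial>sphere_measure)"
    using iF nn by (rule nn_integral_eq_integral)
  finally have "(ln 2 - ln (norm (x - y))) * b \<le> (\<integral>z. (ln 2 - ln (norm (x - z))) * J z \<partial>sphere_measure)"
    using le integral_nonneg_AE[OF nn] by (simp add: ennreal_le_iff)
  also have "\<dots> = (\<integral>z. ln 2 * J z + - ln (norm (x - z)) * J z \<partial>sphere_measure)"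
    by (simp add: algebra_simps)
  also have "\<dots> = ln 2 * b + (\<integral>z. - ln (norm (x - z)) * J z \<partial>sphere_measure)"
    using ind[of "\<lambda>_. 1"] ind[OF iK] mJ by (subst Bochner_Integration.integral_add) auto
  finally show ?thesis by (simp add: J_def algebra_simps)
qed

section \<open>Greedy sequences for the logarithmic kernel\<close>

context
  fixes x :: "'i \<Rightarrow> 'a::euclidean_space" and I :: "'i set" and u :: real
  assumes dim: "DIM('a) = 3" and I: "finite I" "I \<noteq> {}" "\<And>i. i \<in> I \<Longrightarrow> norm (x i) = 1"
    and u: "\<And>z. norm z = 1 \<Longrightarrow> z \<notin> x ` I \<Longrightarrow> u \<le> (\<Sum>i\<in>I. - ln (norm (x i - z)))"
begin

lemma card_ge_1: "real (card I) \<ge> 1"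
  using I by (simp add: card_gt_0_iff Suc_leI)

lemma log_excess:
  "has_bochner_integral sphere_measure (\<lambda>z. (\<Sum>i\<in>I. - ln (norm (x i - z))) - u) (real (card I) * (1 / 2 - ln 2) - u)"
proof -
  interpret S: prob_space "sphere_measure :: 'a measure" by (rule prob_space_sphere_measure)
  have "has_bochner_integral sphere_measure (\<lambda>z::'a. u) u"
    using S.prob_space by (simp add: has_bochner_integral_iff)
  hence "has_bochner_integral sphere_measure (\<lambda>z. (\<Sum>i\<in>I. - ln (norm (x i - z))) - u) ((\<Sum>i\<in>I. 1 / 2 - ln 2) - u)"
    using I by (intro has_bochner_integral_diff has_bochner_integral_sum integrable_sphere_ln dim) auto
  thus ?thesis by simp
qed

lemma AE_not_point: "AE z in sphere_measure. norm z = 1 \<and> z \<notin> x ` I"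
proof -
  have "AE z in sphere_measure. \<forall>i\<in>I. z \<noteq> x i"
    using I dim by (intro AE_finite_allI AE_sphere_neq) auto
  thus ?thesis using AE_sphere_measure by eventually_elim auto
qed

lemma AE_log_excess_nonneg: "AE z in sphere_measure. 0 \<le> (\<Sum>i\<in>I. - ln (norm (x i - z))) - u"
  using AE_not_point
proof eventually_elim
  case (elim z)
  thus ?case using u[of z] by simp
qed

lemma log_excess_ge_bumps:
  assumes "norm y = 1" "y \<notin> x ` I" "0 < b" "b < 1"
  shows "(\<Sum>i\<in>I. log_bump b (norm (x i - y))) - real (card I) * (- ln (1 - b) / 2) \<le> (\<Sum>i\<in>I. - ln (norm (x i - y))) - u"
proof -
  have "u + (\<Sum>i\<in>I. circle_gap b (norm (x i - y))) \<le> (\<Sum>i\<in>I. - ln (norm (x i - y)))"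
    by (rule log_potential_ge[where x = x, OF dim I(1)]; (rule I(3) u assms; assumption)?)
  moreover have "(\<Sum>i\<in>I. log_bump b (norm (x i - y)))
      = (\<Sum>i\<in>I. circle_gap b (norm (x i - y))) - real (card I) * (ln (1 - b) / 2)"
    by (simp only: log_bump_def sum_subtractf sum_constant)
  ultimately show ?thesis by simp
qed

text \<open>Caps of measure \<open>b = 1 / (2 * n)\<close> cover at most half of the sphere, while
  each bump lies entirely in its cap. So half of the total mean \<open>n * c\<close> of the bumps
  survives, and \<open>c \<ge> b / 2\<close> makes this at least
  \<open>n * b / 4 = 1 / 8\<close>.\<close>

lemma log_polarization: "u \<le> real (card I) * (1 / 2 - ln 2) - 1 / 8"
proof -
  let ?\<mu> = "chord_measure TYPE('a)"
  have dim2: "DIM('a) \<ge> 2" using dim by simp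
  define n where "n = real (card I)"
  have n: "n \<ge> 1" using card_ge_1 by (simp add: n_def)
  define b where "b = 1 / (2 * n)"
  have b: "0 < b" "b < 1" "n * b = 1 / 2" using n by (simp_all add: b_def field_simps)
  define c where "c = - ln (1 - b) / 2"
  have "ln (1 - b) \<le> (1 - b) - 1" using b by (intro ln_le_minus_one) auto
  hence c: "c \<ge> b / 2" by (simp add: c_def)
  have hb: "has_bochner_integral ?\<mu> (log_bump b) c"
    unfolding c_def using b by (intro integral_log_bump dim measure_chord_cap(3)) auto
  have "AE y in sphere_measure. (\<Sum>i\<in>I. - ln (norm (x i - y))) - u \<ge> (\<Sum>i\<in>I. log_bump b (norm (x i - y))) - real (card I) * c"
    using AE_not_point by eventually_elim (use log_excess_ge_bumps b in \<open>simp add: c_def\<close>)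
  hence "n * ((\<integral>r. log_bump b r * indicator {..2 * sqrt b} r \<partial>?\<mu>) - c * (n * measure ?\<mu> {..2 * sqrt b}))
      \<le> (\<integral>y. (\<Sum>i\<in>I. - ln (norm (x i - y))) - u \<partial>sphere_measure)"
    unfolding n_def using log_excess hb b c log_bump_nonneg
    by (intro integral_ge_bumps dim2 I(1,2) AE_log_excess_nonneg) (auto simp: has_bochner_integral_iff I(3))
  also have "\<dots> = n * (1 / 2 - ln 2) - u"
    using log_excess by (simp add: has_bochner_integral_iff n_def)
  also have "measure ?\<mu> {..2 * sqrt b} = b" using b by (intro measure_chord_cap dim) auto
  also have "(\<integral>r. log_bump b r * indicator {..2 * sqrt b} r \<partial>?\<mu>) = (\<integral>r. log_bump b r \<partial>?\<mu>)"
  proof (rule Bochner_Integration.integral_cong[OF refl])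
    fix r :: real
    show "log_bump b r * indicator {..2 * sqrt b} r = log_bump b r"
    proof (cases "r \<le> 2 * sqrt b")
      case False
      hence "(2 * sqrt b)\<^sup>2 \<le> r\<^sup>2" using b by (intro power_mono) auto
      hence "b \<le> r\<^sup>2 / 4" using b by (simp add: power_mult_distrib)
      thus ?thesis using log_bump_outside b by simp
    qed simp
  qed
  also have "\<dots> = c" using hb by (simp add: has_bochner_integral_iff)
  finally have "n * (c - c * (n * b)) \<le> n * (1 / 2 - ln 2) - u" .
  moreover have "n * (c - c * (n * b)) = n * c / 2" unfolding b(3) by simp
  moreover have "n * c \<ge> n * (b / 2)" using c n by (intro mult_left_mono) auto
  ultimately show ?thesis unfolding n_def[symmetric] using b(3) by linarith
qed

text \<open>Where the potential does not exceed \<open>u\<close>, the sum of the bumps is at most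
  \<open>n\<close> times their mean, hence at most 1/2 for \<open>b = 1 / (2 * n)\<close>. Each
  single bump is then at most 1/2; since it grows logarithmically near its centre, the squared chord
  divided by 4 is at least \<open>b / (2 * exp 1) \<ge> b / 6\<close>.\<close>

lemma log_separation:
  assumes y: "norm y = 1" "y \<notin> x ` I" "(\<Sum>i\<in>I. - ln (norm (x i - y))) \<le> u" and i: "i \<in> I"
  shows "(norm (x i - y))\<^sup>2 \<ge> 1 / (3 * real (card I))"
proof -
  define n where "n = real (card I)"
  have n: "n \<ge> 1" using card_ge_1 by (simp add: n_def)
  define b where "b = 1 / (2 * n)"
  have b: "0 < b" "b \<le> 1 / 2" "n * b = 1 / 2" using n by (simp_all add: b_def field_simps)
  define r where "r = norm (x i - y)"
  have r: "r > 0" using y i by (auto simp: r_def)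
  define \<beta> where "\<beta> = r\<^sup>2 / 4"
  have beta: "\<beta> > 0" using r by (simp add: \<beta>_def)
  have "\<beta> \<ge> b / 6"
  proof (cases "b \<le> \<beta>")
    case False
    have "- ln (1 - b) = ln (1 / (1 - b))" using b by (simp add: ln_div)
    also have "\<dots> \<le> 1 / (1 - b) - 1" using b by (intro ln_le_minus_one) auto
    also have "\<dots> \<le> 2 * b" using b mult_left_mono[of b "1/2" "2 * b"] by (simp add: field_simps)
    finally have "n * (- ln (1 - b) / 2) \<le> n * b" using n by (intro mult_left_mono) auto
    hence "(\<Sum>i\<in>I. log_bump b (norm (x i - y))) \<le> 1 / 2"
      using log_excess_ge_bumps[OF y(1,2), of b] y(3) b by (simp add: n_def)
    moreover have "log_bump b r \<le> (\<Sum>i\<in>I. log_bump b (norm (x i - y)))"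
      unfolding r_def using i I b log_bump_nonneg by (intro member_le_sum) auto
    moreover have "log_bump b r = ln (b / (1 - b)) / 2 - ln (\<beta> / (1 - \<beta>)) / 2"
      unfolding \<beta>_def using False b r by (intro log_bump_inside) (auto simp: \<beta>_def)
    ultimately have "ln (b / (1 - b)) - 1 \<le> ln (\<beta> / (1 - \<beta>))" by linarith
    moreover have "ln b \<le> ln (b / (1 - b))" using b by (intro ln_mono) (auto simp: field_simps)
    moreover have "ln (\<beta> / (1 - \<beta>)) \<le> ln (2 * \<beta>)"
      using False beta b by (intro ln_mono) (auto simp: field_simps)
    ultimately have "ln b \<le> ln (2 * \<beta>) + ln (exp 1)" by simp
    also have "\<dots> = ln (2 * \<beta> * exp 1)" using beta by (simp add: ln_mult)
    finally have "b \<le> 2 * \<beta> * exp 1" using b beta by simp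
    also have "\<dots> \<le> 2 * \<beta> * 3" using exp_le beta by (intro mult_left_mono) auto
    finally show ?thesis by simp
  qed (use b in simp)
  thus ?thesis using n by (simp add: \<beta>_def r_def b_def n_def field_simps)
qed

text \<open>On the cap about \<open>x i\<close> each other kernel has mean at least its value at
  \<open>x i\<close>, while the own kernel is at least \<open>- ln R\<close>. So the potential at
  \<open>x i\<close> of the other points is bounded by the mean of the excess \<open>V\<close> over
  the cap, plus \<open>u + ln R\<close>. The caps being disjoint, the integrals of \<open>V\<close>
  over them add up to at most the total excess, and division by \<open>b\<close> produces the factor
  \<open>64 * N\<close>; \<open>ln R\<close> is the source of \<open>- ln N / 2\<close>.\<close>

lemma log_energy_le:
  assumes sep: "\<And>i j. i \<in> I \<Longrightarrow> j \<in> I \<Longrightarrow> i \<noteq> j \<Longrightarrow> (norm (x i - x j))\<^sup>2 \<ge> 1 / (3 * real (card I))"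
  defines "N \<equiv> real (card I)"
  shows "(\<Sum>i\<in>I. \<Sum>j\<in>I - {i}. - ln (norm (x i - x j))) \<le> 64 * N * (N * (1 / 2 - ln 2) - u) + N * u - N * ln N / 2"
proof -
  interpret S: prob_space "sphere_measure :: 'a measure" by (rule prob_space_sphere_measure)
  have N: "N \<ge> 1" using card_ge_1 by (simp add: N_def)
  \<comment> \<open>Caps of measure \<open>b\<close> about the points are disjoint, by the separation.\<close>
  define b where "b = 1 / (64 * N)"
  have b: "0 < b" "b < 1" using N by (simp_all add: b_def field_simps)
  define R where "R = 2 * sqrt b"
  have R: "R > 0" "R\<^sup>2 = 1 / (16 * N)" using b N by (simp_all add: R_def power_mult_distrib b_def)
  define J where "J i z = (indicator {..R} (norm (x i - z)) :: real)" for i z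
  have Jm [measurable]: "J i \<in> borel_measurable borel" for i unfolding J_def by measurable
  define V where "V z = (\<Sum>i\<in>I. - ln (norm (x i - z))) - u" for z
  have V: "integrable sphere_measure V" "(\<integral>z. V z \<partial>sphere_measure) = N * (1 / 2 - ln 2) - u"
    using log_excess by (simp_all add: has_bochner_integral_iff V_def[abs_def] N_def)
  have V0: "AE z in sphere_measure. 0 \<le> V z" using AE_log_excess_nonneg by (simp add: V_def)
  have ind: "integrable sphere_measure (\<lambda>z. f z * J i z)" if f: "integrable sphere_measure f" for f :: "'a \<Rightarrow> real" and i
  proof (rule Bochner_Integration.integrable_bound[OF f])
    show "AE z in sphere_measure. norm (f z * J i z) \<le> norm (f z)" by (intro AE_I2) (simp add: J_def indicator_def)
  qed (use borel_measurable_integrable[OF f] in measurable)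
  have mJ: "(\<integral>z. J i z \<partial>sphere_measure) = b" if "i \<in> I" for i
    using integral_chord[OF I(3)[OF that], of "indicator {..R}"] measure_chord_cap(1)[OF dim b]
    by (simp add: J_def R_def)
  have iJ: "integrable sphere_measure (J i)" for i using ind[of "\<lambda>_. 1" i] by simp
  have iK: "integrable sphere_measure (\<lambda>z. - ln (norm (x i - z)))" if "i \<in> I" for i
    using integrable_sphere_ln[OF dim I(3)[OF that]] by (simp add: has_bochner_integral_iff)
  have one: "b * (\<Sum>j\<in>I - {i}. - ln (norm (x i - x j))) \<le> (\<integral>z. V z * J i z \<partial>sphere_measure) + b * (u + ln R)"
    if i: "i \<in> I" for i
  proof -
    have "b * (\<Sum>j\<in>I - {i}. - ln (norm (x i - x j))) = (\<Sum>j\<in>I - {i}. - ln (norm (x j - x i)) * b)"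
      by (simp add: sum_distrib_left norm_minus_commute mult.commute)
    also have "\<dots> \<le> (\<Sum>j\<in>I - {i}. (\<integral>z. - ln (norm (x j - z)) * J i z \<partial>sphere_measure))"
    proof (rule sum_mono)
      fix j assume j: "j \<in> I - {i}"
      have "b < 1 / (3 * N) / 4" using N by (simp add: b_def field_simps)
      also have "\<dots> \<le> (norm (x j - x i))\<^sup>2 / 4" using sep[of j i] i j by (simp add: N_def)
      finally show "- ln (norm (x j - x i)) * b \<le> (\<integral>z. - ln (norm (x j - z)) * J i z \<partial>sphere_measure)"
        unfolding J_def R_def using i j I b by (intro log_cap_mean dim) auto
    qed
    also have "\<dots> = (\<integral>z. (\<Sum>j\<in>I - {i}. - ln (norm (x j - z)) * J i z) \<partial>sphere_measure)"
      using iK ind by (intro Bochner_Integration.integral_sum[symmetric]) auto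
    also have "\<dots> \<le> (\<integral>z. V z * J i z + (u + ln R) * J i z \<partial>sphere_measure)"
    proof (rule integral_mono_AE)
      show "integrable sphere_measure (\<lambda>z. \<Sum>j\<in>I - {i}. - ln (norm (x j - z)) * J i z)"
        using iK ind by (intro Bochner_Integration.integrable_sum) auto
      show "integrable sphere_measure (\<lambda>z. V z * J i z + (u + ln R) * J i z)"
        using ind[OF V(1)] iJ by auto
      show "AE z in sphere_measure. (\<Sum>j\<in>I - {i}. - ln (norm (x j - z)) * J i z) \<le> V z * J i z + (u + ln R) * J i z"
        using AE_not_point
      proof eventually_elim
        case (elim z)
        show ?case
        proof (cases "norm (x i - z) \<le> R")
          case True
          have "ln (norm (x i - z)) \<le> ln R" using True elim i R by (intro ln_mono) auto
          \<comment> \<open>The own kernel is split off the potential; on the cap it is at least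
            \<open>- ln R\<close>.\<close>
          moreover have "V z + u = - ln (norm (x i - z)) + (\<Sum>j\<in>I - {i}. - ln (norm (x j - z)))"
            unfolding V_def using I i by (subst sum.remove[of I i]) auto
          ultimately have "(\<Sum>j\<in>I - {i}. - ln (norm (x j - z))) \<le> V z + (u + ln R)" by linarith
          thus ?thesis using True by (simp add: J_def)
        qed (simp add: J_def)
      qed
    qed
    also have "\<dots> = (\<integral>z. V z * J i z \<partial>sphere_measure) + b * (u + ln R)"
      using ind[OF V(1)] iJ mJ[OF i] by (subst Bochner_Integration.integral_add) auto
    finally show ?thesis .
  qed
  have disj: "(\<Sum>i\<in>I. V z * J i z) \<le> V z" if V: "0 \<le> V z" for z
  proof (cases "\<exists>i\<in>I. norm (x i - z) \<le> R")
    case True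
    then obtain i where i: "i \<in> I" "norm (x i - z) \<le> R" by blast
    have "J j z = 0" if j: "j \<in> I - {i}" for j
    proof (rule ccontr)
      assume "J j z \<noteq> 0"
      hence "norm (x j - z) \<le> R" by (simp add: J_def indicator_def split: if_splits)
      hence "norm (x i - x j) \<le> 2 * R"
        using i(2) norm_triangle_ineq4[of "x i - z" "x j - z"] by simp
      hence "(norm (x i - x j))\<^sup>2 \<le> (2 * R)\<^sup>2" by (intro power_mono) auto
      also have "\<dots> < 1 / (3 * N)" using R N by (simp add: power_mult_distrib field_simps)
      finally show False using sep[of i j] i j by (auto simp: N_def)
    qed
    hence "(\<Sum>i\<in>I. V z * J i z) = V z * J i z"
      using I i by (subst sum.remove[of I i]) auto
    thus ?thesis using i by (simp add: J_def)
  next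
    case False
    hence "(\<Sum>i\<in>I. V z * J i z) = 0" by (intro sum.neutral) (auto simp: J_def)
    thus ?thesis using V by simp
  qed
  have "(\<Sum>i\<in>I. \<integral>z. V z * J i z \<partial>sphere_measure) = (\<integral>z. (\<Sum>i\<in>I. V z * J i z) \<partial>sphere_measure)"
    using ind[OF V(1)] by (intro Bochner_Integration.integral_sum[symmetric]) auto
  also have "\<dots> \<le> (\<integral>z. V z \<partial>sphere_measure)"
    using V0 disj ind[OF V(1)] V(1) by (intro integral_mono_AE) (auto elim!: eventually_mono)
  finally have tot: "(\<Sum>i\<in>I. \<integral>z. V z * J i z \<partial>sphere_measure) \<le> N * (1 / 2 - ln 2) - u" using V(2) by simp
  have "b * (\<Sum>i\<in>I. \<Sum>j\<in>I - {i}. - ln (norm (x i - x j)))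
      \<le> (\<Sum>i\<in>I. (\<integral>z. V z * J i z \<partial>sphere_measure) + b * (u + ln R))"
    unfolding sum_distrib_left[of b] by (rule sum_mono) (use one in \<open>simp add: sum_distrib_left\<close>)
  also have "\<dots> \<le> N * (1 / 2 - ln 2) - u + N * b * (u + ln R)"
    using tot by (simp add: sum.distrib N_def)
  finally have "64 * N * (b * (\<Sum>i\<in>I. \<Sum>j\<in>I - {i}. - ln (norm (x i - x j))))
      \<le> 64 * N * (N * (1 / 2 - ln 2) - u + N * b * (u + ln R))"
    using N by (intro mult_left_mono) auto
  moreover have "64 * N * (b * E) = E" for E using N by (simp add: b_def)
  moreover have "64 * N * (e + N * b * w) = 64 * N * e + N * w" for e w using N by (simp add: b_def field_simps)
  ultimately have "(\<Sum>i\<in>I. \<Sum>j\<in>I - {i}. - ln (norm (x i - x j))) \<le> 64 * N * (N * (1 / 2 - ln 2) - u) + N * (u + ln R)"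
    by metis
  moreover have "ln R \<le> - ln N / 2"
  proof -
    have "2 * ln R = ln (1 / (16 * N))" using R by (simp add: ln_realpow flip: R(2))
    also have "\<dots> \<le> ln (1 / N)" using N by (intro ln_mono) (auto simp: field_simps)
    also have "\<dots> = - ln N" using N by (simp add: ln_div)
    finally show ?thesis by simp
  qed
  hence "N * ln R \<le> N * (- ln N / 2)" using N by (intro mult_left_mono) auto
  ultimately show ?thesis by (simp add: distrib_left)
qed

end

section \<open>The recursion for the deficit of a greedy sequence\<close>

context
  fixes x :: "nat \<Rightarrow> 'a::euclidean_space"
  assumes dim: "DIM('a) = 3" and greedy: "greedy_sequence 0 x"
begin

lemma dim_ge_2: "DIM('a) \<ge> 2"
  using dim by simp

lemmas greedyD = greedy_sequenceD[OF greedy order_refl dim_ge_2, unfolded kernel_real_def, simplified if_True]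

definition greedy_min :: "nat \<Rightarrow> real" where
  "greedy_min n = (\<Sum>i\<in>{1..n}. - ln (norm (x i - x (Suc n))))"

definition greedy_log_energy :: "nat \<Rightarrow> real" where
  "greedy_log_energy n = (\<Sum>i\<in>{1..n}. \<Sum>j\<in>{1..n} - {i}. - ln (norm (x i - x j)))"

text \<open>The constant \<open>1 / 2 - ln 2\<close> is the energy constant, so this is the energy
  difference with the sign reversed.\<close>

definition greedy_deficit :: "nat \<Rightarrow> real" where
  "greedy_deficit n = (real n)\<^sup>2 * (1 / 2 - ln 2) - greedy_log_energy n"

lemma greedy_min_le:
  assumes "n \<ge> 1" "norm y = 1" "y \<notin> x ` {1..n}"
  shows "greedy_min n \<le> (\<Sum>i\<in>{1..n}. - ln (norm (x i - y)))"
  unfolding greedy_min_def using greedyD(4)[OF assms] by simp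

lemma greedy_deficit_Suc:
  "greedy_deficit (Suc n) = greedy_deficit n + 2 * (real n * (1 / 2 - ln 2) - greedy_min n) + (1 / 2 - ln 2)"
proof -
  have "greedy_log_energy (Suc n) = greedy_log_energy n + 2 * greedy_min n"
    unfolding greedy_log_energy_def greedy_min_def
    by (rule offdiag_sum_Suc) (simp add: norm_minus_commute)
  moreover have "(real (Suc n))\<^sup>2 = (real n)\<^sup>2 + 2 * real n + 1"
    by (simp add: power2_eq_square algebra_simps)
  ultimately show ?thesis
    unfolding greedy_deficit_def by (simp add: algebra_simps)
qed

lemma greedy_deficit_1: "greedy_deficit 1 = 1 / 2 - ln 2"
  by (simp add: greedy_deficit_def greedy_log_energy_def)

lemma greedy_gain:
  assumes "n \<ge> 1"
  shows "real n * (1 / 2 - ln 2) - greedy_min n \<ge> 1 / 8"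
proof -
  have "greedy_min n \<le> real (card {1..n}) * (1 / 2 - ln 2) - 1 / 8"
    by (rule log_polarization[where x = x, OF dim]) (use assms greedyD(1) greedy_min_le[OF assms] in auto)
  thus ?thesis by simp
qed

text \<open>For one point the deficit is negative, and the general gain 1/8 does not outweigh this.
  The antipode as competitor gives the sharper \<open>greedy_min 1 \<le> - ln 2\<close>.\<close>

lemma greedy_deficit_2: "greedy_deficit 2 \<ge> 1 / 2"
proof -
  have x1: "norm (x 1) = 1" by (rule greedyD(1)) simp
  have "x 1 \<noteq> - x 1" using x1 by (auto simp: eq_neg_iff_add_eq_0 simp flip: scaleR_2)
  hence "greedy_min 1 \<le> (\<Sum>i\<in>{1..1}. - ln (norm (x i - - x 1)))"
    using x1 by (intro greedy_min_le) auto
  also have "\<dots> = - ln 2" using x1 by (simp flip: scaleR_2)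
  finally have "greedy_min 1 \<le> - ln 2" .
  moreover have "ln 2 \<le> (25 / 36 :: real)" by (rule ln2_le_25_over_36)
  moreover have "greedy_deficit (Suc 1) = greedy_deficit 1 + 2 * (real 1 * (1 / 2 - ln 2) - greedy_min 1) + (1 / 2 - ln 2)"
    by (rule greedy_deficit_Suc)
  moreover have "Suc 1 = 2" by simp
  ultimately show ?thesis using greedy_deficit_1 by (simp del: One_nat_def)
qed

text \<open>Each step adds at least \<open>2 / 8 + 1 / 2 - ln 2\<close>, which is positive because
  \<open>ln 2 \<le> 25 / 36\<close>.\<close>

lemma greedy_deficit_ge_half:
  assumes "n \<ge> 2"
  shows "greedy_deficit n \<ge> 1 / 2"
  using assms
proof (induction n rule: nat_induct_at_least)
  case base
  show ?case by (rule greedy_deficit_2)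
next
  case (Suc n)
  have "ln 2 \<le> (25 / 36 :: real)" by (rule ln2_le_25_over_36)
  moreover define e where "e = real n * (1 / 2 - ln 2) - greedy_min n"
  moreover have "e \<ge> 1 / 8"
    unfolding e_def using Suc.hyps by (intro greedy_gain) simp
  ultimately show ?case using greedy_deficit_Suc[of n, folded e_def] Suc.IH by linarith
qed

text \<open>At the step at which the later point \<open>x j\<close> was chosen it minimised the
  potential of the \<open>j - 1\<close> points before it, so \<open>log_separation\<close> applies
  to those; the bound only weakens as \<open>n\<close> grows.\<close>

lemma greedy_separation:
  assumes "1 \<le> i" "i < j" "j \<le> n"
  shows "(norm (x i - x j))\<^sup>2 \<ge> 1 / (3 * real n)"
proof -
  obtain m where m: "j = Suc m" using assms by (cases j) auto
  hence m1: "m \<ge> 1" "i \<in> {1..m}" using assms by auto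
  have "(norm (x i - x (Suc m)))\<^sup>2 \<ge> 1 / (3 * real (card {1..m}))"
  proof (rule log_separation[where x = x and u = "greedy_min m", OF dim])
    show "norm (x (Suc m)) = 1" by (rule greedyD(1)) simp
    show "x (Suc m) \<notin> x ` {1..m}" by (rule greedyD(2)[OF m1(1)])
    show "(\<Sum>i\<in>{1..m}. - ln (norm (x i - x (Suc m)))) \<le> greedy_min m" by (simp add: greedy_min_def)
  qed (use m1 greedyD(1) greedy_min_le[OF m1(1)] in auto)
  moreover have "1 / (3 * real n) \<le> 1 / (3 * real m)" using m1 m assms by (intro divide_left_mono) auto
  ultimately show ?thesis using m by simp
qed

text \<open>Writing the minimum as mean minus gain, the term \<open>n * greedy_min n\<close> in the
  energy bound contributes \<open>n\<^sup>2\<close> times the energy constant and takes back one of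
  the 64 multiples of the gain.\<close>

lemma greedy_deficit_le_gain:
  assumes n: "n \<ge> 1"
  shows "real n * ln (real n) / 2 - greedy_deficit n \<le> 63 * real n * (real n * (1 / 2 - ln 2) - greedy_min n)"
proof -
  have "greedy_log_energy n \<le> 64 * real (card {1..n}) * (real (card {1..n}) * (1 / 2 - ln 2) - greedy_min n)
      + real (card {1..n}) * greedy_min n - real (card {1..n}) * ln (real (card {1..n})) / 2"
    unfolding greedy_log_energy_def
  proof (rule log_energy_le[where x = x, OF dim])
    fix i j assume "i \<in> {1..n}" "j \<in> {1..n}" "i \<noteq> j"
    thus "(norm (x i - x j))\<^sup>2 \<ge> 1 / (3 * real (card {1..n}))"
      using greedy_separation[of i j n] greedy_separation[of j i n]
      by (cases "i < j") (auto simp: norm_minus_commute)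
  qed (use n greedyD(1) greedy_min_le[OF n] in auto)
  thus ?thesis by (simp add: greedy_deficit_def power2_eq_square algebra_simps)
qed

text \<open>
  The constants make \<open>n ln n / 65 - n\<close> a subsolution of the recursion
  \<open>g (n + 1) = g n * (1 - 2 / (63 n)) + ln n / 63 + (1 / 2 - ln 2)\<close>.
\<close>

lemma greedy_deficit_ge:
  assumes "n \<ge> 1"
  shows "greedy_deficit n \<ge> real n * ln (real n) / 65 - real n"
  using assms
proof (induction n rule: nat_induct_at_least)
  case base
  have "ln 2 \<le> (25 / 36 :: real)" by (rule ln2_le_25_over_36)
  thus ?case using greedy_deficit_1 by simp
next
  case (Suc n)
  define m where "m = real n"
  define L where "L = ln m"
  define g where "g = greedy_deficit n"
  define G where "G = m * (1 / 2 - ln 2) - greedy_min n"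
  have m: "m \<ge> 1" using Suc.hyps by (simp add: m_def)
  have L: "L \<ge> 0" using m by (simp add: L_def)
  have rec: "greedy_deficit (Suc n) = g + 2 * G + (1 / 2 - ln 2)"
    unfolding g_def G_def m_def by (rule greedy_deficit_Suc)
  have le: "m * L / 2 - g \<le> 63 * m * G"
    unfolding m_def L_def g_def G_def by (rule greedy_deficit_le_gain[OF Suc.hyps])
  have "(m * L / 2 - g) / m \<le> 63 * G"
    using le m by (simp add: pos_divide_le_eq mult_ac)
  moreover have "(m * L / 2 - g) / m = L / 2 - g / m" using m by (simp add: diff_divide_distrib)
  ultimately have gain: "2 * G \<ge> L / 63 - 2 / 63 * (g / m)" by linarith
  have IH: "g \<ge> m * (L / 65 - 1)" using Suc.IH by (simp add: g_def m_def L_def right_diff_distrib)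
  \<comment> \<open>The old deficit enters the recursion with a nonnegative factor, so its lower
    bound may be substituted.\<close>
  have "1 - 2 / (63 * m) \<ge> 0" using m by (simp add: field_simps)
  hence "(m * (L / 65 - 1)) * (1 - 2 / (63 * m)) \<le> g * (1 - 2 / (63 * m))"
    using IH by (intro mult_right_mono)
  moreover have "g * (1 - 2 / (63 * m)) = g - 2 / 63 * (g / m)" by (simp add: right_diff_distrib)
  moreover have "(m * a) * (1 - 2 / (63 * m)) = m * a - 2 / 63 * a" for a
    using m by (simp add: field_simps)
  note this[of "L / 65 - 1"]
  ultimately have lower: "greedy_deficit (Suc n) \<ge> m * (L / 65 - 1) - 2 / 63 * (L / 65 - 1) + L / 63 + (1 / 2 - ln 2)"
    using rec gain by linarith
  have "ln (m + 1) - L = ln ((m + 1) / m)" using m by (simp add: L_def ln_div)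
  also have "\<dots> \<le> (m + 1) / m - 1" using m by (intro ln_le_minus_one) auto
  also have "\<dots> = 1 / m" using m by (simp add: field_simps)
  finally have "(m + 1) * ln (m + 1) \<le> (m + 1) * (L + 1 / m)" using m by (intro mult_left_mono) auto
  also have "\<dots> = m * L + L + 1 + 1 / m" using m by (simp add: field_simps)
  also have "1 / m \<le> 1" using m by simp
  finally have step: "(m + 1) * ln (m + 1) \<le> m * L + L + 2" by simp
  have "ln 2 \<le> (25 / 36 :: real)" by (rule ln2_le_25_over_36)
  \<comment> \<open>Here 65 is 63 + 2, the value for which the coefficients of \<open>L\<close>
    agree: \<open>(1 - 2 / 65) / 63 = 1 / 65\<close>. The remainder 4/4095 is
    \<open>2 / 63 - 2 / 65\<close>.\<close>
  moreover have "m * (L / 65 - 1) - 2 / 63 * (L / 65 - 1) + L / 63 = (m * L + L + 2) / 65 - m + 4 / 4095"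
  proof -
    have "m * (L / 65 - 1) = m * L / 65 - m" by (simp add: right_diff_distrib)
    thus ?thesis by (simp add: add_divide_distrib diff_divide_distrib)
  qed
  moreover have "(m + 1) * ln (m + 1) / 65 \<le> (m * L + L + 2) / 65"
    using step by (rule divide_right_mono) simp
  ultimately have "greedy_deficit (Suc n) \<ge> (m + 1) * ln (m + 1) / 65 - (m + 1)"
    using lower by linarith
  thus ?case by (simp add: m_def add.commute)
qed

text \<open>The preceding bound is used for \<open>ln n \<ge> 130\<close>, and \<open>greedy_deficit n \<ge> 1 / 2\<close> otherwise.\<close>

lemma greedy_deficit_ge_mult_ln:
  assumes "n \<ge> 2"
  shows "greedy_deficit n \<ge> 1 / (260 * exp 130) * real n * ln (real n)"
proof -
  have n0: "real n * ln (real n) \<ge> 0" using assms by simp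
  have e: "(1::real) \<le> 2 * exp 130" using one_le_exp_iff[of "130::real"] by linarith
  show ?thesis
  proof (cases "ln (real n) \<ge> 130")
    case True
    have "1 / (260 * exp 130) * (real n * ln (real n)) \<le> 1 / 130 * (real n * ln (real n))"
      using n0 e by (intro mult_right_mono divide_left_mono) auto
    \<comment> \<open>The threshold 130 is twice 65, so half of the leading term absorbs
      \<open>n\<close>.\<close>
    also have "\<dots> \<le> real n * ln (real n) / 65 - real n"
      using mult_left_mono[OF True, of "real n"] by simp
    also have "\<dots> \<le> greedy_deficit n" using assms by (intro greedy_deficit_ge) simp
    finally show ?thesis by (simp only: mult.assoc)
  next
    case False
    have "real n = exp (ln (real n))" using assms by simp
    also have "\<dots> \<le> exp 130" using False by simp
    finally have "real n * ln (real n) \<le> exp 130 * 130" using False assms by (intro mult_mono) auto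
    hence "1 / (260 * exp 130) * (real n * ln (real n)) \<le> 1 / (260 * exp 130) * (exp 130 * 130)"
      by (intro mult_left_mono) auto
    also have "\<dots> = 1 / 2" by simp
    also have "\<dots> \<le> greedy_deficit n" using assms by (rule greedy_deficit_ge_half)
    finally show ?thesis by (simp only: mult.assoc)
  qed
qed

lemma greedy_riesz_energy_0:
  "riesz_energy 0 x n - ereal (sphere_energy TYPE('a) 0 * (real n)\<^sup>2) = ereal (- greedy_deficit n)"
proof -
  have "sphere_energy TYPE('a) 0 = 1 / 2 - ln 2"
    by (simp only: sphere_energy_eq integral_chord_neg_ln[OF dim] simp_thms if_True)
  moreover have "riesz_energy 0 x n = ereal (greedy_log_energy n)"
    unfolding greedy_log_energy_def using riesz_energy_eq[OF greedyD(3), of 0 n] by (simp add: kernel_real_def)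
  ultimately show ?thesis by (simp add: greedy_deficit_def mult.commute)
qed

end

lemma greedy_log_energy_bounds:
  assumes dim: "DIM('a::euclidean_space) = 3"
  shows "\<exists>c C :: real. c > 0 \<and> C > 0 \<and>
          (\<forall>x :: nat \<Rightarrow> 'a. greedy_sequence 0 x \<longrightarrow>
            (\<forall>N\<ge>2.
              ereal (- (1 / 2) * real N * ln (real N) - c * real N)
                \<le> riesz_energy 0 x N - ereal (sphere_energy TYPE('a) 0 * (real N)\<^sup>2) \<and>
              riesz_energy 0 x N - ereal (sphere_energy TYPE('a) 0 * (real N)\<^sup>2)
                \<le> ereal (- C * real N * ln (real N))))"
proof -
  obtain c where c: "c > 0"
    "\<And>I (x :: nat \<Rightarrow> 'a). finite I \<Longrightarrow> I \<noteq> {} \<Longrightarrow> (\<And>i. i \<in> I \<Longrightarrow> norm (x i) = 1) \<Longrightarrow> inj_on x I \<Longrightarrow>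
      (real (card I))\<^sup>2 * (\<integral>r. - ln r \<partial>chord_measure TYPE('a))
          - real (card I) * ln (real (card I)) / 2 - c * real (card I)
        \<le> (\<Sum>i\<in>I. \<Sum>j\<in>I - {i}. - ln (norm (x i - x j)))"
    by (rule log_energy_ge[OF dim, where 'i = nat]) blast
  have "ereal (- (1 / 2) * real N * ln (real N) - c * real N)
          \<le> riesz_energy 0 x N - ereal (sphere_energy TYPE('a) 0 * (real N)\<^sup>2) \<and>
        riesz_energy 0 x N - ereal (sphere_energy TYPE('a) 0 * (real N)\<^sup>2)
          \<le> ereal (- (1 / (260 * exp 130)) * real N * ln (real N))"
    if g: "greedy_sequence 0 x" and N: "N \<ge> 2" for x :: "nat \<Rightarrow> 'a" and N
  proof
    note D = greedyD[OF dim g]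
    have "(real (card {1..N}))\<^sup>2 * (\<integral>r. - ln r \<partial>chord_measure TYPE('a))
          - real (card {1..N}) * ln (real (card {1..N})) / 2 - c * real (card {1..N})
        \<le> greedy_log_energy x N"
      unfolding greedy_log_energy_def[OF dim g]
      by (rule c(2)) (use N D(1) inj_on_subset[OF D(3), of "{1..N}"] in auto)
    hence "(real N)\<^sup>2 * (1 / 2 - ln 2) - real N * ln (real N) / 2 - c * real N \<le> greedy_log_energy x N"
      unfolding integral_chord_neg_ln[OF dim] by simp
    thus "ereal (- (1 / 2) * real N * ln (real N) - c * real N)
        \<le> riesz_energy 0 x N - ereal (sphere_energy TYPE('a) 0 * (real N)\<^sup>2)"
      unfolding greedy_riesz_energy_0[OF dim g] greedy_deficit_def[OF dim g] by simp
    show "riesz_energy 0 x N - ereal (sphere_energy TYPE('a) 0 * (real N)\<^sup>2)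
        \<le> ereal (- (1 / (260 * exp 130)) * real N * ln (real N))"
      unfolding greedy_riesz_energy_0[OF dim g] using greedy_deficit_ge_mult_ln[OF dim g N] by simp
  qed
  thus ?thesis using c(1) by (intro exI[of _ c] exI[of _ "1 / (260 * exp 130)"]) auto
qed

theorem theorem1p4:
  fixes d :: nat
  assumes "d \<ge> 2" and "CARD('n::finite) = d + 1"
  shows
    "(\<forall>s::real. real d - 2 \<le> s \<and> s < real d \<and> s > 0 \<longrightarrow>
        (\<exists>c C :: real. c > 0 \<and> C > 0 \<and>
          (\<forall>x :: nat \<Rightarrow> real ^ 'n. greedy_sequence s x \<longrightarrow>
            (\<forall>N\<ge>2.
              ereal (- c * real N powr (1 + s / real d))
                \<le> riesz_energy s x N - ereal (sphere_energy TYPE(real ^ 'n) s * (real N)\<^sup>2) \<and>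
              riesz_energy s x N - ereal (sphere_energy TYPE(real ^ 'n) s * (real N)\<^sup>2)
                \<le> ereal (- C * real N powr (1 + s / real d))))))
     \<and>
     (d = 2 \<longrightarrow>
        (\<exists>c C :: real. c > 0 \<and> C > 0 \<and>
          (\<forall>x :: nat \<Rightarrow> real ^ 'n. greedy_sequence 0 x \<longrightarrow>
            (\<forall>N\<ge>2.
              ereal (- (1 / 2) * real N * ln (real N) - c * real N)
                \<le> riesz_energy 0 x N - ereal (sphere_energy TYPE(real ^ 'n) 0 * (real N)\<^sup>2) \<and>
              riesz_energy 0 x N - ereal (sphere_energy TYPE(real ^ 'n) 0 * (real N)\<^sup>2)
                \<le> ereal (- C * real N * ln (real N))))))"
proof (intro conjI allI impI)
  fix s :: real
  assume "real d - 2 \<le> s \<and> s < real d \<and> s > 0"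
  thus "\<exists>c C :: real. c > 0 \<and> C > 0 \<and>
          (\<forall>x :: nat \<Rightarrow> real ^ 'n. greedy_sequence s x \<longrightarrow>
            (\<forall>N\<ge>2.
              ereal (- c * real N powr (1 + s / real d))
                \<le> riesz_energy s x N - ereal (sphere_energy TYPE(real ^ 'n) s * (real N)\<^sup>2) \<and>
              riesz_energy s x N - ereal (sphere_energy TYPE(real ^ 'n) s * (real N)\<^sup>2)
                \<le> ereal (- C * real N powr (1 + s / real d))))"
    using assms by (intro greedy_riesz_energy_bounds) auto
next
  assume "d = 2"
  hence "DIM(real ^ 'n) = 3" using assms by simp
  thus "\<exists>c C :: real. c > 0 \<and> C > 0 \<and>
          (\<forall>x :: nat \<Rightarrow> real ^ 'n. greedy_sequence 0 x \<longrightarrow>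
            (\<forall>N\<ge>2.
              ereal (- (1 / 2) * real N * ln (real N) - c * real N)
                \<le> riesz_energy 0 x N - ereal (sphere_energy TYPE(real ^ 'n) 0 * (real N)\<^sup>2) \<and>
              riesz_energy 0 x N - ereal (sphere_energy TYPE(real ^ 'n) 0 * (real N)\<^sup>2)
                \<le> ereal (- C * real N * ln (real N))))"
    by (rule greedy_log_energy_bounds)
qed


end
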